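(* For each dimension $d$ let $\kappa_d>0$, let $R_d$ be a real random variable with $R_d>0$ almost surely, $\rho_d=\mathbb E R_d$, $\epsilon_d=\operatorname{sd}(R_d)>0$, $\xi_d=(R_d-\rho_d)/\epsilon_d$, and let $U_d\sim\operatorname{Unif}(S^{d-1})$ be independent of $R_d$. Assume that, as $d\to\infty$, $\xi_d\Rightarrow\Xi$ in distribution for some random variable $\Xi$, and that $$b_d=\kappa_d\epsilon_d\coth(\kappa_d\rho_d)\to0 .$$ Put $\lambda_{d,\mathbb H}=\sqrt d\,b_d$. Let $(R_{0,d},U_{0,d})$ (query) and $(R_{i,d},U_{i,d})$, $i=1,2,3$ (prototypes) be independent copies of $(R_d,U_d)$, regarded as geodesic polar coordinates of points in the hyperbolic space $\mathbb H^d_{-\kappa_d^2}$ of curvature $-\kappa_d^2$, and let $\xi_{i,d}=(R_{i,d}-\rho_d)/\epsilon_d$. Then the farthest ordering, i.e. the ordering over $i=1,2,3$ of $$C_{i,d}=\cosh(\kappa_dR_{0,d})\cosh(\kappa_dR_{i,d})-\sinh(\kappa_dR_{0,d})\sinh(\kappa_dR_{i,d})\langle U_{0,d},U_{i,d}\rangle$$ (the hyperbolic cosine of $\kappa_d$ times the distance from the query to prototype $i$), is the ordering of scores $$S^{\mathbb H}_{i,d}=\lambda_{d,\mathbb H}\,\xi_{i,d}-Z_{i,d}+r^{\mathbb H}_{i,d},\qquad Z_{i,d}=\sqrt d\,\langle U_{0,d},U_{i,d}\rangle,\qquad i=1,2,3,$$ where, conditionally on the prototypes, $(Z_{1,d},Z_{2,d},Z_{3,d})\Rightarrow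 N(0,I_3)$ in probability, and the random remainders $r^{\mathbb H}_{i,d}$ are $o_p(1)$ if $\lambda_{d,\mathbb H}=O(1)$ and $o_p(\lambda_{d,\mathbb H})$ if $\lambda_{d,\mathbb H}\to\infty$.
   Context: "The ordering of $C_{i,d}$ is the ordering of the scores" means that $C_{i,d}\le C_{j,d}$ if and only if $S^{\mathbb H}_{i,d}\le S^{\mathbb H}_{j,d}$, for all $i,j\in\{1,2,3\}$ (almost surely). "Conditionally on the prototypes, $\ldots\Rightarrow N(0,I_3)$ in probability" means that the conditional law of $(Z_{1,d},Z_{2,d},Z_{3,d})$ given the prototypes converges weakly to $N(0,I_3)$ in probability, i.e. for every bounded continuous $f:\mathbb R^3\to\mathbb R$ the conditional expectation of $f(Z_{1,d},Z_{2,d},Z_{3,d})$ given the prototypes converges in probability to $\mathbb E f(Z)$ with $Z\sim N(0,I_3)$. A sequence of random variables is $o_p(a_d)$ if its quotient by $a_d$ converges to $0$ in probability as $d\to\infty$. *)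

theory Defs
  imports "HOL-Probability.Probability" "HOL-Library.Landau_Symbols"
begin

text \<open>Since the dimension varies along a sequence, a vector of dimension \<open>d\<close> is a function on
  \<open>{..<d}\<close>, extended by \<^const>\<open>undefined\<close>.\<close>

definition vec_borel :: "nat \<Rightarrow> (nat \<Rightarrow> real) measure" where
  "vec_borel d = Pi\<^sub>M {..<d} (\<lambda>_. borel)"

definition dotp :: "nat \<Rightarrow> (nat \<Rightarrow> real) \<Rightarrow> (nat \<Rightarrow> real) \<Rightarrow> real" where
  "dotp d x y = (\<Sum>k<d. x k * y k)"

definition vnorm :: "nat \<Rightarrow> (nat \<Rightarrow> real) \<Rightarrow> real" where
  "vnorm d x = sqrt (dotp d x x)"

definition punctured_ball :: "nat \<Rightarrow> (nat \<Rightarrow> real) set" where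
  "punctured_ball d = {x \<in> extensional {..<d}. 0 < vnorm d x \<and> vnorm d x \<le> 1}"

text \<open>Normalised surface measure on the unit sphere: the measure of a set \<open>A\<close> of directions is
  the normalised Lebesgue measure of the cone \<open>{t x | 0 < t \<le> 1, x \<in> A}\<close>.  Meaningful for \<open>d \<ge> 1\<close>;
  for \<open>d = 1\<close> it is the uniform distribution on \<open>{-1, 1}\<close>.\<close>

definition unif_sphere :: "nat \<Rightarrow> (nat \<Rightarrow> real) measure" where
  "unif_sphere d =
     distr (uniform_measure (Pi\<^sub>M {..<d} (\<lambda>_. lborel)) (punctured_ball d)) (vec_borel d)
       (\<lambda>x. \<lambda>k\<in>{..<d}. x k / vnorm d x)"

lemma dotp_measurable [measurable]:
  "(\<lambda>x. dotp d x x) \<in> borel_measurable (Pi\<^sub>M {..<d} (\<lambda>_. lborel))"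
  unfolding dotp_def by measurable

lemma vnorm_measurable [measurable]:
  "vnorm d \<in> borel_measurable (Pi\<^sub>M {..<d} (\<lambda>_. lborel))"
  unfolding vnorm_def by measurable

lemma dotp_self_nonneg: "0 \<le> dotp d x x"
  unfolding dotp_def by (intro sum_nonneg) auto

lemma punctured_ball_sets [measurable]:
  "punctured_ball d \<in> sets (Pi\<^sub>M {..<d} (\<lambda>_. lborel))"
proof -
  have "punctured_ball d
      = {x \<in> space (Pi\<^sub>M {..<d} (\<lambda>_. lborel)). 0 < vnorm d x \<and> vnorm d x \<le> 1}"
    unfolding punctured_ball_def space_PiM PiE_def by auto
  then show ?thesis by simp
qed

lemma prob_space_unif_sphere:
  assumes "d \<ge> 1"
  shows "prob_space (unif_sphere d)"
proof -
  interpret product_sigma_finite "\<lambda>_::nat. lborel :: real measure" ..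
  let ?L = "Pi\<^sub>M {..<d} (\<lambda>_. lborel :: real measure)"
  have box: "emeasure ?L (Pi\<^sub>E {..<d} (\<lambda>_. {a..b})) = ennreal (b - a) ^ d" if "a \<le> b" for a b :: real
    using that by (subst emeasure_PiM) auto
  have "punctured_ball d \<subseteq> Pi\<^sub>E {..<d} (\<lambda>_. {-1..1})"
  proof
    fix x assume x: "x \<in> punctured_ball d"
    have "\<bar>x k\<bar> \<le> 1" if "k < d" for k
    proof -
      have "(x k)\<^sup>2 \<le> dotp d x x"
        unfolding dotp_def power2_eq_square using that
        by (intro member_le_sum) auto
      also have "\<dots> \<le> 1"
        using x by (auto simp: punctured_ball_def vnorm_def)
      finally show ?thesis by (simp add: abs_square_le_1)
    qed
    then show "x \<in> Pi\<^sub>E {..<d} (\<lambda>_. {-1..1})"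
      using x by (auto simp: punctured_ball_def PiE_def abs_le_iff minus_le_iff)
  qed
  then have "emeasure ?L (punctured_ball d) \<le> emeasure ?L (Pi\<^sub>E {..<d} (\<lambda>_. {-1..1}))"
    by (intro emeasure_mono) (auto intro!: sets_PiM_I_finite)
  also have "\<dots> < \<infinity>"
    by (subst box) (auto simp del: ennreal_numeral simp: ennreal_power simp flip: ennreal_numeral)
  finally have fin: "emeasure ?L (punctured_ball d) \<noteq> \<infinity>" by simp
  have "Pi\<^sub>E {..<d} (\<lambda>_. {1 / (2 * real d)..1 / real d}) \<subseteq> punctured_ball d"
  proof
    fix x assume x: "x \<in> Pi\<^sub>E {..<d} (\<lambda>_. {1 / (2 * real d)..1 / real d})"
    then have b: "1 / (2 * real d) \<le> x k" "x k \<le> 1 / d" if "k < d" for k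
      using that by (auto dest!: PiE_mem)
    have pos: "0 < x k" if "k < d" for k
      using b(1)[OF that] assms by (smt (verit) zero_less_divide_1_iff of_nat_0_less_iff less_le_trans mult_pos_pos zero_less_one)
    have "0 < dotp d x x"
      unfolding dotp_def using pos assms by (intro sum_pos) (auto simp: lessThan_empty_iff)
    moreover have "dotp d x x \<le> (\<Sum>k<d. 1 / real d * 1)"
      unfolding dotp_def
    proof (intro sum_mono mult_mono)
      fix k assume k: "k \<in> {..<d}"
      show "x k \<le> 1 / real d" using b k by simp
      have "1 / real d \<le> 1" using assms by simp
      with b(2)[of k] k show "x k \<le> 1" by (meson lessThan_iff order_trans)
      show "0 \<le> x k" using pos[of k] k by simp
    qed simp
    ultimately show "x \<in> punctured_ball d"
      using x assms by (auto simp: punctured_ball_def vnorm_def PiE_def)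
  qed
  then have "emeasure ?L (Pi\<^sub>E {..<d} (\<lambda>_. {1 / (2 * real d)..1 / real d}))
      \<le> emeasure ?L (punctured_ball d)"
    by (intro emeasure_mono) auto
  moreover have "0 < emeasure ?L (Pi\<^sub>E {..<d} (\<lambda>_. {1 / (2 * real d)..1 / real d}))"
    using assms by (subst box) (auto simp: field_simps ennreal_power zero_less_power)
  ultimately have "emeasure ?L (punctured_ball d) \<noteq> 0" by auto
  from this fin have "prob_space (uniform_measure ?L (punctured_ball d))"
    by (rule prob_space_uniform_measure)
  moreover have "(\<lambda>x. \<lambda>k\<in>{..<d}. x k / vnorm d x)
      \<in> measurable (uniform_measure ?L (punctured_ball d)) (vec_borel d)"
    unfolding vec_borel_def by measurable
  ultimately show ?thesis
    unfolding unif_sphere_def by (rule prob_space.prob_space_distr)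
qed

lemma normalise_on_sphere:
  assumes "x \<in> punctured_ball d"
  shows "vnorm d (\<lambda>k\<in>{..<d}. x k / vnorm d x) = 1"
proof -
  have pos: "0 < vnorm d x" using assms by (simp add: punctured_ball_def)
  have "dotp d (\<lambda>k\<in>{..<d}. x k / vnorm d x) (\<lambda>k\<in>{..<d}. x k / vnorm d x)
      = dotp d x x / (vnorm d x)\<^sup>2"
    unfolding dotp_def sum_divide_distrib
    by (intro sum.cong) (auto simp: power2_eq_square)
  also have "\<dots> = 1"
    using pos dotp_self_nonneg[of d x] by (simp add: vnorm_def)
  finally show ?thesis by (simp add: vnorm_def)
qed

text \<open>Hyperboloid model of the space of dimension \<open>d\<close> and curvature \<open>-\<kappa>\<^sup>2\<close>, in Minkowski space
  with time coordinate first and origin \<open>(1 / \<kappa>, 0)\<close>.\<close>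

definition minkowski :: "nat \<Rightarrow> real \<times> (nat \<Rightarrow> real) \<Rightarrow> real \<times> (nat \<Rightarrow> real) \<Rightarrow> real" where
  "minkowski d p q = dotp d (snd p) (snd q) - fst p * fst q"

definition hyperboloid :: "real \<Rightarrow> nat \<Rightarrow> (real \<times> (nat \<Rightarrow> real)) set" where
  "hyperboloid \<kappa> d =
     {p. 0 < fst p \<and> snd p \<in> extensional {..<d} \<and> minkowski d p p = - 1 / \<kappa>\<^sup>2}"

definition hyp_dist :: "real \<Rightarrow> nat \<Rightarrow> real \<times> (nat \<Rightarrow> real) \<Rightarrow> real \<times> (nat \<Rightarrow> real) \<Rightarrow> real" where
  "hyp_dist \<kappa> d p q = arcosh (- \<kappa>\<^sup>2 * minkowski d p q) / \<kappa>"

text \<open>The point with geodesic polar coordinates \<open>(r, u)\<close> about the origin.\<close>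

definition hyp_polar :: "real \<Rightarrow> nat \<Rightarrow> real \<Rightarrow> (nat \<Rightarrow> real) \<Rightarrow> real \<times> (nat \<Rightarrow> real)" where
  "hyp_polar \<kappa> d r u = (cosh (\<kappa> * r) / \<kappa>, \<lambda>k\<in>{..<d}. sinh (\<kappa> * r) / \<kappa> * u k)"

lemma minkowski_hyp_polar:
  "minkowski d (hyp_polar \<kappa> d r u) (hyp_polar \<kappa> d s v)
     = (sinh (\<kappa> * r) * sinh (\<kappa> * s) * dotp d u v - cosh (\<kappa> * r) * cosh (\<kappa> * s)) / \<kappa>\<^sup>2"
proof -
  have "dotp d (\<lambda>k\<in>{..<d}. sinh (\<kappa> * r) / \<kappa> * u k) (\<lambda>k\<in>{..<d}. sinh (\<kappa> * s) / \<kappa> * v k)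
      = sinh (\<kappa> * r) * sinh (\<kappa> * s) / \<kappa>\<^sup>2 * dotp d u v"
    unfolding dotp_def sum_distrib_left
    by (intro sum.cong) (auto simp: power2_eq_square)
  then show ?thesis
    unfolding minkowski_def hyp_polar_def
    by (simp add: power2_eq_square diff_divide_distrib)
qed

lemma hyp_polar_in_hyperboloid:
  assumes "\<kappa> > 0" and "vnorm d u = 1"
  shows "hyp_polar \<kappa> d r u \<in> hyperboloid \<kappa> d"
proof -
  have "dotp d u u = 1" using assms(2) by (simp add: vnorm_def)
  then have "minkowski d (hyp_polar \<kappa> d r u) (hyp_polar \<kappa> d r u) = - 1 / \<kappa>\<^sup>2"
    unfolding minkowski_hyp_polar
    by (simp add: power2_eq_square[symmetric] cosh_square_eq)
  then show ?thesis
    using assms(1) by (auto simp: hyperboloid_def hyp_polar_def cosh_real_pos)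
qed

lemma hyp_dist_origin:
  assumes "\<kappa> > 0" and "r \<ge> 0"
  shows "hyp_dist \<kappa> d (hyp_polar \<kappa> d 0 v) (hyp_polar \<kappa> d r u) = r"
  using assms by (simp add: hyp_dist_def minkowski_hyp_polar arcosh_cosh_real)

definition tendsto_in_prob :: "(nat \<Rightarrow> 'a measure) \<Rightarrow> (nat \<Rightarrow> 'a \<Rightarrow> real) \<Rightarrow> real \<Rightarrow> bool" where
  "tendsto_in_prob M X c \<longleftrightarrow>
     (\<forall>e>0. (\<lambda>n. measure (M n) {\<omega> \<in> space (M n). \<bar>X n \<omega> - c\<bar> > e}) \<longlonglongrightarrow> 0)"

definition small_op :: "(nat \<Rightarrow> 'a measure) \<Rightarrow> (nat \<Rightarrow> 'a \<Rightarrow> real) \<Rightarrow> (nat \<Rightarrow> real) \<Rightarrow> bool" where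
  "small_op M X a \<longleftrightarrow> tendsto_in_prob M (\<lambda>n \<omega>. X n \<omega> / a n) 0"

definition coth :: "real \<Rightarrow> real" where
  "coth x = cosh x / sinh x"

text \<open>The distribution \<open>N(0, I\<^sub>3)\<close>, with three-dimensional space as a product of lines.\<close>

definition std_normal3 :: "(real \<times> real \<times> real) measure" where
  "std_normal3 =
     density lborel std_normal_density \<Otimes>\<^sub>M
       (density lborel std_normal_density \<Otimes>\<^sub>M density lborel std_normal_density)"

definition prototype_algebra ::
  "'a measure \<Rightarrow> nat \<Rightarrow> (nat \<Rightarrow> 'a \<Rightarrow> real) \<Rightarrow> (nat \<Rightarrow> 'a \<Rightarrow> nat \<Rightarrow> real) \<Rightarrow> 'a measure" where
  "prototype_algebra M d R U =
     vimage_algebra (space M) (\<lambda>\<omega>. \<lambda>i\<in>{1..3}. (R i \<omega>, U i \<omega>))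
       (Pi\<^sub>M {1..3} (\<lambda>_. borel \<Otimes>\<^sub>M vec_borel d))"

end

theory Submission
  imports Defs
begin

text \<open>An increasing affine map that is common to the prototypes does not change the ordering of the
\<open>C i\<close>. Dividing \<open>C i\<close> by \<open>sinh (\<kappa> * R 0) * sinh (\<kappa> * \<rho>) / sqrt d > 0\<close>
and subtracting a number that does not depend on \<open>i\<close> leaves
\<open>sqrt d * coth (\<kappa> * R 0) * (cosh (\<kappa> * R i) - cosh (\<kappa> * \<rho>)) / sinh (\<kappa> * \<rho>)
  - sinh (\<kappa> * R i) / sinh (\<kappa> * \<rho>) * Z i\<close>,
so this is the score, and the remainder is defined as its difference from \<open>lam * \<xi> i - Z i\<close>
(\<open>ordering_by_scores\<close>).

The remainder is small because \<open>b\<close> is. Write \<open>\<kappa> * R i = \<kappa> * \<rho> + x i\<close> with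
\<open>x i = \<kappa> * \<epsilon> * \<xi> i\<close>. The variables \<open>\<xi> i\<close> have mean 0 and variance 1, so by Chebyshev
they are bounded by a large \<open>K\<close> with high probability, and then \<open>coth (\<kappa> * \<rho>) * \<bar>x i\<bar> \<le> b * K\<close> is
small. By the addition theorems this makes the ratios \<open>sinh (\<kappa> * R i) / sinh (\<kappa> * \<rho>)\<close> and
\<open>cosh (\<kappa> * R i) / cosh (\<kappa> * \<rho>)\<close> close to 1, and the first term of the score equal to
\<open>lam * \<xi> i\<close> up to a small multiple of \<open>lam\<close>. If also \<open>\<bar>Z i\<bar> \<le> K\<close>, the remainder is at most
\<open>40 * b * K\<^sup>2 * (1 + lam)\<close> (\<open>remainder_bound\<close>), which covers both regimes of \<open>lam\<close>.

For the normal limit, the query direction is independent of the prototypes, so the conditional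
expectation is the integral of \<open>f (sqrt d * \<langle>x, u\<^sub>1\<rangle>, sqrt d * \<langle>x, u\<^sub>2\<rangle>, sqrt d * \<langle>x, u\<^sub>3\<rangle>)\<close> over the
uniform \<open>x\<close> on the sphere, evaluated at the directions of the prototypes (\<open>real_cond_exp_indep\<close>). A uniform
direction is \<open>g / \<bar>g\<bar>\<close> for a standard Gaussian vector \<open>g\<close> (\<open>distr_normalise_gauss\<close>). Since
\<open>\<bar>g\<bar>\<^sup>2 / d\<close> is close to 1, the normalisation may be dropped (\<open>gauss_rescaling\<close>), and the
three numbers \<open>\<langle>g, u\<^sub>i\<rangle>\<close> are exactly jointly normal: their law is the image of the standard normal law
of three-dimensional space under a Cholesky factor of the Gram matrix of \<open>u\<^sub>1, u\<^sub>2, u\<^sub>3\<close>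
(\<open>gauss_triangular\<close>). That factor depends continuously on the Gram matrix, so for nearly
orthonormal directions the integral is close to the one for \<open>N(0, I\<^sub>3)\<close>
(\<open>sphere_projections_near_normal\<close>). Independent uniform directions are nearly orthogonal with high
probability (\<open>indep_dotp_tail\<close>), which gives convergence in probability.\<close>

section \<open>Standard Gaussian vectors\<close>

definition gauss :: "nat \<Rightarrow> (nat \<Rightarrow> real) measure" where
  "gauss d = Pi\<^sub>M {..<d} (\<lambda>_. std_normal_distribution)"

abbreviation normalise :: "nat \<Rightarrow> (nat \<Rightarrow> real) \<Rightarrow> nat \<Rightarrow> real" where
  "normalise d x \<equiv> (\<lambda>k\<in>{..<d}. x k / vnorm d x)"

lemma prob_space_std_normal: "prob_space std_normal_distribution"
  by (rule prob_space_normal_density) simp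

lemma sets_gauss [measurable_cong]: "sets (gauss d) = sets (vec_borel d)"
  unfolding gauss_def vec_borel_def by (intro sets_PiM_cong) auto

lemma prob_space_gauss: "prob_space (gauss d)"
  unfolding gauss_def by (intro prob_space_PiM prob_space_std_normal)

lemma dotp_measurable_pair [measurable (raw)]:
  assumes [measurable]: "f \<in> measurable M (vec_borel d)" "g \<in> measurable M (vec_borel d)"
  shows "(\<lambda>x. dotp d (f x) (g x)) \<in> borel_measurable M"
proof -
  have "(\<lambda>x. f x k) \<in> borel_measurable M" "(\<lambda>x. g x k) \<in> borel_measurable M" if "k < d" for k
    using that assms unfolding vec_borel_def
    by (auto intro!: measurable_compose[OF _ measurable_component_singleton])
  then show ?thesis unfolding dotp_def by (auto intro!: borel_measurable_sum)
qed

lemma vnorm_measurable_vec [measurable (raw)]: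
  assumes [measurable]: "f \<in> measurable M (vec_borel d)"
  shows "(\<lambda>x. vnorm d (f x)) \<in> borel_measurable M"
  unfolding vnorm_def by measurable

lemma normalise_measurable [measurable]: "normalise d \<in> measurable (vec_borel d) (vec_borel d)"
proof -
  have "(\<lambda>x. x k / vnorm d x) \<in> borel_measurable (vec_borel d)" if "k < d" for k
    by (intro borel_measurable_divide vnorm_measurable_vec)
       (use that in \<open>auto simp: vec_borel_def\<close>)
  then show ?thesis by (subst (2) vec_borel_def) (auto intro!: measurable_restrict)
qed

lemma dotp_scaleL: "dotp d (\<lambda>k\<in>{..<d}. c * x k) y = c * dotp d x y"
  unfolding dotp_def sum_distrib_left by (intro sum.cong) auto

lemma dotp_commute: "dotp d x y = dotp d y x"
  by (simp add: dotp_def mult.commute)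

lemma dotp_scaleR: "dotp d y (\<lambda>k\<in>{..<d}. c * x k) = c * dotp d y x"
  using dotp_scaleL[of d c x y] by (simp add: dotp_commute)

lemma vnorm_scale: "0 \<le> c \<Longrightarrow> vnorm d (\<lambda>k\<in>{..<d}. c * x k) = c * vnorm d x"
  by (simp add: vnorm_def dotp_scaleL dotp_scaleR real_sqrt_mult)

lemma vnorm_nonneg: "0 \<le> vnorm d x"
  by (simp add: vnorm_def dotp_self_nonneg)

lemma normalise_scale: "0 < c \<Longrightarrow> normalise d (\<lambda>k\<in>{..<d}. c * x k) = normalise d x"
  by (auto simp: vnorm_scale)

lemma vnorm_pow2: "(vnorm d x)\<^sup>2 = (\<Sum>k<d. (x k)\<^sup>2)"
  by (simp add: vnorm_def dotp_self_nonneg) (simp add: dotp_def power2_eq_square)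

interpretation lebesgue_product: product_sigma_finite "\<lambda>_::nat. lborel :: real measure" ..

abbreviation leb :: "nat \<Rightarrow> (nat \<Rightarrow> real) measure" where
  "leb d \<equiv> Pi\<^sub>M {..<d} (\<lambda>_. lborel)"

lemma sets_leb: "sets (leb d) = sets (vec_borel d)"
  unfolding vec_borel_def by (intro sets_PiM_cong) auto

text \<open>The factor \<open>r ^ d\<close> is checked on boxes, which determine a measure on the product space.\<close>

lemma leb_scale:
  assumes "0 < r" and A: "A \<in> sets (leb d)"
  shows "emeasure (leb d) ((\<lambda>x. \<lambda>k\<in>{..<d}. x k / r) -` A \<inter> space (leb d))
    = ennreal (r ^ d) * emeasure (leb d) A"
proof -
  let ?f = "\<lambda>x. \<lambda>k\<in>{..<d}. (x k / r :: real)"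
  have f [measurable]: "?f \<in> measurable (leb d) (leb d)" by measurable
  have inv: "ennreal (1 / c) * (ennreal c * y) = y" "ennreal c * (ennreal (1 / c) * y) = y" if "0 < c" for c y
  proof -
    have c: "ennreal (1 / c) * ennreal c = 1"
      using that by (subst ennreal_mult[symmetric]) auto
    show "ennreal (1 / c) * (ennreal c * y) = y"
      by (subst mult.assoc[symmetric], subst c) (rule mult_1)
    show "ennreal c * (ennreal (1 / c) * y) = y"
      by (subst mult.left_commute, subst mult.assoc[symmetric], subst c) (rule mult_1)
  qed
  have pow: "0 < r ^ d" using assms by simp
  have "leb d = density (distr (leb d) (leb d) ?f) (\<lambda>_. ennreal (1 / r ^ d))"
  proof (rule lebesgue_product.PiM_eqI[symmetric])
    fix A :: "nat \<Rightarrow> real set" assume A: "\<And>i. i \<in> {..<d} \<Longrightarrow> A i \<in> sets lborel"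
    have m: "emeasure lborel ((\<lambda>x. x / r) -` B) = ennreal r * emeasure lborel B" if "B \<in> sets borel" for B
    proof -
      have "lborel = density (distr lborel borel (\<lambda>x. x / r)) (\<lambda>_. ennreal \<bar>1 / r\<bar>)"
        using lborel_real_affine[of "1 / r" 0] assms by simp
      then have "emeasure lborel B = emeasure (density (distr lborel borel (\<lambda>x. x / r)) (\<lambda>_. ennreal \<bar>1
        / r\<bar>)) B"
        by (rule arg_cong)
      also have "\<dots> = ennreal (1 / r) * emeasure lborel ((\<lambda>x. x / r) -` B)"
        using that assms by (simp add: emeasure_density nn_integral_cmult_indicator emeasure_distr)
      finally show ?thesis
        by (simp only: inv(2)[OF assms(1)])
    qed
    have meas: "(\<lambda>x. x / r) -` B \<in> sets borel" if "B \<in> sets borel" for B :: "real set"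
      using measurable_sets[of "\<lambda>x. x / r" borel borel B] that by simp
    have pre: "?f -` (Pi\<^sub>E {..<d} A) \<inter> space (leb d) = Pi\<^sub>E {..<d} (\<lambda>i. (\<lambda>x. x / r) -` A i)"
      by (auto simp: space_PiM PiE_iff extensional_def)
    have box: "Pi\<^sub>E {..<d} A \<in> sets (leb d)" using A by (intro sets_PiM_I_finite) auto
    have "emeasure (density (distr (leb d) (leb d) ?f) (\<lambda>_. ennreal (1 / r ^ d))) (Pi\<^sub>E {..<d} A)
       = ennreal (1 / r ^ d) * emeasure (leb d) (Pi\<^sub>E {..<d} (\<lambda>i. (\<lambda>x. x / r) -` A i))"
      using box by (simp add: emeasure_density nn_integral_cmult_indicator emeasure_distr pre)
    also have "emeasure (leb d) (Pi\<^sub>E {..<d} (\<lambda>i. (\<lambda>x. x / r) -` A i))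
      = (\<Prod>i<d. emeasure lborel ((\<lambda>x. x / r) -` A i))"
      using A by (intro lebesgue_product.emeasure_PiM) (auto intro!: meas)
    also have "\<dots> = (\<Prod>i<d. ennreal r * emeasure lborel (A i))"
      using A m by (intro prod.cong) auto
    also have "\<dots> = ennreal (r ^ d) * (\<Prod>i<d. emeasure lborel (A i))"
      using assms by (simp add: prod.distrib ennreal_power)
    also have "ennreal (1 / r ^ d) * (ennreal (r ^ d) * (\<Prod>i<d. emeasure lborel (A i)))
      = (\<Prod>i<d. emeasure lborel (A i))"
      by (simp only: inv[OF pow])
    finally show "emeasure (density (distr (leb d) (leb d) ?f) (\<lambda>_. ennreal (1 / r ^ d))) (Pi\<^sub>E {..<d} A)
       = (\<Prod>i<d. emeasure lborel (A i))" .
  qed auto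
  then have "emeasure (leb d) A = emeasure (density (distr (leb d) (leb d) ?f) (\<lambda>_. ennreal (1 / r ^ d))) A"
    by (rule arg_cong)
  also have "\<dots> = ennreal (1 / r ^ d) * emeasure (leb d) (?f -` A \<inter> space (leb d))"
    using A by (simp add: emeasure_density nn_integral_cmult_indicator emeasure_distr)
  finally show ?thesis
    by (simp only: inv(2)[OF pow])
qed

lemma gauss_density:
  "gauss d = density (leb d) (\<lambda>x. ennreal ((1 / sqrt (2 * pi)) ^ d * exp (- (vnorm d x)\<^sup>2 / 2)))"
proof -
  interpret N: product_sigma_finite "\<lambda>_::nat. std_normal_distribution"
    by (intro product_sigma_finite.intro prob_space_imp_sigma_finite prob_space_std_normal)
  have dens: "ennreal ((1 / sqrt (2 * pi)) ^ d * exp (- (vnorm d x)\<^sup>2 / 2))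
    = (\<Prod>k<d. ennreal (std_normal_density (x k)))" for x
  proof -
    have "(1 / sqrt (2 * pi)) ^ d * exp (- (vnorm d x)\<^sup>2 / 2) = (\<Prod>k<d. std_normal_density (x k))"
    proof -
      have "(\<Prod>k<d. std_normal_density (x k)) = (\<Prod>k<d. (1 / sqrt (2 * pi)) * exp (- (x k)\<^sup>2 / 2))"
        by (simp only: std_normal_density_def)
      also have "\<dots> = (1 / sqrt (2 * pi)) ^ d * exp (\<Sum>k<d. - (x k)\<^sup>2 / 2)"
        unfolding prod.distrib by (simp add: exp_sum)
      also have "(\<Sum>k<d. - (x k)\<^sup>2 / 2) = - (vnorm d x)\<^sup>2 / 2"
        unfolding vnorm_pow2 by (simp add: sum_negf sum_divide_distrib)
      finally show ?thesis by (rule sym)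
    qed
    then show ?thesis by (simp add: prod_ennreal)
  qed
  show ?thesis unfolding dens gauss_def
  proof (rule N.PiM_eqI[symmetric])
    fix A :: "nat \<Rightarrow> real set" assume A: "\<And>i. i \<in> {..<d} \<Longrightarrow> A i \<in> sets std_normal_distribution"
    have box: "Pi\<^sub>E {..<d} A \<in> sets (leb d)" using A by (intro sets_PiM_I_finite) auto
    have "emeasure (density (leb d) (\<lambda>x. \<Prod>k<d. ennreal (std_normal_density (x k)))) (Pi\<^sub>E {..<d} A)
       = (\<integral>\<^sup>+x. (\<Prod>k<d. ennreal (std_normal_density (x k))) * indicator (Pi\<^sub>E {..<d} A) x \<partial>leb d)"
      using box by (intro emeasure_density) (auto intro!: borel_measurable_prod_ennreal)
    also have "\<dots> = (\<integral>\<^sup>+x. (\<Prod>k<d. ennreal (std_normal_density (x k)) * indicator (A k) (x k)) \<partial>leb d)"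
    proof (intro nn_integral_cong)
      fix x assume x: "x \<in> space (leb d)"
      have "indicator (Pi\<^sub>E {..<d} A) x = (\<Prod>k<d. indicator (A k) (x k) :: ennreal)"
        using x by (auto simp: indicator_def space_PiM PiE_iff)
      then show "(\<Prod>k<d. ennreal (std_normal_density (x k))) * indicator (Pi\<^sub>E {..<d} A) x
        = (\<Prod>k<d. ennreal (std_normal_density (x k)) * indicator (A k) (x k))"
        by (simp add: prod.distrib)
    qed
    also have "\<dots> = (\<Prod>k<d. \<integral>\<^sup>+x. ennreal (std_normal_density x) * indicator (A k) x \<partial>lborel)"
      using A by (subst lebesgue_product.product_nn_integral_prod) auto
    also have "\<dots> = (\<Prod>k<d. emeasure std_normal_distribution (A k))"
      using A by (intro prod.cong) (auto simp: emeasure_density)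
    finally show "emeasure (density (leb d) (\<lambda>x. \<Prod>k<d. ennreal (std_normal_density (x k)))) (Pi\<^sub>E {..<d} A)
      = (\<Prod>k<d. emeasure std_normal_distribution (A k))" .
  qed (auto intro!: sets_PiM_cong)
qed

text \<open>With \<open>s\<close> the norm of a point this writes the Gaussian density as a mixture of indicators of
balls of radius \<open>r\<close>.\<close>

lemma exp_as_mixture:
  assumes "0 \<le> s"
  shows "ennreal (exp (- s\<^sup>2 / 2)) = (\<integral>\<^sup>+r. ennreal (r * exp (- r\<^sup>2 / 2)) * indicator {s..} r \<partial>lborel)"
proof -
  have sq: "filterlim (\<lambda>r::real. r\<^sup>2) at_top at_top"
    by (rule filterlim_pow_at_top) (simp_all add: filterlim_ident)
  have "filterlim (\<lambda>r::real. r\<^sup>2 * (1 / 2)) at_top at_top"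
    by (rule filterlim_at_top_mult_tendsto_pos[OF tendsto_const _ sq]) simp
  then have "filterlim (\<lambda>r::real. - (r\<^sup>2 * (1 / 2))) at_bot at_top"
    by (simp only: filterlim_uminus_at_top minus_minus)
  from tendsto_minus[OF filterlim_compose[OF exp_at_bot this]]
  have lim: "((\<lambda>r::real. - exp (- r\<^sup>2 / 2)) \<longlongrightarrow> 0) at_top"
    by simp
  have "(\<integral>\<^sup>+r. ennreal (r * exp (- r\<^sup>2 / 2)) * indicator {s..} r \<partial>lborel) = ennreal (0 - (- exp (- s\<^sup>2 / 2)))"
    by (rule nn_integral_FTC_atLeast)
       (use assms lim in \<open>auto intro!: derivative_eq_intros simp: field_simps\<close>)
  then show ?thesis by simp
qed

section \<open>The normalised Gaussian vector is uniform on the sphere\<close>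

lemma vnorm_null_set: "1 \<le> d \<Longrightarrow> {x \<in> space (leb d). vnorm d x = 0} \<in> null_sets (leb d)"
proof -
  assume d: "1 \<le> d"
  have "{x \<in> space (leb d). vnorm d x = 0} \<subseteq> Pi\<^sub>E {..<d} (\<lambda>_. {0})"
  proof
    fix x assume x: "x \<in> {x \<in> space (leb d). vnorm d x = 0}"
    then have "(\<Sum>k<d. (x k)\<^sup>2) = 0" using vnorm_pow2[of d x] by simp
    then have "\<forall>k<d. x k = 0" by (subst (asm) sum_nonneg_eq_0_iff) auto
    with x show "x \<in> Pi\<^sub>E {..<d} (\<lambda>_. {0})" by (intro PiE_I) (auto simp: space_PiM PiE_iff extensional_def)
  qed
  moreover have "emeasure (leb d) (Pi\<^sub>E {..<d} (\<lambda>_. {0})) = 0"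
    using d by (subst lebesgue_product.emeasure_PiM) auto
  moreover have "Pi\<^sub>E {..<d} (\<lambda>_. {0::real}) \<in> sets (leb d)"
    by (intro sets_PiM_I_finite) auto
  ultimately have "Pi\<^sub>E {..<d} (\<lambda>_. {0::real}) \<in> null_sets (leb d)"
    by (intro null_setsI)
  moreover have "{x \<in> space (leb d). vnorm d x = 0} \<in> sets (leb d)" by measurable
  ultimately show ?thesis
    using \<open>{x \<in> space (leb d). vnorm d x = 0} \<subseteq> Pi\<^sub>E {..<d} (\<lambda>_. {0})\<close>
    by (rule null_sets_subset)
qed

text \<open>The Gaussian measure of a cone is a constant multiple of the volume of its part in the unit ball: the
density is a mixture of indicators of centred balls, and a cone meets the ball of radius \<open>r\<close> in a
dilation of its part in the unit ball.\<close>

lemma gauss_cone: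
  assumes d: "1 \<le> d" and S [measurable]: "S \<in> sets (leb d)"
    and cone: "\<And>c x. 0 < c \<Longrightarrow> x \<in> space (leb d) \<Longrightarrow> (\<lambda>k\<in>{..<d}. c * x k) \<in> S \<longleftrightarrow> x \<in> S"
  shows "emeasure (gauss d) S
    = (\<integral>\<^sup>+r. ennreal ((1 / sqrt (2 * pi)) ^ d) * ennreal (r * exp (- r\<^sup>2 / 2)) * ennreal (r ^ d) \<partial>lborel)
      * emeasure (leb d) (punctured_ball d \<inter> S)"
proof -
  let ?c = "(1 / sqrt (2 * pi)) ^ d"
  let ?w = "\<lambda>r::real. ennreal (r * exp (- r\<^sup>2 / 2))"
  interpret finite_product_sigma_finite "\<lambda>_. lborel :: real measure" "{..<d}" by standard simp
  interpret pair_sigma_finite "leb d" "lborel :: real measure" ..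
  have ball: "emeasure (leb d) {x \<in> S. vnorm d x \<le> r}
    = ennreal (r ^ d) * emeasure (leb d) (punctured_ball d \<inter> S)"
    if r: "0 < r" for r
  proof -
    have "{x \<in> S. vnorm d x \<le> r} = (\<lambda>x. \<lambda>k\<in>{..<d}. x k / r) -` {x \<in> S. vnorm d x \<le> 1} \<inter> space (leb d)"
    proof -
      have "(\<lambda>k\<in>{..<d}. x k / r) \<in> S \<longleftrightarrow> x \<in> S" if "x \<in> space (leb d)" for x
        using cone[of "1 / r" x] that r by simp
      moreover have "vnorm d (\<lambda>k\<in>{..<d}. x k / r) = vnorm d x / r" for x
        using vnorm_scale[of "1 / r" d x] r by simp
      ultimately show ?thesis
        using sets.sets_into_space[OF S] r by (auto simp: divide_le_eq)
    qed
    then have "emeasure (leb d) {x \<in> S. vnorm d x \<le> r} = ennreal (r ^ d) * emeasure (leb d) {x \<in> S. vnorm d x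
      \<le> 1}"
      using leb_scale[OF r, of "{x \<in> S. vnorm d x \<le> 1}" d] by simp
    also have "emeasure (leb d) {x \<in> S. vnorm d x \<le> 1} = emeasure (leb d) (punctured_ball d \<inter> S)"
    proof (rule emeasure_eq_AE)
      show "AE x in leb d. x \<in> {x \<in> S. vnorm d x \<le> 1} \<longleftrightarrow> x \<in> punctured_ball d \<inter> S"
        using AE_not_in[OF vnorm_null_set[OF d]] AE_space
      proof eventually_elim
        case (elim x)
        then show ?case
          using vnorm_nonneg[of d x] by (auto simp: punctured_ball_def space_PiM PiE_def less_le)
      qed
    qed measurable
    finally show ?thesis .
  qed
  have "emeasure (gauss d) S = (\<integral>\<^sup>+x. ennreal (?c * exp (- (vnorm d x)\<^sup>2 / 2)) * indicator S x \<partial>leb d)"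
    unfolding gauss_density by (rule emeasure_density) measurable
  also have "\<dots> = (\<integral>\<^sup>+x. (\<integral>\<^sup>+r. ennreal ?c * ?w r * indicator {x \<in> S. vnorm d x \<le> r} x \<partial>lborel) \<partial>leb d)"
  proof (intro nn_integral_cong)
    fix x
    have "ennreal (?c * exp (- (vnorm d x)\<^sup>2 / 2)) * indicator S x
        = ennreal ?c * indicator S x * (\<integral>\<^sup>+r. ?w r * indicator {vnorm d x..} r \<partial>lborel)"
      by (subst ennreal_mult) (simp_all only: exp_as_mixture[OF vnorm_nonneg] mult_ac, simp_all)
    also have "\<dots> = (\<integral>\<^sup>+r. ennreal ?c * indicator S x * (?w r * indicator {vnorm d x..} r) \<partial>lborel)"
      by (rule nn_integral_cmult[symmetric]) measurable
    finally show "ennreal (?c * exp (- (vnorm d x)\<^sup>2 / 2)) * indicator S x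
      = (\<integral>\<^sup>+r. ennreal ?c * ?w r * indicator {x \<in> S. vnorm d x \<le> r} x \<partial>lborel)"
      by (auto simp: indicator_def intro!: nn_integral_cong split: if_splits)
  qed
  also have "\<dots> = (\<integral>\<^sup>+r. (\<integral>\<^sup>+x. ennreal ?c * ?w r * indicator {x \<in> S. vnorm d x \<le> r} x \<partial>leb d) \<partial>lborel)"
  proof (rule Fubini'[symmetric])
    have "(\<lambda>(x, r). ennreal ?c * ?w r * (if x \<in> S \<and> vnorm d x
      \<le> r then 1 else 0)) \<in> borel_measurable (leb d \<Otimes>\<^sub>M lborel)"
      by measurable
    then show "(\<lambda>(x, r). ennreal ?c * ?w r * indicator {x \<in> S. vnorm d x
      \<le> r} x) \<in> borel_measurable (leb d \<Otimes>\<^sub>M lborel)"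
      by (simp add: indicator_def)
  qed
  also have "\<dots> = (\<integral>\<^sup>+r. ennreal ?c * ?w r * emeasure (leb d) {x \<in> S. vnorm d x \<le> r} \<partial>lborel)"
    by (intro nn_integral_cong nn_integral_cmult_indicator) measurable
  also have "\<dots> = (\<integral>\<^sup>+r. (ennreal ?c * ?w r * ennreal (r ^ d))
    * emeasure (leb d) (punctured_ball d \<inter> S) \<partial>lborel)"
  proof (intro nn_integral_cong)
    fix r :: real
    show "ennreal ?c * ?w r * emeasure (leb d) {x \<in> S. vnorm d x \<le> r}
      = (ennreal ?c * ?w r * ennreal (r ^ d)) * emeasure (leb d) (punctured_ball d \<inter> S)"
    proof (cases "0 < r")
      case True
      then show ?thesis by (simp only: ball mult.assoc)
    next
      case False
      then have "?w r = 0" by (intro ennreal_neg) (simp add: mult_nonpos_nonneg)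
      then show ?thesis by (simp only: mult_zero_left mult_zero_right)
    qed
  qed
  also have "\<dots> = (\<integral>\<^sup>+r. ennreal ?c * ?w r * ennreal (r ^ d) \<partial>lborel) * emeasure (leb d) (punctured_ball d \<inter> S)"
    by (rule nn_integral_multc) measurable
  finally show ?thesis .
qed

lemma ennreal_eq_inverse:
  fixes x y :: ennreal
  assumes "x * y = 1"
  shows "x = inverse y"
proof -
  have "y \<noteq> 0" "y \<noteq> top"
    using assms by (auto simp: ennreal_mult_top split: if_splits)
  then have "x * y / y = x" by (rule mult_divide_eq_ennreal)
  then show ?thesis by (simp add: assms divide_ennreal_def)
qed

text \<open>Both sides give to a set of directions a constant times the volume of its cone in the unit ball, and the
constants agree because both are probability measures.\<close>

theorem distr_normalise_gauss:
  assumes d: "1 \<le> d"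
  shows "distr (gauss d) (vec_borel d) (normalise d) = unif_sphere d"
proof (rule measure_eqI)
  let ?K = "\<integral>\<^sup>+r. ennreal ((1 / sqrt (2 * pi)) ^ d) * ennreal (r * exp (- r\<^sup>2 / 2)) * ennreal (r ^ d) \<partial>lborel"
  let ?B = "punctured_ball d"
  show "sets (distr (gauss d) (vec_borel d) (normalise d)) = sets (unif_sphere d)"
    by (simp add: unif_sphere_def)
  have [measurable]: "normalise d \<in> measurable (leb d) (vec_borel d)"
    using normalise_measurable[of d] by (simp add: measurable_cong_sets[OF sets_leb refl])
  have eq: "emeasure (gauss d) (normalise d -` A \<inter> space (leb d))
    = ?K * emeasure (leb d) (?B \<inter> (normalise d -` A \<inter> space (leb d)))"
    if [measurable]: "A \<in> sets (vec_borel d)" for A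
  proof (rule gauss_cone[OF d])
    show "(\<lambda>k\<in>{..<d}. c * x k) \<in> normalise d -` A \<inter> space (leb d) \<longleftrightarrow> x \<in> normalise d -` A \<inter> space (leb d)"
      if "0 < c" "x \<in> space (leb d)" for c x
      using that normalise_scale[OF that(1), where d=d and x=x] by (auto simp: space_PiM)
  qed measurable
  have sp: "space (gauss d) = space (leb d)" by (simp add: gauss_def space_PiM)
  have norm: "?K * emeasure (leb d) ?B = 1"
  proof -
    have "normalise d -` space (vec_borel d) \<inter> space (leb d) = space (leb d)"
      by (auto simp: vec_borel_def space_PiM)
    moreover have "?B \<inter> space (leb d) = ?B"
      using sets.sets_into_space[OF punctured_ball_sets[of d]] by auto
    ultimately show ?thesis
      using eq[OF sets.top] prob_space.emeasure_space_1[OF prob_space_gauss[of d]] by (simp add: sp)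
  qed
  have K: "?K = inverse (emeasure (leb d) ?B)"
    by (rule ennreal_eq_inverse[OF norm])
  fix A assume "A \<in> sets (distr (gauss d) (vec_borel d) (normalise d))"
  then have A [measurable]: "A \<in> sets (vec_borel d)" by simp
  have "emeasure (distr (gauss d) (vec_borel d) (normalise d)) A
    = emeasure (gauss d) (normalise d -` A \<inter> space (leb d))"
    by (subst emeasure_distr) (auto simp: sp)
  also have "\<dots> = emeasure (leb d) (?B \<inter> (normalise d -` A \<inter> space (leb d))) / emeasure (leb d) ?B"
    by (subst eq[OF A], subst K) (simp only: divide_ennreal_def mult.commute)
  also have "\<dots> = emeasure (unif_sphere d) A"
    unfolding unif_sphere_def
    by (subst emeasure_distr) (auto simp: emeasure_uniform_measure)
  finally show "emeasure (distr (gauss d) (vec_borel d) (normalise d)) A = emeasure (unif_sphere d) A" .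
qed

section \<open>Rotation invariance in the plane\<close>

lemma nn_integral_std_normal:
  assumes [measurable]: "f \<in> borel_measurable borel"
  shows "(\<integral>\<^sup>+x. f x \<partial>std_normal_distribution) = (\<integral>\<^sup>+x. ennreal (std_normal_density x) * f x \<partial>lborel)"
  by (rule nn_integral_density) auto

lemma nn_integral2_std_normal:
  assumes [measurable]: "case_prod f \<in> borel_measurable (borel \<Otimes>\<^sub>M borel)"
  shows "(\<integral>\<^sup>+x. \<integral>\<^sup>+y. f x y \<partial>std_normal_distribution \<partial>std_normal_distribution)
    = (\<integral>\<^sup>+x. \<integral>\<^sup>+y. ennreal (exp (- (x\<^sup>2 + y\<^sup>2) / 2) / (2 * pi)) * f x y \<partial>lborel \<partial>lborel)"
proof -
  interpret prob_space std_normal_distribution by (rule prob_space_std_normal)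
  have "std_normal_density x * std_normal_density y = exp (- (x\<^sup>2 + y\<^sup>2) / 2) / (2 * pi)" for x y
  proof -
    have "sqrt (2 * pi) * sqrt (2 * pi) = 2 * pi" by (simp flip: power2_eq_square)
    moreover have "exp (- x\<^sup>2 / 2) * exp (- y\<^sup>2 / 2) = exp (- (x\<^sup>2 + y\<^sup>2) / 2)"
      by (simp only: mult_exp_exp) (simp add: field_simps)
    ultimately show ?thesis
      by (simp add: std_normal_density_def del: real_sqrt_mult real_sqrt_mult_self)
  qed
  then have d: "ennreal (std_normal_density x) * (ennreal (std_normal_density y) * z)
    = ennreal (exp (- (x\<^sup>2 + y\<^sup>2) / 2) / (2 * pi)) * z" for x y z
    by (simp only: mult.assoc[symmetric] ennreal_mult[symmetric] normal_density_nonneg)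
  have [measurable]: "(\<lambda>y. f x y) \<in> borel_measurable borel" for x
    using measurable_Pair2[OF assms, of x] by simp
  have "(\<integral>\<^sup>+x. \<integral>\<^sup>+y. f x y \<partial>std_normal_distribution \<partial>std_normal_distribution)
    = (\<integral>\<^sup>+x. ennreal (std_normal_density x) * (\<integral>\<^sup>+y. f x y \<partial>std_normal_distribution) \<partial>lborel)"
    by (rule nn_integral_std_normal) measurable
  also have "\<dots> = (\<integral>\<^sup>+x. \<integral>\<^sup>+y. ennreal (std_normal_density x) * (ennreal (std_normal_density y)
    * f x y) \<partial>lborel \<partial>lborel)"
    by (subst nn_integral_std_normal) (auto simp: nn_integral_cmult)
  finally show ?thesis unfolding d .
qed

text \<open>If \<open>a \<noteq> 0\<close>, substituting for the first coordinate with the second one fixed and then for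
the second with the first one fixed contributes the factors \<open>1 / \<bar>a\<bar>\<close> and \<open>\<bar>a\<bar>\<close>. If
\<open>a = 0\<close>, the map swaps the coordinates up to signs.\<close>

lemma lborel_planar_affine:
  fixes f :: "real \<Rightarrow> real \<Rightarrow> ennreal"
  assumes ac: "a\<^sup>2 + c\<^sup>2 = 1"
    and [measurable]: "case_prod f \<in> borel_measurable (borel \<Otimes>\<^sub>M borel)"
  shows "(\<integral>\<^sup>+x. \<integral>\<^sup>+y. f (a * x + c * y) (a * y - c * x) \<partial>lborel \<partial>lborel) = (\<integral>\<^sup>+x. \<integral>\<^sup>+y. f x y \<partial>lborel \<partial>lborel)"
proof -
  have fm: "(\<lambda>w. f (g w) (h w)) \<in> borel_measurable M"
    if "g \<in> borel_measurable M" "h \<in> borel_measurable M" for g h and M :: "'z measure"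
    using measurable_compose[OF measurable_Pair[OF that] assms(2)] by simp
  show ?thesis
  proof (cases "a = 0")
    case True
    then have "c = 1 \<or> c = -1" using ac by (simp add: power2_eq_1_iff)
    then have c0: "c \<noteq> 0" "\<bar>c\<bar> = 1" by auto
    have "(\<integral>\<^sup>+x. \<integral>\<^sup>+y. f (a * x + c * y) (a * y - c * x) \<partial>lborel \<partial>lborel)
      = (\<integral>\<^sup>+x. \<integral>\<^sup>+y. f (c * y) (- c * x) \<partial>lborel \<partial>lborel)"
      by (simp add: True)
    also have "\<dots> = (\<integral>\<^sup>+x. \<integral>\<^sup>+y. f y (- c * x) \<partial>lborel \<partial>lborel)"
      by (subst (2) nn_integral_real_affine[of _ c 0]) (auto simp: c0 intro!: fm)
    also have "\<dots> = (\<integral>\<^sup>+x. \<integral>\<^sup>+y. f y x \<partial>lborel \<partial>lborel)"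
      by (subst (3) nn_integral_real_affine[of _ "- c" 0])
         (auto simp: c0 intro!: fm lborel.borel_measurable_nn_integral)
    also have "\<dots> = (\<integral>\<^sup>+x. \<integral>\<^sup>+y. f x y \<partial>lborel \<partial>lborel)"
      by (rule lborel_pair.Fubini') (auto intro!: fm simp: split_beta')
    finally show ?thesis .
  next
    case a: False
    have "(\<integral>\<^sup>+x. \<integral>\<^sup>+y. f (a * x + c * y) (a * y - c * x) \<partial>lborel \<partial>lborel)
      = (\<integral>\<^sup>+y. \<integral>\<^sup>+x. f (a * x + c * y) (a * y - c * x) \<partial>lborel \<partial>lborel)"
      by (rule lborel_pair.Fubini'[symmetric]) (auto intro!: fm simp: split_beta')
    also have "\<dots> = (\<integral>\<^sup>+y. ennreal \<bar>1 / a\<bar> * (\<integral>\<^sup>+s. f s (y / a - c / a * s) \<partial>lborel) \<partial>lborel)"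
    proof (intro nn_integral_cong)
      fix y
      have e: "a * ((s - c * y) / a) + c * y = s" for s using a by simp
      have "a * y - c * ((s - c * y) / a) = (a\<^sup>2 + c\<^sup>2) * y / a - c / a * s" for s
        using a by (simp add: field_simps power2_eq_square)
      then have e2: "a * y - c * ((s - c * y) / a) = y / a - c / a * s" for s
        by (simp add: ac)
      have "(\<integral>\<^sup>+x. f (a * x + c * y) (a * y - c * x) \<partial>lborel)
        = ennreal \<bar>1 / a\<bar> * (\<integral>\<^sup>+s. f (a * (- c * y / a + 1 / a * s) + c * y) (a * y
          - c * (- c * y / a + 1 / a * s)) \<partial>lborel)"
        using a by (intro nn_integral_real_affine) (auto intro!: fm)
      also have "(\<lambda>s. - c * y / a + 1 / a * s) = (\<lambda>s. (s - c * y) / a)"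
        by (simp add: diff_divide_distrib)
      finally show "(\<integral>\<^sup>+x. f (a * x + c * y) (a * y - c * x) \<partial>lborel)
        = ennreal \<bar>1 / a\<bar> * (\<integral>\<^sup>+s. f s (y / a - c / a * s) \<partial>lborel)"
        by (simp only: e e2)
    qed
    also have "\<dots> = (\<integral>\<^sup>+y. \<integral>\<^sup>+s. ennreal \<bar>1 / a\<bar> * f s (y / a - c / a * s) \<partial>lborel \<partial>lborel)"
      by (intro nn_integral_cong nn_integral_cmult[symmetric]) (auto intro!: fm)
    also have "\<dots> = (\<integral>\<^sup>+s. \<integral>\<^sup>+y. ennreal \<bar>1 / a\<bar> * f s (y / a - c / a * s) \<partial>lborel \<partial>lborel)"
      by (rule lborel_pair.Fubini') (auto intro!: fm borel_measurable_times_ennreal simp: split_beta')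
    also have "\<dots> = (\<integral>\<^sup>+s. \<integral>\<^sup>+y. f s y \<partial>lborel \<partial>lborel)"
    proof (rule nn_integral_cong)
      fix s
      have "(\<integral>\<^sup>+y. f s y \<partial>lborel) = ennreal \<bar>1 / a\<bar> * (\<integral>\<^sup>+y. f s (- (c / a * s) + 1 / a * y) \<partial>lborel)"
        using a by (intro nn_integral_real_affine) (auto intro!: fm)
      also have "\<dots> = (\<integral>\<^sup>+y. ennreal \<bar>1 / a\<bar> * f s (- (c / a * s) + 1 / a * y) \<partial>lborel)"
        by (intro nn_integral_cmult[symmetric]) (auto intro!: fm)
      finally show "(\<integral>\<^sup>+y. ennreal \<bar>1 / a\<bar> * f s (y / a - c / a * s) \<partial>lborel) = (\<integral>\<^sup>+y. f s y \<partial>lborel)"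
        by (simp add: algebra_simps)
    qed
    finally show ?thesis .
  qed
qed

text \<open>The joint density of two standard normal variables depends on \<open>x\<^sup>2 + y\<^sup>2\<close> alone.\<close>

lemma std_normal_rotation:
  fixes f :: "real \<Rightarrow> real \<Rightarrow> ennreal"
  assumes ac: "a\<^sup>2 + c\<^sup>2 = 1"
    and m: "case_prod f \<in> borel_measurable (borel \<Otimes>\<^sub>M borel)"
  shows "(\<integral>\<^sup>+x. \<integral>\<^sup>+y. f (a * x + c * y) (a * y - c * x) \<partial>std_normal_distribution \<partial>std_normal_distribution)
    = (\<integral>\<^sup>+x. \<integral>\<^sup>+y. f x y \<partial>std_normal_distribution \<partial>std_normal_distribution)"
proof -
  have fm: "(\<lambda>w. f (g w) (h w)) \<in> borel_measurable M"
    if "g \<in> borel_measurable M" "h \<in> borel_measurable M" for g h and M :: "'z measure"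
    using measurable_compose[OF measurable_Pair[OF that] m] by simp
  let ?g = "\<lambda>x y. ennreal (exp (- (x\<^sup>2 + y\<^sup>2) / 2) / (2 * pi)) * f x y"
  have "(a * x + c * y)\<^sup>2 + (a * y - c * x)\<^sup>2 = (a\<^sup>2 + c\<^sup>2) * (x\<^sup>2 + y\<^sup>2)" for x y
    by (simp add: power2_eq_square algebra_simps)
  then have sq: "(a * x + c * y)\<^sup>2 + (a * y - c * x)\<^sup>2 = x\<^sup>2 + y\<^sup>2" for x y
    by (simp add: ac)
  have "(\<integral>\<^sup>+x. \<integral>\<^sup>+y. f (a * x + c * y) (a * y - c * x) \<partial>std_normal_distribution \<partial>std_normal_distribution)
    = (\<integral>\<^sup>+x. \<integral>\<^sup>+y. ?g (a * x + c * y) (a * y - c * x) \<partial>lborel \<partial>lborel)"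
    unfolding sq by (rule nn_integral2_std_normal) (auto intro!: fm simp: split_beta')
  also have "\<dots> = (\<integral>\<^sup>+x. \<integral>\<^sup>+y. ?g x y \<partial>lborel \<partial>lborel)"
    by (rule lborel_planar_affine[OF ac]) (auto intro!: borel_measurable_times_ennreal fm simp: split_beta')
  also have "\<dots> = (\<integral>\<^sup>+x. \<integral>\<^sup>+y. f x y \<partial>std_normal_distribution \<partial>std_normal_distribution)"
    by (rule nn_integral2_std_normal[symmetric, OF m])
  finally show ?thesis .
qed

section \<open>The joint law of three projections of a Gaussian vector\<close>

text \<open>Measurability on iterated products is proved componentwise for the product sigma-algebra, which for
the real line is the Borel sigma-algebra of the product.\<close>

lemma borel_measurable_tripleI:
  fixes f :: "real \<Rightarrow> real \<Rightarrow> real \<Rightarrow> 'a :: topological_space"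
  assumes "(\<lambda>(a, b, c). f a b c) \<in> borel_measurable (borel \<Otimes>\<^sub>M borel \<Otimes>\<^sub>M borel)"
  shows "(\<lambda>(a, b, c). f a b c) \<in> borel_measurable borel"
  using assms by (simp add: borel_prod)

text \<open>Three linear forms in two independent standard normal variables, with coefficient rows
\<open>(p, q)\<close>, \<open>(p2, q2)\<close>, \<open>(p3, q3)\<close>. Rotating the plane so that the first row becomes \<open>(s, 0)\<close>
changes neither the joint law of the forms nor the inner products of the rows.\<close>

lemma planar_rotation_to_axis:
  fixes p q p2 q2 p3 q3 :: real
  obtains s m2 n2 m3 n3 where
    "0 \<le> s" "s\<^sup>2 = p\<^sup>2 + q\<^sup>2" "s * m2 = p * p2 + q * q2" "s * m3 = p * p3 + q * q3"
    "m2\<^sup>2 + n2\<^sup>2 = p2\<^sup>2 + q2\<^sup>2" "m3\<^sup>2 + n3\<^sup>2 = p3\<^sup>2 + q3\<^sup>2" "m2 * m3 + n2 * n3 = p2 * p3 + q2 * q3"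
    "\<And>F :: real \<times> real \<times> real \<Rightarrow> ennreal. F \<in> borel_measurable borel \<Longrightarrow>
      (\<integral>\<^sup>+x. \<integral>\<^sup>+y. F (p * x + q * y, p2 * x + q2 * y, p3 * x
        + q3 * y) \<partial>std_normal_distribution \<partial>std_normal_distribution)
      = (\<integral>\<^sup>+x. \<integral>\<^sup>+y. F (s * x, m2 * x + n2 * y, m3 * x
        + n3 * y) \<partial>std_normal_distribution \<partial>std_normal_distribution)"
proof (cases "p = 0 \<and> q = 0")
  case True
  then show ?thesis by (intro that[of 0 p2 p3 q2 q3]) auto
next
  case False
  define s where "s = sqrt (p\<^sup>2 + q\<^sup>2)"
  have s: "0 < s" "s\<^sup>2 = p\<^sup>2 + q\<^sup>2"
    using False by (auto simp: s_def sum_power2_gt_zero_iff)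
  define a c where "a = p / s" and "c = q / s"
  have p: "p = s * a" and q: "q = s * c" using s(1) by (simp_all add: a_def c_def)
  have ac: "a\<^sup>2 + c\<^sup>2 = 1"
    using s(1) by (simp add: a_def c_def power_divide s(2)[symmetric] flip: add_divide_distrib)
  have ac': "a * (a * t) + c * (c * t) = t" for t
    using ac by (metis distrib_right mult.assoc mult_1 power2_eq_square)
  show ?thesis
  proof (rule that[of s "a * p2 + c * q2" "a * p3 + c * q3" "a * q2 - c * p2" "a * q3 - c * p3"])
    show "s * (a * p2 + c * q2) = p * p2 + q * q2" "s * (a * p3 + c * q3) = p * p3 + q * q3"
      by (simp_all add: p q algebra_simps)
    have "(a * p2 + c * q2) * (a * p3 + c * q3) + (a * q2 - c * p2) * (a * q3 - c * p3)
      = (a\<^sup>2 + c\<^sup>2) * (p2 * p3 + q2 * q3)" for p2 q2 p3 q3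
      by (simp add: algebra_simps power2_eq_square)
    then have ip: "(a * p2 + c * q2) * (a * p3 + c * q3) + (a * q2 - c * p2) * (a * q3 - c * p3)
      = p2 * p3 + q2 * q3" for p2 q2 p3 q3
      by (simp add: ac)
    show "(a * p2 + c * q2)\<^sup>2 + (a * q2 - c * p2)\<^sup>2 = p2\<^sup>2 + q2\<^sup>2"
      "(a * p3 + c * q3)\<^sup>2 + (a * q3 - c * p3)\<^sup>2 = p3\<^sup>2 + q3\<^sup>2"
      "(a * p2 + c * q2) * (a * p3 + c * q3) + (a * q2 - c * p2) * (a * q3 - c * p3) = p2 * p3 + q2 * q3"
      using ip[of p2 q2 p2 q2] ip[of p3 q3 p3 q3] ip by (simp_all add: power2_eq_square)
    fix F :: "real \<times> real \<times> real \<Rightarrow> ennreal" assume [measurable]: "F \<in> borel_measurable borel"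
    let ?f = "\<lambda>x y. F (s * x, (a * p2 + c * q2) * x + (a * q2 - c * p2) * y, (a * p3 + c * q3) * x + (a * q3
      - c * p3) * y)"
    have "(a * p + c * q) * (a * x + c * y) + (a * q - c * p) * (a * y - c * x)
      = (a\<^sup>2 + c\<^sup>2) * (p * x + q * y)" for p q x y
      by (simp add: algebra_simps power2_eq_square)
    then have row: "(a * p + c * q) * (a * x + c * y) + (a * q - c * p) * (a * y - c * x)
      = p * x + q * y" for p q x y
      by (simp add: ac)
    have "s * (a * x + c * y) = p * x + q * y" for x y by (simp add: p q algebra_simps)
    then have "(\<integral>\<^sup>+x. \<integral>\<^sup>+y. F (p * x + q * y, p2 * x + q2 * y, p3 * x
      + q3 * y) \<partial>std_normal_distribution \<partial>std_normal_distribution)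
      = (\<integral>\<^sup>+x. \<integral>\<^sup>+y. ?f (a * x + c * y) (a * y - c * x) \<partial>std_normal_distribution \<partial>std_normal_distribution)"
      by (simp only: row)
    also have "\<dots> = (\<integral>\<^sup>+x. \<integral>\<^sup>+y. ?f x y \<partial>std_normal_distribution \<partial>std_normal_distribution)"
      by (rule std_normal_rotation[OF ac]) measurable
    finally show "(\<integral>\<^sup>+x. \<integral>\<^sup>+y. F (p * x + q * y, p2 * x + q2 * y, p3 * x
      + q3 * y) \<partial>std_normal_distribution \<partial>std_normal_distribution)
      = (\<integral>\<^sup>+x. \<integral>\<^sup>+y. ?f x y \<partial>std_normal_distribution \<partial>std_normal_distribution)" .
  qed (use s in auto)
qed

text \<open>The coefficients form a lower triangular matrix whose product with its transpose is the Gram matrix of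
\<open>u\<close>, \<open>v\<close>, \<open>w\<close>, so three linear forms in a Gaussian vector have the law of three triangular
forms in three standard normal variables. The induction adds one coordinate at a time: the new
coordinate is a fourth normal variable, and three planar rotations, mixing it in turn with each of the
other three variables, remove it from the first, second and third form.\<close>

lemma gauss_triangular:
  fixes u v w :: "nat \<Rightarrow> real"
  shows "\<exists>a11 a21 a22 a31 a32 a33. 0 \<le> a11 \<and> 0 \<le> a22 \<and> 0 \<le> a33
    \<and> dotp d u u = a11\<^sup>2 \<and> dotp d u v = a11 * a21 \<and> dotp d u w = a11 * a31
    \<and> dotp d v v = a21\<^sup>2 + a22\<^sup>2 \<and> dotp d v w = a21 * a31 + a22 * a32
    \<and> dotp d w w = a31\<^sup>2 + a32\<^sup>2 + a33\<^sup>2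
    \<and> (\<forall>F :: real \<times> real \<times> real \<Rightarrow> ennreal. F \<in> borel_measurable borel \<longrightarrow>
        (\<integral>\<^sup>+g. F (dotp d g u, dotp d g v, dotp d g w) \<partial>gauss d)
        = (\<integral>\<^sup>+x. \<integral>\<^sup>+y. \<integral>\<^sup>+z. F (a11 * x, a21 * x + a22 * y, a31 * x + a32 * y + a33 * z)
            \<partial>std_normal_distribution \<partial>std_normal_distribution \<partial>std_normal_distribution))"
proof (induction d)
  interpret N: prob_space std_normal_distribution by (rule prob_space_std_normal)
  case 0
  interpret G: prob_space "gauss 0" by (rule prob_space_gauss)
  show ?case
    by (intro exI[of _ 0]) (simp add: dotp_def G.emeasure_space_1 N.emeasure_space_1[simplified])
next
  case (Suc d)
  let ?N = "std_normal_distribution"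
  interpret N: prob_space ?N by (rule prob_space_std_normal)
  interpret NN: pair_sigma_finite ?N ?N ..
  interpret P: product_sigma_finite "\<lambda>_::nat. ?N" ..
  from Suc obtain a11 a21 a22 a31 a32 a33 where
    A: "0 \<le> a11" "0 \<le> a22" "0 \<le> a33"
      "dotp d u u = a11\<^sup>2" "dotp d u v = a11 * a21" "dotp d u w = a11 * a31"
      "dotp d v v = a21\<^sup>2 + a22\<^sup>2" "dotp d v w = a21 * a31 + a22 * a32"
      "dotp d w w = a31\<^sup>2 + a32\<^sup>2 + a33\<^sup>2"
    and IH: "\<And>F :: real \<times> real \<times> real \<Rightarrow> ennreal. F \<in> borel_measurable borel \<Longrightarrow>
        (\<integral>\<^sup>+g. F (dotp d g u, dotp d g v, dotp d g w) \<partial>gauss d)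
        = (\<integral>\<^sup>+x. \<integral>\<^sup>+y. \<integral>\<^sup>+z. F (a11 * x, a21 * x + a22 * y, a31 * x + a32 * y + a33 * z) \<partial>?N \<partial>?N \<partial>?N)"
    by blast
  obtain s1 m2 n2 m3 n3 where K1: "0 \<le> s1" "s1\<^sup>2 = a11\<^sup>2 + (u d)\<^sup>2" "s1 * m2 = a11 * a21 + u d * v d"
      "s1 * m3 = a11 * a31 + u d * w d" "m2\<^sup>2 + n2\<^sup>2 = a21\<^sup>2 + (v d)\<^sup>2" "m3\<^sup>2 + n3\<^sup>2 = a31\<^sup>2 + (w d)\<^sup>2"
      "m2 * m3 + n2 * n3 = a21 * a31 + v d * w d"
    and R1: "\<And>F :: real \<times> real \<times> real \<Rightarrow> ennreal. F \<in> borel_measurable borel \<Longrightarrow>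
      (\<integral>\<^sup>+x. \<integral>\<^sup>+y. F (a11 * x + u d * y, a21 * x + v d * y, a31 * x + w d * y) \<partial>?N \<partial>?N)
      = (\<integral>\<^sup>+x. \<integral>\<^sup>+y. F (s1 * x, m2 * x + n2 * y, m3 * x + n3 * y) \<partial>?N \<partial>?N)"
    by (rule planar_rotation_to_axis[of a11 "u d" a21 "v d" a31 "w d"]) blast
  obtain s2 m4 n4 where K2: "0 \<le> s2" "s2\<^sup>2 = a22\<^sup>2 + n2\<^sup>2" "s2 * m4 = a22 * a32 + n2 * n3"
      "m4\<^sup>2 + n4\<^sup>2 = a32\<^sup>2 + n3\<^sup>2"
    and R2: "\<And>F :: real \<times> real \<times> real \<Rightarrow> ennreal. F \<in> borel_measurable borel \<Longrightarrow>
      (\<integral>\<^sup>+x. \<integral>\<^sup>+y. F (a22 * x + n2 * y, a32 * x + n3 * y, a32 * x + n3 * y) \<partial>?N \<partial>?N)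
      = (\<integral>\<^sup>+x. \<integral>\<^sup>+y. F (s2 * x, m4 * x + n4 * y, m4 * x + n4 * y) \<partial>?N \<partial>?N)"
  proof (rule planar_rotation_to_axis[of a22 n2 a32 n3 0 0], goal_cases)
    case (1 s m2' n2' m3' n3')
    show ?case
    proof (rule 1(1)[of s m2' n2'])
      fix F :: "real \<times> real \<times> real \<Rightarrow> ennreal" assume [measurable]: "F \<in> borel_measurable borel"
      have "(\<lambda>(a, b, c). F (a, b, b)) \<in> borel_measurable (borel :: (real \<times> real \<times> real) measure)"
        by (rule borel_measurable_tripleI) measurable
      from 1(9)[OF this] show "(\<integral>\<^sup>+x. \<integral>\<^sup>+y. F (a22 * x + n2 * y, a32 * x + n3 * y, a32 * x + n3 * y) \<partial>?N \<partial>?N)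
        = (\<integral>\<^sup>+x. \<integral>\<^sup>+y. F (s * x, m2' * x + n2' * y, m2' * x + n2' * y) \<partial>?N \<partial>?N)"
        by simp
    qed (use 1 in auto)
  qed
  obtain s3 where K3: "0 \<le> s3" "s3\<^sup>2 = a33\<^sup>2 + n4\<^sup>2"
    and R3: "\<And>F :: real \<Rightarrow> ennreal. F \<in> borel_measurable borel \<Longrightarrow>
      (\<integral>\<^sup>+x. \<integral>\<^sup>+y. F (a33 * x + n4 * y) \<partial>?N \<partial>?N) = (\<integral>\<^sup>+x. \<integral>\<^sup>+y. F (s3 * x) \<partial>?N \<partial>?N)"
  proof (rule planar_rotation_to_axis[of a33 n4 0 0 0 0], goal_cases)
    case (1 s m2' n2' m3' n3')
    show ?case
    proof (rule 1(1)[of s])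
      fix F :: "real \<Rightarrow> ennreal" assume [measurable]: "F \<in> borel_measurable borel"
      have "(\<lambda>(a, b, c). F a) \<in> borel_measurable (borel :: (real \<times> real \<times> real) measure)"
        by (rule borel_measurable_tripleI) measurable
      from 1(9)[OF this] show "(\<integral>\<^sup>+x. \<integral>\<^sup>+y. F (a33 * x + n4 * y) \<partial>?N \<partial>?N) = (\<integral>\<^sup>+x. \<integral>\<^sup>+y. F (s * x) \<partial>?N \<partial>?N)"
        by simp
    qed (use 1 in auto)
  qed
  have law: "(\<integral>\<^sup>+g. F (dotp (Suc d) g u, dotp (Suc d) g v, dotp (Suc d) g w) \<partial>gauss (Suc d))
        = (\<integral>\<^sup>+x. \<integral>\<^sup>+y. \<integral>\<^sup>+z. F (s1 * x, m2 * x + s2 * y, m3 * x + m4 * y + s3 * z) \<partial>?N \<partial>?N \<partial>?N)"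
    if [measurable]: "F \<in> borel_measurable borel" for F :: "real \<times> real \<times> real \<Rightarrow> ennreal"
  proof -
    have [measurable]: "(\<lambda>g. dotp n g x) \<in> borel_measurable (gauss n)" for n x
      unfolding dotp_def gauss_def by (intro borel_measurable_sum borel_measurable_times) auto
    have dS: "dotp (Suc d) (g(d := t)) x = dotp d g x + x d * t" for g x and t :: real
      by (simp add: dotp_def mult.commute)
    have "(\<integral>\<^sup>+g. F (dotp (Suc d) g u, dotp (Suc d) g v, dotp (Suc d) g w) \<partial>gauss (Suc d))
      = (\<integral>\<^sup>+t. \<integral>\<^sup>+g. F (dotp d g u + u d * t, dotp d g v + v d * t, dotp d g w + w d * t) \<partial>gauss d \<partial>?N)"
    proof -
      have "(\<lambda>g. F (dotp (Suc d) g u, dotp (Suc d) g v, dotp (Suc d) g w)) \<in> borel_measurable (gauss (Suc d))"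
        by measurable
      then show ?thesis
        unfolding gauss_def lessThan_Suc
        by (subst P.product_nn_integral_insert_rev) (auto simp: dS)
    qed
    also have "\<dots> = (\<integral>\<^sup>+t. \<integral>\<^sup>+x. \<integral>\<^sup>+y. \<integral>\<^sup>+z. F (a11 * x + u d * t, a21 * x + a22 * y + v d * t, a31 * x + a32 * y
      + a33 * z + w d * t) \<partial>?N \<partial>?N \<partial>?N \<partial>?N)"
    proof (rule nn_integral_cong)
      fix t
      have "(\<lambda>(a, b, c). F (a + u d * t, b + v d * t, c + w d * t)) \<in> borel_measurable borel"
        by (rule borel_measurable_tripleI) measurable
      from IH[OF this] show "(\<integral>\<^sup>+g. F (dotp d g u + u d * t, dotp d g v + v d * t, dotp d g w
        + w d * t) \<partial>gauss d)
        = (\<integral>\<^sup>+x. \<integral>\<^sup>+y. \<integral>\<^sup>+z. F (a11 * x + u d * t, a21 * x + a22 * y + v d * t, a31 * x + a32 * y + a33 * z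
          + w d * t) \<partial>?N \<partial>?N \<partial>?N)"
        by simp
    qed
    \<comment> \<open>Exchanging integrals moves \<open>t\<close> next to the variable with which it is rotated.\<close>
    also have "\<dots> = (\<integral>\<^sup>+x. \<integral>\<^sup>+t. \<integral>\<^sup>+y. \<integral>\<^sup>+z. F (a11 * x + u d * t, a21 * x + a22 * y + v d * t, a31 * x + a32 * y
      + a33 * z + w d * t) \<partial>?N \<partial>?N \<partial>?N \<partial>?N)"
      by (rule NN.Fubini') measurable
    also have "\<dots> = (\<integral>\<^sup>+x. \<integral>\<^sup>+t. \<integral>\<^sup>+y. \<integral>\<^sup>+z. F (s1 * x, m2 * x + (a22 * y + n2 * t), m3 * x + (a32 * y + n3 * t)
      + a33 * z) \<partial>?N \<partial>?N \<partial>?N \<partial>?N)"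
    proof -
      have "(\<lambda>(a, b, c). \<integral>\<^sup>+y. \<integral>\<^sup>+z. F (a, b + a22 * y, c + a32 * y
        + a33 * z) \<partial>?N \<partial>?N) \<in> borel_measurable borel"
        by (rule borel_measurable_tripleI) measurable
      from R1[OF this] show ?thesis by (simp add: add_ac)
    qed
    also have "\<dots> = (\<integral>\<^sup>+x. \<integral>\<^sup>+y. \<integral>\<^sup>+t. \<integral>\<^sup>+z. F (s1 * x, m2 * x + (a22 * y + n2 * t), m3 * x + (a32 * y + n3 * t)
      + a33 * z) \<partial>?N \<partial>?N \<partial>?N \<partial>?N)"
      by (rule nn_integral_cong, rule NN.Fubini') measurable
    also have "\<dots> = (\<integral>\<^sup>+x. \<integral>\<^sup>+y. \<integral>\<^sup>+t. \<integral>\<^sup>+z. F (s1 * x, m2 * x + s2 * y, m3 * x + m4 * y + (a33 * z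
      + n4 * t)) \<partial>?N \<partial>?N \<partial>?N \<partial>?N)"
    proof (rule nn_integral_cong)
      fix x
      have "(\<lambda>(b, c, c'). \<integral>\<^sup>+z. F (s1 * x, m2 * x + b, m3 * x + c
        + a33 * z) \<partial>?N) \<in> borel_measurable (borel :: (real \<times> real \<times> real) measure)"
        by (rule borel_measurable_tripleI) measurable
      from R2[OF this] show "(\<integral>\<^sup>+y. \<integral>\<^sup>+t. \<integral>\<^sup>+z. F (s1 * x, m2 * x + (a22 * y + n2 * t), m3 * x + (a32 * y
        + n3 * t) + a33 * z) \<partial>?N \<partial>?N \<partial>?N)
        = (\<integral>\<^sup>+y. \<integral>\<^sup>+t. \<integral>\<^sup>+z. F (s1 * x, m2 * x + s2 * y, m3 * x + m4 * y + (a33 * z + n4 * t)) \<partial>?N \<partial>?N \<partial>?N)"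
        by (simp add: add_ac)
    qed
    also have "\<dots> = (\<integral>\<^sup>+x. \<integral>\<^sup>+y. \<integral>\<^sup>+z. \<integral>\<^sup>+t. F (s1 * x, m2 * x + s2 * y, m3 * x + m4 * y + (a33 * z
      + n4 * t)) \<partial>?N \<partial>?N \<partial>?N \<partial>?N)"
      by (rule nn_integral_cong, rule nn_integral_cong, rule NN.Fubini') measurable
    also have "\<dots> = (\<integral>\<^sup>+x. \<integral>\<^sup>+y. \<integral>\<^sup>+z. F (s1 * x, m2 * x + s2 * y, m3 * x + m4 * y + s3 * z) \<partial>?N \<partial>?N \<partial>?N)"
    proof (rule nn_integral_cong, rule nn_integral_cong)
      fix x y
      show "(\<integral>\<^sup>+z. \<integral>\<^sup>+t. F (s1 * x, m2 * x + s2 * y, m3 * x + m4 * y + (a33 * z + n4 * t)) \<partial>?N \<partial>?N)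
        = (\<integral>\<^sup>+z. F (s1 * x, m2 * x + s2 * y, m3 * x + m4 * y + s3 * z) \<partial>?N)"
        by (subst R3[of "\<lambda>r. F (s1 * x, m2 * x + s2 * y, m3 * x + m4 * y + r)"])
           (auto simp: N.emeasure_space_1[simplified])
    qed
    finally show ?thesis .
  qed
  have D: "dotp (Suc d) x y = dotp d x y + x d * y d" for x y by (simp add: dotp_def)
  have sq: "x d * x d = (x d)\<^sup>2" for x :: "nat \<Rightarrow> real" by (simp only: power2_eq_square)
  have G: "dotp (Suc d) u u = s1\<^sup>2" "dotp (Suc d) u v = s1 * m2" "dotp (Suc d) u w = s1 * m3"
    "dotp (Suc d) v v = m2\<^sup>2 + s2\<^sup>2" "dotp (Suc d) v w = m2 * m3 + s2 * m4"
    "dotp (Suc d) w w = m3\<^sup>2 + m4\<^sup>2 + s3\<^sup>2"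
    unfolding D A sq using K1 K2 K3 by linarith+
  show ?case
    by (rule exI[of _ s1], rule exI[of _ m2], rule exI[of _ s2], rule exI[of _ m3], rule exI[of _ m4], rule
      exI[of _ s3])
       (intro conjI allI impI G K1(1) K2(1) K3(1) law)
qed

section \<open>Concentration of the norm and tails of projections\<close>

lemma nn_integral_std_normal_moments:
  "(\<integral>\<^sup>+x. ennreal (x\<^sup>2) \<partial>std_normal_distribution) = 1"
  "(\<integral>\<^sup>+x. ennreal (x ^ 4) \<partial>std_normal_distribution) = 3"
proof -
  have "(\<integral>\<^sup>+x. ennreal (x ^ (2 * 1)) \<partial>std_normal_distribution)
    = ennreal (LINT x|std_normal_distribution. x ^ (2 * 1))"
    by (rule nn_integral_eq_integral[OF std_normal_distribution_even_moments(2)]) simp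
  also have "(LINT x|std_normal_distribution. x ^ (2 * 1)) = 1"
    by (subst std_normal_distribution_even_moments(1)) simp
  finally show "(\<integral>\<^sup>+x. ennreal (x\<^sup>2) \<partial>std_normal_distribution) = 1" by simp
  have "(\<integral>\<^sup>+x. ennreal (x ^ (2 * 2)) \<partial>std_normal_distribution)
    = ennreal (LINT x|std_normal_distribution. x ^ (2 * 2))"
    by (rule nn_integral_eq_integral[OF std_normal_distribution_even_moments(2)]) simp
  also have "(LINT x|std_normal_distribution. x ^ (2 * 2)) = 3"
    by (subst std_normal_distribution_even_moments(1)) (simp add: fact_numeral)
  finally show "(\<integral>\<^sup>+x. ennreal (x ^ 4) \<partial>std_normal_distribution) = 3" by simp
qed

text \<open>The two moments give mean \<open>d\<close> and variance \<open>2 * d\<close> for the squared norm.\<close>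

lemma gauss_norm_moments:
  "(\<integral>\<^sup>+g. ennreal ((vnorm d g)\<^sup>2) \<partial>gauss d) = ennreal (real d)"
  "(\<integral>\<^sup>+g. ennreal (vnorm d g ^ 4) \<partial>gauss d) = ennreal ((real d)\<^sup>2 + 2 * real d)"
proof (induction d)
  case 0
  { case 1 show ?case by (simp add: vnorm_pow2) }
  { case 2 show ?case by (simp add: vnorm_def dotp_def) }
next
  case (Suc d)
  let ?N = "std_normal_distribution"
  interpret N: prob_space ?N by (rule prob_space_std_normal)
  interpret P: product_sigma_finite "\<lambda>_::nat. ?N" ..
  interpret G: prob_space "gauss d" by (rule prob_space_gauss)
  have S: "(vnorm (Suc d) (g(d := t)))\<^sup>2 = (vnorm d g)\<^sup>2 + t\<^sup>2" for g t
    by (simp add: vnorm_pow2)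
  have ins: "(\<integral>\<^sup>+g. F ((vnorm (Suc d) g)\<^sup>2) \<partial>gauss (Suc d))
    = (\<integral>\<^sup>+g. \<integral>\<^sup>+t. F ((vnorm d g)\<^sup>2 + t\<^sup>2) \<partial>?N \<partial>gauss d)"
    if [measurable]: "F \<in> borel_measurable borel" for F :: "real \<Rightarrow> ennreal"
  proof -
    have "(\<lambda>g. F ((vnorm (Suc d) g)\<^sup>2)) \<in> borel_measurable (gauss (Suc d))" by measurable
    then show ?thesis
      unfolding gauss_def lessThan_Suc by (subst P.product_nn_integral_insert) (auto simp: S)
  qed
  { case 1
    have "(\<integral>\<^sup>+g. ennreal ((vnorm (Suc d) g)\<^sup>2) \<partial>gauss (Suc d))
      = (\<integral>\<^sup>+g. \<integral>\<^sup>+t. ennreal ((vnorm d g)\<^sup>2 + t\<^sup>2) \<partial>?N \<partial>gauss d)"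
      by (rule ins) measurable
    also have "\<dots> = (\<integral>\<^sup>+g. ennreal ((vnorm d g)\<^sup>2) + 1 \<partial>gauss d)"
      by (intro nn_integral_cong)
         (simp add: nn_integral_add nn_integral_std_normal_moments N.emeasure_space_1[simplified])
    also have "\<dots> = ennreal (real (Suc d))"
      using Suc.IH(1) by (simp add: nn_integral_add G.emeasure_space_1 ennreal_plus[symmetric] del:
        ennreal_plus) simp
    finally show ?case . }
  { case 2
    have "(\<integral>\<^sup>+g. ennreal (vnorm (Suc d) g ^ 4) \<partial>gauss (Suc d))
      = (\<integral>\<^sup>+g. \<integral>\<^sup>+t. ennreal (((vnorm d g)\<^sup>2 + t\<^sup>2)\<^sup>2) \<partial>?N \<partial>gauss d)"
      using ins[of "\<lambda>r. ennreal (r\<^sup>2)"] by simp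
    also have "\<dots> = (\<integral>\<^sup>+g. ennreal (vnorm d g ^ 4) + (ennreal 2 * ennreal ((vnorm d g)\<^sup>2) + 3) \<partial>gauss d)"
    proof (rule nn_integral_cong)
      fix g
      let ?s = "(vnorm d g)\<^sup>2"
      have "ennreal ((?s + t\<^sup>2)\<^sup>2) = ennreal (?s\<^sup>2) + (ennreal (2 * ?s) * ennreal (t\<^sup>2)
        + ennreal (t ^ 4))" for t
      proof -
        have sq: "(?s + t\<^sup>2)\<^sup>2 = ?s\<^sup>2 + (2 * ?s * t\<^sup>2 + t ^ 4)"
          by (simp add: power2_sum)
        have split: "ennreal (a + (b * c + e)) = ennreal a + (ennreal b * ennreal c + ennreal e)"
          if "0 \<le> a" "0 \<le> b" "0 \<le> c" "0 \<le> e" for a b c e :: real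
          using that by (simp add: ennreal_plus ennreal_mult)
        show ?thesis unfolding sq by (rule split) auto
      qed
      then have "(\<integral>\<^sup>+t. ennreal ((?s + t\<^sup>2)\<^sup>2) \<partial>?N)
        = (\<integral>\<^sup>+t. ennreal (?s\<^sup>2) + (ennreal (2 * ?s) * ennreal (t\<^sup>2) + ennreal (t ^ 4)) \<partial>?N)"
        by (simp only:)
      also have "\<dots> = ennreal (?s\<^sup>2) + (ennreal (2 * ?s) + 3)"
        by (simp add: nn_integral_add nn_integral_cmult nn_integral_std_normal_moments
          N.emeasure_space_1[simplified])
      also have "ennreal (2 * ?s) = ennreal 2 * ennreal ?s" by (rule ennreal_mult) auto
      finally show "(\<integral>\<^sup>+t. ennreal ((?s + t\<^sup>2)\<^sup>2) \<partial>?N) = ennreal (vnorm d g ^ 4) + (ennreal 2 * ennreal ?s + 3)"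
        by simp
    qed
    also have "\<dots> = ennreal ((real d)\<^sup>2 + 2 * real d) + (ennreal 2 * ennreal (real d) + ennreal 3)"
      using Suc.IH by (simp add: nn_integral_add nn_integral_cmult G.emeasure_space_1 del: ennreal_plus)
    also have "\<dots> = ennreal (((real d)\<^sup>2 + 2 * real d) + (2 * real d + 3))"
      by (simp only: ennreal_mult[symmetric] ennreal_plus[symmetric] of_nat_0_le_iff zero_le_numeral
        add_nonneg_nonneg mult_nonneg_nonneg zero_le_power)
    also have "((real d)\<^sup>2 + 2 * real d) + (2 * real d + 3) = (real (Suc d))\<^sup>2 + 2 * real (Suc d)"
      by (simp add: power2_eq_square algebra_simps)
    finally show ?case . }
qed

text \<open>Chebyshev's inequality for the squared norm.\<close>

lemma gauss_norm_concentration: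
  assumes "1 \<le> d" "0 < \<theta>"
  shows "measure (gauss d) {g \<in> space (gauss d). \<theta> \<le> \<bar>(vnorm d g)\<^sup>2 / d - 1\<bar>} \<le> 2 / (d * \<theta>\<^sup>2)"
proof -
  interpret G: prob_space "gauss d" by (rule prob_space_gauss)
  let ?X = "\<lambda>g. (vnorm d g)\<^sup>2"
  have e: "G.expectation ?X = d"
    by (subst integral_eq_nn_integral) (auto simp: gauss_norm_moments)
  have i2: "integrable (gauss d) (\<lambda>g. (?X g)\<^sup>2)"
    by (rule integrableI_nonneg) (auto simp: gauss_norm_moments)
  have e2: "G.expectation (\<lambda>g. (?X g)\<^sup>2) = (real d)\<^sup>2 + 2 * d"
    by (subst integral_eq_nn_integral) (auto simp: gauss_norm_moments simp del: ennreal_plus)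
  have i1: "integrable (gauss d) ?X"
    by (rule G.square_integrable_imp_integrable[OF _ i2]) measurable
  have var: "G.variance ?X = 2 * d"
    using G.variance_eq[OF i1 i2] unfolding e e2 by simp
  have "measure (gauss d) {g \<in> space (gauss d). \<theta> * d \<le> \<bar>?X g - G.expectation ?X\<bar>} \<le> G.variance ?X / (\<theta> * d)\<^sup>2"
    using assms by (intro G.Chebyshev_inequality i2) auto
  also have "\<dots> = 2 / (d * \<theta>\<^sup>2)"
    unfolding var using assms by (simp add: power2_eq_square field_simps)
  also have "{g \<in> space (gauss d). \<theta> * d \<le> \<bar>?X g - G.expectation ?X\<bar>} = {g \<in> space (gauss d). \<theta>
    \<le> \<bar>?X g / d - 1\<bar>}"
  proof -
    have "?X g / d - 1 = (?X g - d) / d" for g using assms by (simp add: field_simps)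
    then show ?thesis unfolding e using assms by (auto simp: abs_divide le_divide_eq)
  qed
  finally show ?thesis .
qed

text \<open>A projection on a unit vector has second moment 1.\<close>

lemma gauss_dotp_tail:
  assumes u: "dotp d u u = 1" and K: "0 < K" and [measurable]: "u \<in> space (vec_borel d)"
  shows "measure (gauss d) {g \<in> space (gauss d). K \<le> \<bar>dotp d g u\<bar>} \<le> 1 / K\<^sup>2"
proof -
  interpret G: prob_space "gauss d" by (rule prob_space_gauss)
  interpret N: prob_space std_normal_distribution by (rule prob_space_std_normal)
  have [measurable]: "(\<lambda>g. dotp d g u) \<in> borel_measurable (gauss d)" by measurable
  have m: "(\<integral>\<^sup>+g. ennreal ((dotp d g u)\<^sup>2) \<partial>gauss d) = 1"
  proof -
    have F: "(\<lambda>(a, b, c). ennreal (a\<^sup>2)) \<in> borel_measurable (borel :: (real \<times> real \<times> real) measure)"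
      by (rule borel_measurable_tripleI) measurable
    obtain a where a: "dotp d u u = a\<^sup>2"
      and law: "(\<integral>\<^sup>+g. ennreal ((dotp d g u)\<^sup>2) \<partial>gauss d)
        = (\<integral>\<^sup>+x. \<integral>\<^sup>+y. \<integral>\<^sup>+z. ennreal ((a * x)\<^sup>2) \<partial>std_normal_distribution \<partial>std_normal_distribution
          \<partial>std_normal_distribution)"
      using gauss_triangular[of d u u u] F by fastforce
    show ?thesis
      unfolding law using a u
      by (simp add: power_mult_distrib nn_integral_std_normal_moments N.emeasure_space_1[simplified])
  qed
  have i: "integrable (gauss d) (\<lambda>g. (dotp d g u)\<^sup>2)"
    by (rule integrableI_nonneg) (auto simp: m)
  have e: "G.expectation (\<lambda>g. (dotp d g u)\<^sup>2) = 1"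
    by (subst integral_eq_nn_integral) (auto simp: m)
  show ?thesis
    using G.second_moment_method[of "\<lambda>g. dotp d g u" K] i K by (simp add: e)
qed

text \<open>If \<open>sqrt d * \<langle>g, u\<rangle> / \<bar>g\<bar>\<close> exceeds \<open>K\<close>, then either \<open>\<bar>g\<bar>\<^sup>2 \<le> d / 4\<close> or
\<open>\<langle>g, u\<rangle>\<close> exceeds \<open>K / 2\<close>.\<close>

lemma sphere_dotp_tail:
  assumes d: "1 \<le> d" and u: "dotp d u u = 1" and K: "0 < K" and us [measurable]: "u \<in> space (vec_borel d)"
  shows "measure (unif_sphere d) {v \<in> space (unif_sphere d). K < \<bar>sqrt d * dotp d v u\<bar>} \<le> 4 / d + 4 / K\<^sup>2"
proof -
  interpret G: prob_space "gauss d" by (rule prob_space_gauss)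
  let ?A = "{g \<in> space (gauss d). 3 / 4 \<le> \<bar>(vnorm d g)\<^sup>2 / d - 1\<bar>}"
  let ?B = "{g \<in> space (gauss d). K / 2 \<le> \<bar>dotp d g u\<bar>}"
  have "measure (unif_sphere d) {v \<in> space (unif_sphere d). K < \<bar>sqrt d * dotp d v u\<bar>}
    = measure (gauss d) {g \<in> space (gauss d). K < \<bar>sqrt d * dotp d (normalise d g) u\<bar>}"
  proof -
    have "{v \<in> space (vec_borel d). K < \<bar>sqrt d * dotp d v u\<bar>} \<in> sets (vec_borel d)" by measurable
    moreover have "normalise d -` {v \<in> space (vec_borel d). K < \<bar>sqrt d * dotp d v u\<bar>} \<inter> space (gauss d)
      = {g \<in> space (gauss d). K < \<bar>sqrt d * dotp d (normalise d g) u\<bar>}"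
      by (auto simp: vec_borel_def space_PiM)
    ultimately show ?thesis
      unfolding distr_normalise_gauss[OF d, symmetric]
      by (simp add: measure_distr measurable_cong_sets[OF sets_gauss refl] del: vimage_Collect_eq)
  qed
  also have "\<dots> \<le> measure (gauss d) (?A \<union> ?B)"
  proof (rule G.finite_measure_mono)
    show "{g \<in> space (gauss d). K < \<bar>sqrt d * dotp d (normalise d g) u\<bar>} \<subseteq> ?A \<union> ?B"
    proof safe
      fix g assume g: "g \<in> space (gauss d)" "K < \<bar>sqrt d * dotp d (normalise d g) u\<bar>"
        and B: "\<not> K / 2 \<le> \<bar>dotp d g u\<bar>"
      show "3 / 4 \<le> \<bar>(vnorm d g)\<^sup>2 / d - 1\<bar>"
      proof (rule ccontr)
        assume "\<not> ?thesis"
        then have "1 / 4 < (vnorm d g)\<^sup>2 / d" by linarith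
        then have "d < (2 * vnorm d g)\<^sup>2" using d by (simp add: field_simps)
        then have s: "sqrt d < 2 * vnorm d g"
          using vnorm_nonneg[of d g] by (intro real_less_lsqrt) auto
        have "dotp d (normalise d g) u = dotp d g u / vnorm d g"
          using dotp_scaleL[of d "1 / vnorm d g" g u] by simp
        then have "\<bar>sqrt d * dotp d (normalise d g) u\<bar> = sqrt d * \<bar>dotp d g u\<bar> / vnorm d g"
          using vnorm_nonneg[of d g] by (simp add: abs_mult abs_divide)
        also have "\<dots> \<le> (2 * vnorm d g) * (K / 2) / vnorm d g"
          using s B K vnorm_nonneg[of d g] by (intro divide_right_mono mult_mono) auto
        also have "\<dots> \<le> K" using K by simp
        finally show False using g(2) by simp
      qed
    qed
  qed measurable
  also have "\<dots> \<le> measure (gauss d) ?A + measure (gauss d) ?B"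
    by (intro measure_Un_le) measurable
  also have "\<dots> \<le> 2 / (d * (3 / 4)\<^sup>2) + 1 / (K / 2)\<^sup>2"
    using gauss_norm_concentration[OF d, of "3 / 4"] gauss_dotp_tail[OF u, of "K / 2"] K us by auto
  also have "\<dots> \<le> 4 / d + 4 / K\<^sup>2"
    using d K by (simp add: power2_eq_square field_simps)
  finally show ?thesis .
qed

section \<open>Projections of a uniform direction on a nearly orthonormal triple\<close>

lemma sets_std_normal3 [measurable_cong, simp]: "sets std_normal3 = sets borel"
  unfolding std_normal3_def borel_prod[symmetric] by (intro sets_pair_measure_cong) auto

lemma prob_space_std_normal3: "prob_space std_normal3"
proof -
  interpret N: prob_space std_normal_distribution by (rule prob_space_std_normal)
  interpret N2: pair_prob_space std_normal_distribution std_normal_distribution ..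
  interpret N3: pair_prob_space std_normal_distribution "std_normal_distribution \<Otimes>\<^sub>M std_normal_distribution" ..
  show ?thesis unfolding std_normal3_def by (rule N3.P.prob_space_axioms)
qed

lemma nn_integral_std_normal3:
  fixes F :: "real \<times> real \<times> real \<Rightarrow> ennreal"
  assumes F: "F \<in> borel_measurable borel"
  shows "(\<integral>\<^sup>+z. F z \<partial>std_normal3) = (\<integral>\<^sup>+x. \<integral>\<^sup>+y. \<integral>\<^sup>+z. F (x, y, z)
    \<partial>std_normal_distribution \<partial>std_normal_distribution \<partial>std_normal_distribution)"
proof -
  interpret N: prob_space std_normal_distribution by (rule prob_space_std_normal)
  interpret N2: pair_prob_space std_normal_distribution std_normal_distribution ..
  have m [measurable]: "F \<in> borel_measurable (std_normal_distribution \<Otimes>\<^sub>M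
    (std_normal_distribution \<Otimes>\<^sub>M std_normal_distribution))"
    using F measurable_cong_sets[OF sets_std_normal3 refl] unfolding std_normal3_def by blast
  show ?thesis
    unfolding std_normal3_def
    by (subst N2.nn_integral_fst[symmetric, OF m], intro nn_integral_cong, subst N.nn_integral_fst[symmetric])
      measurable
qed

text \<open>The Cholesky factor of the correlation matrix with off-diagonal entries \<open>\<alpha>\<close> (first and second),
\<open>\<beta>\<close> (first and third) and \<open>\<gamma>\<close> (second and third).\<close>

definition lower_triangular :: "real \<Rightarrow> real \<Rightarrow> real \<Rightarrow> real \<times> real \<times> real \<Rightarrow> real \<times> real \<times> real" where
  "lower_triangular \<alpha> \<beta> \<gamma> = (\<lambda>(x, y, z). (x, \<alpha> * x + sqrt (1 - \<alpha>\<^sup>2) * y,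
     \<beta> * x + (\<gamma> - \<alpha> * \<beta>) / sqrt (1 - \<alpha>\<^sup>2) * y + sqrt (1 - \<beta>\<^sup>2 - ((\<gamma> - \<alpha> * \<beta>) / sqrt (1 - \<alpha>\<^sup>2))\<^sup>2) * z))"

lemma lower_triangular_measurable [measurable]: "lower_triangular \<alpha> \<beta> \<gamma> \<in> borel_measurable borel"
  unfolding lower_triangular_def case_prod_unfold by (intro borel_measurable_continuous_onI continuous_intros)

lemma gauss_dotp3_measurable [measurable]:
  "(\<lambda>g. (dotp d g u, dotp d g v, dotp d g w)) \<in> borel_measurable (gauss d)"
proof -
  have [measurable]: "(\<lambda>g. dotp d g x) \<in> borel_measurable (gauss d)" for x
    unfolding dotp_def gauss_def by (intro borel_measurable_sum borel_measurable_times) auto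
  show ?thesis by measurable
qed

text \<open>For unit vectors the triangular matrix with nonnegative diagonal is determined by the Gram matrix.\<close>

lemma gauss_dotp3_law:
  assumes u: "dotp d u u = 1" and v: "dotp d v v = 1" and w: "dotp d w w = 1"
    and small: "\<bar>dotp d u v\<bar> < 1"
  shows "distr (gauss d) borel (\<lambda>g. (dotp d g u, dotp d g v, dotp d g w))
    = distr std_normal3 borel (lower_triangular (dotp d u v) (dotp d u w) (dotp d v w))"
proof -
  let ?\<alpha> = "dotp d u v" and ?\<beta> = "dotp d u w" and ?\<gamma> = "dotp d v w"
  obtain a11 a21 a22 a31 a32 a33 where
    A: "0 \<le> a11" "0 \<le> a22" "0 \<le> a33"
      "dotp d u u = a11\<^sup>2" "?\<alpha> = a11 * a21" "?\<beta> = a11 * a31"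
      "dotp d v v = a21\<^sup>2 + a22\<^sup>2" "?\<gamma> = a21 * a31 + a22 * a32"
      "dotp d w w = a31\<^sup>2 + a32\<^sup>2 + a33\<^sup>2"
    and law: "\<And>F :: real \<times> real \<times> real \<Rightarrow> ennreal. F \<in> borel_measurable borel \<Longrightarrow>
        (\<integral>\<^sup>+g. F (dotp d g u, dotp d g v, dotp d g w) \<partial>gauss d)
        = (\<integral>\<^sup>+x. \<integral>\<^sup>+y. \<integral>\<^sup>+z. F (a11 * x, a21 * x + a22 * y, a31 * x + a32 * y + a33 * z)
           \<partial>std_normal_distribution \<partial>std_normal_distribution \<partial>std_normal_distribution)"
    using gauss_triangular[of d u v w] by blast
  have a11: "a11 = 1" using A(1,4) u by (simp add: power2_eq_1_iff)
  have a21: "a21 = ?\<alpha>" and a31: "a31 = ?\<beta>" using A a11 by auto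
  have a22: "a22 = sqrt (1 - ?\<alpha>\<^sup>2)" using A v a21 by (intro real_sqrt_unique[symmetric]) auto
  have "?\<alpha>\<^sup>2 < 1" using small by (simp add: abs_square_less_1)
  then have "0 < a22" by (simp add: a22)
  then have a32: "a32 = (?\<gamma> - ?\<alpha> * ?\<beta>) / sqrt (1 - ?\<alpha>\<^sup>2)"
    using A(8) a21 a31 unfolding a22[symmetric] by (simp add: field_simps)
  have a33: "a33 = sqrt (1 - ?\<beta>\<^sup>2 - a32\<^sup>2)" using A w a31 by (intro real_sqrt_unique[symmetric]) auto
  have T: "lower_triangular ?\<alpha> ?\<beta> ?\<gamma> (x, y, z) = (a11 * x, a21 * x + a22 * y, a31 * x + a32 * y
    + a33 * z)" for x y z
    by (simp only: lower_triangular_def prod.case a33 a32 a31 a22 a21 a11 mult_1)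
  show ?thesis
  proof (rule measure_eqI)
    fix S assume "S \<in> sets (distr (gauss d) borel (\<lambda>g. (dotp d g u, dotp d g v, dotp d g w)))"
    then have [measurable]: "S \<in> sets borel" by simp
    let ?F = "indicator S :: real \<times> real \<times> real \<Rightarrow> ennreal"
    have "emeasure (distr (gauss d) borel (\<lambda>g. (dotp d g u, dotp d g v, dotp d g w))) S
      = (\<integral>\<^sup>+g. ?F (dotp d g u, dotp d g v, dotp d g w) \<partial>gauss d)"
      by (simp flip: nn_integral_indicator add: nn_integral_distr)
    also have "\<dots> = (\<integral>\<^sup>+z. ?F (lower_triangular ?\<alpha> ?\<beta> ?\<gamma> z) \<partial>std_normal3)"
      by (subst law, measurable, subst nn_integral_std_normal3, measurable) (simp only: T)
    also have "\<dots> = emeasure (distr std_normal3 borel (lower_triangular ?\<alpha> ?\<beta> ?\<gamma>)) S"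
      by (simp flip: nn_integral_indicator add: nn_integral_distr)
    finally show "emeasure (distr (gauss d) borel (\<lambda>g. (dotp d g u, dotp d g v, dotp d g w))) S
      = emeasure (distr std_normal3 borel (lower_triangular ?\<alpha> ?\<beta> ?\<gamma>)) S" .
  qed simp
qed

text \<open>Choosing three sequences at once, stated for an abstract predicate.\<close>

lemma choice3: "(\<And>n. \<exists>a b c. Q n a b c) \<Longrightarrow> \<exists>a b c. \<forall>n. Q n (a n) (b n) (c n)"
  by metis

text \<open>The Cholesky factor tends to the identity with the correlations, and bounded convergence applies along
any sequence of correlations tending to 0; a sequence violating the bound for smaller and smaller
\<open>\<delta>\<close> would contradict this.\<close>

lemma lower_triangular_limit:
  fixes f :: "real \<times> real \<times> real \<Rightarrow> real"
  assumes f: "continuous_on UNIV f" and B: "\<And>z. \<bar>f z\<bar> \<le> B" and \<eta>: "0 < \<eta>"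
  obtains \<delta> where "0 < \<delta>" "\<delta> < 1"
    "\<And>\<alpha> \<beta> \<gamma>. \<bar>\<alpha>\<bar> \<le> \<delta> \<Longrightarrow> \<bar>\<beta>\<bar> \<le> \<delta> \<Longrightarrow> \<bar>\<gamma>\<bar> \<le> \<delta> \<Longrightarrow>
      \<bar>(LINT z|std_normal3. f (lower_triangular \<alpha> \<beta> \<gamma> z)) - (LINT z|std_normal3. f z)\<bar> \<le> \<eta>"
proof -
  interpret N: prob_space std_normal3 by (rule prob_space_std_normal3)
  have [measurable]: "f \<in> borel_measurable borel" using f by (rule borel_measurable_continuous_onI)
  let ?D = "\<lambda>\<alpha> \<beta> \<gamma>. \<bar>(LINT z|std_normal3. f (lower_triangular \<alpha> \<beta> \<gamma> z)) - (LINT z|std_normal3. f z)\<bar>"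
  have "\<exists>\<delta>>0. \<delta> < 1 \<and> (\<forall>\<alpha> \<beta> \<gamma>. \<bar>\<alpha>\<bar> \<le> \<delta> \<longrightarrow> \<bar>\<beta>\<bar> \<le> \<delta> \<longrightarrow> \<bar>\<gamma>\<bar> \<le> \<delta> \<longrightarrow> ?D \<alpha> \<beta> \<gamma> \<le> \<eta>)"
  proof (rule ccontr)
    assume neg: "\<not> ?thesis"
    have "\<exists>\<alpha> \<beta> \<gamma>. \<bar>\<alpha>\<bar> \<le> 1 / real (n + 2) \<and> \<bar>\<beta>\<bar> \<le> 1 / real (n + 2) \<and> \<bar>\<gamma>\<bar> \<le> 1 / real (n + 2) \<and> \<eta> < ?D \<alpha> \<beta> \<gamma>" for n
    proof -
      have "0 < 1 / real (n + 2)" "1 / real (n + 2) < 1" by auto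
      with neg have "\<not> (\<forall>\<alpha> \<beta> \<gamma>. \<bar>\<alpha>\<bar> \<le> 1 / real (n + 2) \<longrightarrow> \<bar>\<beta>\<bar> \<le> 1 / real (n + 2) \<longrightarrow> \<bar>\<gamma>\<bar> \<le> 1 / real (n + 2)
        \<longrightarrow> ?D \<alpha> \<beta> \<gamma> \<le> \<eta>)"
        by blast
      then show ?thesis by (simp only: not_all not_imp not_le)
    qed
    then have "\<exists>\<alpha> \<beta> \<gamma>. \<forall>n. \<bar>\<alpha> n\<bar> \<le> 1 / real (n + 2) \<and> \<bar>\<beta> n\<bar> \<le> 1 / real (n + 2) \<and> \<bar>\<gamma> n\<bar> \<le> 1 / real (n + 2)
        \<and> \<eta> < ?D (\<alpha> n) (\<beta> n) (\<gamma> n)"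
      by (rule choice3)
    then obtain \<alpha> \<beta> \<gamma> where seq: "\<forall>n. \<bar>\<alpha> n\<bar> \<le> 1 / real (n + 2) \<and> \<bar>\<beta> n\<bar> \<le> 1 / real (n + 2) \<and> \<bar>\<gamma> n\<bar>
      \<le> 1 / real (n + 2)
        \<and> \<eta> < ?D (\<alpha> n) (\<beta> n) (\<gamma> n)"
      by (elim exE) (erule that)
    note s = conjunct1[OF spec[OF seq]] conjunct1[OF conjunct2[OF spec[OF seq]]]
      conjunct1[OF conjunct2[OF conjunct2[OF spec[OF seq]]]]
    note far = conjunct2[OF conjunct2[OF conjunct2[OF spec[OF seq]]]]
    have null: "(\<lambda>n. 1 / real (n + 2)) \<longlonglongrightarrow> 0"
      by (rule LIMSEQ_ignore_initial_segment[OF lim_1_over_n])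
    have lim: "\<alpha> \<longlonglongrightarrow> 0" "\<beta> \<longlonglongrightarrow> 0" "\<gamma> \<longlonglongrightarrow> 0"
      by (rule Lim_null_comparison[OF always_eventually null], intro allI, simp only: real_norm_def s)+
    have T: "(\<lambda>n. lower_triangular (\<alpha> n) (\<beta> n) (\<gamma> n) z) \<longlonglongrightarrow> z" for z
    proof (cases z)
      case (fields x y t)
      have q: "(\<lambda>n. sqrt (1 - (\<alpha> n)\<^sup>2)) \<longlonglongrightarrow> sqrt (1 - 0\<^sup>2)"
        by (intro tendsto_intros lim)
      have k: "(\<lambda>n. (\<gamma> n - \<alpha> n * \<beta> n) / sqrt (1 - (\<alpha> n)\<^sup>2)) \<longlonglongrightarrow> (0 - 0 * 0) / sqrt (1 - 0\<^sup>2)"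
        by (intro tendsto_divide q tendsto_diff tendsto_mult lim) simp
      have l: "(\<lambda>n. sqrt (1 - (\<beta> n)\<^sup>2 - ((\<gamma> n - \<alpha> n * \<beta> n) / sqrt (1 - (\<alpha> n)\<^sup>2))\<^sup>2)) \<longlonglongrightarrow> sqrt (1 - 0\<^sup>2 - ((0
        - 0 * 0) / sqrt (1 - 0\<^sup>2))\<^sup>2)"
        by (intro tendsto_real_sqrt tendsto_diff tendsto_power k lim tendsto_const)
      have "(\<lambda>n. lower_triangular (\<alpha> n) (\<beta> n) (\<gamma> n) (x, y, t)) \<longlonglongrightarrow>
        (x, 0 * x + sqrt (1 - 0\<^sup>2) * y, 0 * x + (0 - 0 * 0) / sqrt (1 - 0\<^sup>2) * y + sqrt (1 - 0\<^sup>2 - ((0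
          - 0 * 0) / sqrt (1 - 0\<^sup>2))\<^sup>2) * t)"
        unfolding lower_triangular_def prod.case
        by (intro tendsto_Pair tendsto_add tendsto_mult q k l lim tendsto_const)
      then show ?thesis by (simp add: fields)
    qed
    have "(\<lambda>n. LINT z|std_normal3. f (lower_triangular (\<alpha> n) (\<beta> n) (\<gamma> n) z)) \<longlonglongrightarrow> (LINT z|std_normal3. f z)"
    proof (rule integral_dominated_convergence[where w = "\<lambda>_. B"])
      show "AE z in std_normal3. (\<lambda>n. f (lower_triangular (\<alpha> n) (\<beta> n) (\<gamma> n) z)) \<longlonglongrightarrow> f z"
        using T f by (intro AE_I2 continuous_on_tendsto_compose[of UNIV f]) auto
    qed (auto simp: B)
    then have "(\<lambda>n. ?D (\<alpha> n) (\<beta> n) (\<gamma> n)) \<longlonglongrightarrow> 0"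
      by (intro tendsto_rabs_zero LIM_zero)
    then have "\<eta> \<le> 0"
      by (rule LIMSEQ_le_const) (use far less_imp_le in blast)
    then show False using \<eta> by simp
  qed
  then show ?thesis using that by blast
qed

text \<open>Replacing \<open>g\<close> by \<open>sqrt d * g / \<bar>g\<bar>\<close> has little effect, uniformly in the three unit vectors:
the factor is close to 1 outside a set of small measure, the projections are bounded by \<open>K\<close>
outside another one, and on the bounded region \<open>f\<close> is uniformly continuous.\<close>

lemma gauss_rescaling:
  fixes f :: "real \<times> real \<times> real \<Rightarrow> real"
  assumes f: "continuous_on UNIV f" and B: "\<And>z. \<bar>f z\<bar> \<le> B" and \<eta>: "0 < \<eta>"
  obtains D where "1 \<le> D"
    "\<And>d u v w. D \<le> d \<Longrightarrow> u \<in> space (vec_borel d) \<Longrightarrow> v \<in> space (vec_borel d) \<Longrightarrow> w \<in> space (vec_borel d) \<Longrightarrow>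
      dotp d u u = 1 \<Longrightarrow> dotp d v v = 1 \<Longrightarrow> dotp d w w = 1 \<Longrightarrow>
      \<bar>(LINT g|gauss d. f ((sqrt d / vnorm d g) *\<^sub>R (dotp d g u, dotp d g v, dotp d g w)))
        - (LINT g|gauss d. f (dotp d g u, dotp d g v, dotp d g w))\<bar> \<le> \<eta>"
proof -
  have [measurable]: "f \<in> borel_measurable borel" using f by (rule borel_measurable_continuous_onI)
  have B0: "0 \<le> B" by (rule order_trans[OF abs_ge_zero B])
  \<comment> \<open>Each of the three projections exceeds \<open>K\<close> with probability at most \<open>1 / K\<^sup>2\<close>, and there \<open>f\<close> changes
    by at most \<open>2 * B\<close>; the total is to be at most \<open>\<eta> / 3\<close>.\<close>
  define K where "K = 1 + sqrt (18 * B / \<eta>)"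
  have K: "1 \<le> K" using B0 \<eta> by (simp add: K_def)
  have tail: "2 * B * (3 / K\<^sup>2) \<le> \<eta> / 3"
  proof -
    have "18 * B / \<eta> = (sqrt (18 * B / \<eta>))\<^sup>2" using B0 \<eta> by simp
    also have "\<dots> \<le> K\<^sup>2" unfolding K_def using B0 \<eta> by (intro power_mono) auto
    finally show ?thesis using K \<eta> by (simp add: field_simps)
  qed
  \<comment> \<open>The projections form a vector of norm at most \<open>3 * K\<close>, and the rescaling factor is at most 2.\<close>
  have "uniformly_continuous_on (cball 0 (6 * K)) f"
    by (rule compact_uniformly_continuous) (auto intro: continuous_on_subset[OF f])
  then obtain \<delta>0 where \<delta>0: "0 < \<delta>0"
    "\<And>y z. y \<in> cball 0 (6 * K) \<Longrightarrow> z \<in> cball 0 (6 * K) \<Longrightarrow> dist y z < \<delta>0 \<Longrightarrow> dist (f y) (f z) < \<eta> / 3"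
    unfolding uniformly_continuous_on_def using \<eta> by (metis divide_pos_pos zero_less_numeral)
  define \<delta> where "\<delta> = min 1 (\<delta>0 / (6 * K))"
  have \<delta>: "0 < \<delta>" "\<delta> \<le> 1" "\<delta> * (3 * K) < \<delta>0"
  proof -
    show "0 < \<delta>" "\<delta> \<le> 1" using \<delta>0 K by (auto simp: \<delta>_def)
    have "\<delta> * (3 * K) \<le> \<delta>0 / (6 * K) * (3 * K)" using K by (intro mult_right_mono) (auto simp: \<delta>_def)
    also have "\<dots> = \<delta>0 / 2" using K by simp
    finally show "\<delta> * (3 * K) < \<delta>0" using \<delta>0 by simp
  qed
  have "((\<lambda>s. 1 / sqrt s) \<longlongrightarrow> 1 / sqrt 1) (at (1::real))"
    by (intro tendsto_intros) auto
  then have "\<forall>e>0. \<exists>\<theta>>0. \<forall>s. s \<noteq> 1 \<and> dist s 1 < \<theta> \<longrightarrow> dist (1 / sqrt s) (1 / sqrt 1) < e"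
    unfolding LIM_def by simp
  then obtain \<theta> where \<theta>: "0 < \<theta>" "\<And>s. s \<noteq> 1 \<Longrightarrow> \<bar>s - 1\<bar> < \<theta> \<Longrightarrow> \<bar>1 / sqrt s - 1\<bar> < \<delta>"
    using \<delta>(1) by (auto simp: dist_real_def)
  have \<theta>2: "\<bar>1 / sqrt s - 1\<bar> < \<delta>" if "\<bar>s - 1\<bar> < \<theta>" for s
    using \<theta>(2)[OF _ that] \<delta> by (cases "s = 1") auto
  \<comment> \<open>From this dimension on, the event that \<open>\<bar>g\<bar>\<^sup>2 / d\<close> is off by \<open>\<theta>\<close> changes the integral by at most \<open>\<eta> / 3\<close>.\<close>
  define D where "D = nat \<lceil>12 * B / (\<eta> * \<theta>\<^sup>2)\<rceil> + 1"
  have concentration: "2 * B * (2 / (d * \<theta>\<^sup>2)) \<le> \<eta> / 3" if "D \<le> d" for d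
  proof -
    have "12 * B / (\<eta> * \<theta>\<^sup>2) \<le> d" using that unfolding D_def by linarith
    moreover have "0 < d" using that by (simp add: D_def)
    ultimately show ?thesis using \<eta> \<theta>(1) by (simp add: field_simps)
  qed
  show ?thesis
  proof (rule that[of D])
    show "1 \<le> D" by (simp add: D_def)
    fix d u v w assume d: "D \<le> d"
      and sp [measurable]: "u \<in> space (vec_borel d)" "v \<in> space (vec_borel d)" "w \<in> space (vec_borel d)"
      and unit: "dotp d u u = 1" "dotp d v v = 1" "dotp d w w = 1"
    have d1: "1 \<le> d" using d by (simp add: D_def)
    interpret G: prob_space "gauss d" by (rule prob_space_gauss)
    let ?c = "\<lambda>g. sqrt d / vnorm d g"
    let ?X = "\<lambda>g. (dotp d g u, dotp d g v, dotp d g w)"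
    let ?Bad = "\<lambda>x. {g \<in> space (gauss d). K \<le> \<bar>dotp d g x\<bar>}"
    let ?C = "{g \<in> space (gauss d). \<theta> \<le> \<bar>(vnorm d g)\<^sup>2 / d - 1\<bar>}"
    have cX [measurable]: "(\<lambda>g. ?c g *\<^sub>R ?X g) \<in> borel_measurable (gauss d)" by measurable
    have i1: "integrable (gauss d) (\<lambda>g. f (?c g *\<^sub>R ?X g))"
      by (rule G.integrable_const_bound[of _ B]) (auto simp: B)
    have i2: "integrable (gauss d) (\<lambda>g. f (?X g))"
      by (rule G.integrable_const_bound[of _ B]) (auto simp: B)
    let ?bound = "\<lambda>g. \<eta> / 3 + 2 * B * (indicator ?C g + (indicator (?Bad u) g + indicator (?Bad v) g
      + indicator (?Bad w) g)) :: real"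
    have pw: "\<bar>f (?c g *\<^sub>R ?X g) - f (?X g)\<bar> \<le> ?bound g" if g: "g \<in> space (gauss d)" for g
    proof (cases "g \<in> ?C \<or> g \<in> ?Bad u \<or> g \<in> ?Bad v \<or> g \<in> ?Bad w")
      case True
      then have "1 \<le> (indicator ?C g + (indicator (?Bad u) g + indicator (?Bad v) g
        + indicator (?Bad w) g) :: real)"
        by (auto simp: indicator_def)
      then have "2 * B * 1 \<le> 2 * B * (indicator ?C g + (indicator (?Bad u) g + indicator (?Bad v) g
        + indicator (?Bad w) g) :: real)"
        using B0 by (intro mult_left_mono) auto
      then show ?thesis using B[of "?c g *\<^sub>R ?X g"] B[of "?X g"] \<eta> by linarith
    next
      case False
      then have x: "\<bar>dotp d g u\<bar> \<le> K" "\<bar>dotp d g v\<bar> \<le> K" "\<bar>dotp d g w\<bar> \<le> K"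
        and s: "\<bar>(vnorm d g)\<^sup>2 / d - 1\<bar> < \<theta>" using g by auto
      have nX: "norm (?X g) \<le> 3 * K"
      proof -
        have "norm (?X g) \<le> norm (dotp d g u) + norm (dotp d g v, dotp d g w)" by (rule norm_Pair_le)
        also have "norm (dotp d g v, dotp d g w) \<le> norm (dotp d g v) + norm (dotp d g w)" by (rule norm_Pair_le)
        finally show ?thesis using x by simp
      qed
      have "1 / sqrt ((vnorm d g)\<^sup>2 / d) = ?c g"
        using vnorm_nonneg[of d g] by (simp add: real_sqrt_divide)
      then have c: "\<bar>?c g - 1\<bar> < \<delta>" using \<theta>2[OF s] by simp
      then have c2: "\<bar>?c g\<bar> \<le> 2" using \<delta> by linarith
      have n1: "norm (?c g *\<^sub>R ?X g) \<le> 2 * (3 * K)"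
        unfolding norm_scaleR by (intro mult_mono c2 nX) auto
      have "dist (?c g *\<^sub>R ?X g) (?X g) = norm ((?c g - 1) *\<^sub>R ?X g)"
        by (simp only: dist_norm scaleR_left_diff_distrib scaleR_one)
      also have "\<dots> \<le> \<delta> * (3 * K)"
        unfolding norm_scaleR using c \<delta> by (intro mult_mono nX) auto
      finally have "dist (?c g *\<^sub>R ?X g) (?X g) < \<delta>0" using \<delta> by simp
      then have "dist (f (?c g *\<^sub>R ?X g)) (f (?X g)) < \<eta> / 3"
      proof (intro \<delta>0(2))
        show "?c g *\<^sub>R ?X g \<in> cball 0 (6 * K)" unfolding mem_cball_0 using n1 by linarith
        show "?X g \<in> cball 0 (6 * K)" unfolding mem_cball_0 using nX K by linarith
      qed
      moreover have "0 \<le> 2 * B * (indicator ?C g + (indicator (?Bad u) g + indicator (?Bad v) g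
        + indicator (?Bad w) g) :: real)"
        using B0 by (intro mult_nonneg_nonneg add_nonneg_nonneg) auto
      ultimately show ?thesis unfolding dist_real_def by linarith
    qed
    have ib: "integrable (gauss d) ?bound"
      by (intro Bochner_Integration.integrable_add integrable_mult_right G.integrable_const)
        (auto simp: G.emeasure_eq_measure)
    have "\<bar>(LINT g|gauss d. f (?c g *\<^sub>R ?X g)) - (LINT g|gauss d. f (?X g))\<bar>
      = \<bar>LINT g|gauss d. f (?c g *\<^sub>R ?X g) - f (?X g)\<bar>"
      by (simp only: Bochner_Integration.integral_diff[OF i1 i2])
    also have "\<dots> \<le> (LINT g|gauss d. \<bar>f (?c g *\<^sub>R ?X g) - f (?X g)\<bar>)"
      by (rule integral_abs_bound)
    also have "\<dots> \<le> (LINT g|gauss d. ?bound g)"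
      by (rule integral_mono[OF _ ib pw]) (intro integrable_abs Bochner_Integration.integrable_diff i1 i2)
    also have "\<dots> = \<eta> / 3 + 2 * B * (measure (gauss d) ?C + (measure (gauss d) (?Bad u)
      + measure (gauss d) (?Bad v) + measure (gauss d) (?Bad w)))"
      by (simp add: G.prob_space G.emeasure_eq_measure Int_def cong: conj_cong)
    also have "\<dots> \<le> \<eta> / 3 + 2 * B * (2 / (d * \<theta>\<^sup>2) + (1 / K\<^sup>2 + 1 / K\<^sup>2 + 1 / K\<^sup>2))"
    proof -
      have K0: "0 < K" using K by simp
      have "measure (gauss d) ?C + (measure (gauss d) (?Bad u) + measure (gauss d) (?Bad v)
        + measure (gauss d) (?Bad w))
        \<le> 2 / (d * \<theta>\<^sup>2) + (1 / K\<^sup>2 + 1 / K\<^sup>2 + 1 / K\<^sup>2)"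
        using gauss_norm_concentration[OF d1 \<theta>(1)] gauss_dotp_tail[OF unit(1) K0 sp(1)]
          gauss_dotp_tail[OF unit(2) K0 sp(2)] gauss_dotp_tail[OF unit(3) K0 sp(3)] by linarith
      then show ?thesis using B0 by (intro add_left_mono mult_left_mono) auto
    qed
    also have "\<dots> = \<eta> / 3 + 2 * B * (2 / (d * \<theta>\<^sup>2)) + 2 * B * (3 / K\<^sup>2)"
      by (simp add: distrib_left)
    also have "\<dots> \<le> \<eta>" using tail concentration[OF d] by linarith
    finally show "\<bar>(LINT g|gauss d. f (?c g *\<^sub>R ?X g)) - (LINT g|gauss d. f (?X g))\<bar> \<le> \<eta>" .
  qed
qed

text \<open>The projections are those of a Gaussian vector up to normalisation, and these have exactly the law of a
nearly identical triangular transform of three standard normal variables. The bound is uniform in the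
vectors, so that it applies to random ones.\<close>

theorem sphere_projections_near_normal:
  fixes f :: "real \<times> real \<times> real \<Rightarrow> real"
  assumes f: "continuous_on UNIV f" and B: "\<And>z. \<bar>f z\<bar> \<le> B" and \<eta>: "0 < \<eta>"
  obtains D \<delta> where "1 \<le> D" "0 < \<delta>"
    "\<And>d u v w. D \<le> d \<Longrightarrow> u \<in> space (vec_borel d) \<Longrightarrow> v \<in> space (vec_borel d) \<Longrightarrow> w \<in> space (vec_borel d) \<Longrightarrow>
      dotp d u u = 1 \<Longrightarrow> dotp d v v = 1 \<Longrightarrow> dotp d w w = 1 \<Longrightarrow>
      \<bar>dotp d u v\<bar> \<le> \<delta> \<Longrightarrow> \<bar>dotp d u w\<bar> \<le> \<delta> \<Longrightarrow> \<bar>dotp d v w\<bar> \<le> \<delta> \<Longrightarrow>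
      \<bar>(LINT x|unif_sphere d. f (sqrt d * dotp d x u, sqrt d * dotp d x v, sqrt d * dotp d x w))
        - (LINT z|std_normal3. f z)\<bar> \<le> \<eta>"
proof -
  have [measurable]: "f \<in> borel_measurable borel" using f by (rule borel_measurable_continuous_onI)
  have \<eta>2: "0 < \<eta> / 2" using \<eta> by simp
  obtain D where D: "1 \<le> D"
    "\<And>d u v w. D \<le> d \<Longrightarrow> u \<in> space (vec_borel d) \<Longrightarrow> v \<in> space (vec_borel d) \<Longrightarrow> w \<in> space (vec_borel d) \<Longrightarrow>
      dotp d u u = 1 \<Longrightarrow> dotp d v v = 1 \<Longrightarrow> dotp d w w = 1 \<Longrightarrow>
      \<bar>(LINT g|gauss d. f ((sqrt d / vnorm d g) *\<^sub>R (dotp d g u, dotp d g v, dotp d g w)))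
        - (LINT g|gauss d. f (dotp d g u, dotp d g v, dotp d g w))\<bar> \<le> \<eta> / 2"
    by (rule gauss_rescaling[OF f B \<eta>2]) blast
  obtain \<delta> where \<delta>: "0 < \<delta>" "\<delta> < 1"
    "\<And>\<alpha> \<beta> \<gamma>. \<bar>\<alpha>\<bar> \<le> \<delta> \<Longrightarrow> \<bar>\<beta>\<bar> \<le> \<delta> \<Longrightarrow> \<bar>\<gamma>\<bar> \<le> \<delta> \<Longrightarrow>
      \<bar>(LINT z|std_normal3. f (lower_triangular \<alpha> \<beta> \<gamma> z)) - (LINT z|std_normal3. f z)\<bar> \<le> \<eta> / 2"
    by (rule lower_triangular_limit[OF f B \<eta>2]) blast
  show ?thesis
  proof (rule that[OF D(1) \<delta>(1)])
    fix d u v w assume d: "D \<le> d"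
      and sp [measurable]: "u \<in> space (vec_borel d)" "v \<in> space (vec_borel d)" "w \<in> space (vec_borel d)"
      and unit: "dotp d u u = 1" "dotp d v v = 1" "dotp d w w = 1"
      and small: "\<bar>dotp d u v\<bar> \<le> \<delta>" "\<bar>dotp d u w\<bar> \<le> \<delta>" "\<bar>dotp d v w\<bar> \<le> \<delta>"
    have d1: "1 \<le> d" using d D(1) by simp
    have n: "dotp d (normalise d g) x = dotp d g x / vnorm d g" for g x
      using dotp_scaleL[of d "1 / vnorm d g" g x] by simp
    have "(LINT x|unif_sphere d. f (sqrt d * dotp d x u, sqrt d * dotp d x v, sqrt d * dotp d x w))
      = (LINT g|gauss d. f ((sqrt d / vnorm d g) *\<^sub>R (dotp d g u, dotp d g v, dotp d g w)))"
      unfolding distr_normalise_gauss[OF d1, symmetric]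
      by (subst integral_distr) (auto simp: n measurable_cong_sets[OF sets_gauss refl])
    moreover have "(LINT g|gauss d. f (dotp d g u, dotp d g v, dotp d g w))
      = (LINT z|std_normal3. f (lower_triangular (dotp d u v) (dotp d u w) (dotp d v w) z))"
    proof -
      have "(LINT g|gauss d. f (dotp d g u, dotp d g v, dotp d g w))
        = (LINT z|distr (gauss d) borel (\<lambda>g. (dotp d g u, dotp d g v, dotp d g w)). f z)"
        by (subst integral_distr) auto
      also have "\<dots> = (LINT z|distr std_normal3 borel (lower_triangular (dotp d u v) (dotp d u w)
        (dotp d v w)). f z)"
        using small \<delta>(2) by (subst gauss_dotp3_law[OF unit]) auto
      finally show ?thesis by (subst (asm) integral_distr) auto
    qed
    ultimately show "\<bar>(LINT x|unif_sphere d. f (sqrt d * dotp d x u, sqrt d * dotp d x v, sqrt d * dotp d x w))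
        - (LINT z|std_normal3. f z)\<bar> \<le> \<eta>"
      using D(2)[OF d sp unit] \<delta>(3)[OF small] by linarith
  qed
qed

section \<open>Conditional expectation given an independent variable\<close>

text \<open>The joint law is a product measure, so integrating over an event of the sigma-algebra generated by
\<open>X\<close> and applying Fubini's theorem identifies the conditional expectation.\<close>

lemma real_cond_exp_indep:
  assumes "prob_space M" and ind: "prob_space.indep_var M N1 Y N2 X"
    and h [measurable]: "h \<in> borel_measurable (N1 \<Otimes>\<^sub>M N2)" and bd: "\<And>z. \<bar>h z\<bar> \<le> B"
  shows "AE \<omega> in M. real_cond_exp M (vimage_algebra (space M) X N2) (\<lambda>\<omega>. h (Y \<omega>, X \<omega>)) \<omega>
    = (LINT y|distr M N1 Y. h (y, X \<omega>))"
proof -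
  interpret prob_space M by fact
  have Y [measurable]: "Y \<in> measurable M N1" and X [measurable]: "X \<in> measurable M N2"
    using indep_var_rv1[OF ind] indep_var_rv2[OF ind] by auto
  have B0: "0 \<le> B" by (rule order_trans[OF abs_ge_zero bd])
  let ?F = "vimage_algebra (space M) X N2"
  let ?D1 = "distr M N1 Y" and ?D2 = "distr M N2 X"
  interpret D1: prob_space ?D1 by (rule prob_space_distr) measurable
  interpret D2: prob_space ?D2 by (rule prob_space_distr) measurable
  interpret DD: pair_prob_space ?D1 ?D2 ..
  have joint: "?D1 \<Otimes>\<^sub>M ?D2 = distr M (N1 \<Otimes>\<^sub>M N2) (\<lambda>x. (Y x, X x))"
    using ind indep_var_distribution_eq by blast
  have Xsp: "X \<in> space M \<rightarrow> space N2" using measurable_space[OF X] by auto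
  have XF: "X \<in> measurable ?F N2"
    by (rule measurable_vimage_algebra1) (use measurable_space[OF X] in auto)
  have sub: "subalgebra M ?F"
    unfolding subalgebra_def using measurable_sets[OF X] by (auto simp: sets_vimage_algebra2[OF Xsp])
  interpret finite_measure_subalgebra M ?F by unfold_locales (rule sub)
  have hD [measurable]: "h \<in> borel_measurable (?D1 \<Otimes>\<^sub>M ?D2)" by measurable
  have g [measurable]: "(\<lambda>x. LINT y|?D1. h (y, x)) \<in> borel_measurable N2"
    by (rule D1.borel_measurable_lebesgue_integral) measurable
  have gb: "\<bar>LINT y|?D1. h (y, x)\<bar> \<le> B" for x
  proof -
    have "\<bar>LINT y|?D1. h (y, x)\<bar> \<le> (LINT y|?D1. \<bar>h (y, x)\<bar>)" by (rule integral_abs_bound)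
    also have "\<dots> \<le> (LINT y|?D1. B)"
      by (rule integral_mono_AE') (auto simp: bd B0)
    finally show ?thesis using D1.prob_space by simp
  qed
  show ?thesis
  proof (rule real_cond_exp_charact)
    show "integrable M (\<lambda>\<omega>. h (Y \<omega>, X \<omega>))"
      by (rule integrable_const_bound[of _ B]) (auto simp: bd)
    show "integrable M (\<lambda>\<omega>. LINT y|?D1. h (y, X \<omega>))"
      by (rule integrable_const_bound[of _ B]) (auto simp: gb)
    show "(\<lambda>\<omega>. LINT y|?D1. h (y, X \<omega>)) \<in> borel_measurable ?F"
      by (rule measurable_compose[OF XF g])
    fix A assume "A \<in> sets ?F"
    then obtain C where C [measurable]: "C \<in> sets N2" and A: "A = X -` C \<inter> space M"
      using sets_vimage_algebra2[OF Xsp] by auto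
    have i: "integrable (?D1 \<Otimes>\<^sub>M ?D2) (\<lambda>(y, x). indicator C x * h (y, x))"
      by (rule DD.P.integrable_const_bound[of _ B])
         (auto simp: indicator_def bd order_trans[OF abs_ge_zero bd] split: prod.splits)
    have "(LINT \<omega>:A|M. h (Y \<omega>, X \<omega>)) = (LINT \<omega>|M. indicator C (X \<omega>) * h (Y \<omega>, X \<omega>))"
      unfolding set_lebesgue_integral_def A
      by (intro Bochner_Integration.integral_cong) (auto simp: indicator_def)
    also have "\<dots> = (LINT z|(?D1 \<Otimes>\<^sub>M ?D2). (\<lambda>(y, x). indicator C x * h (y, x)) z)"
      unfolding joint by (subst integral_distr) auto
    also have "\<dots> = (LINT x|?D2. LINT y|?D1. indicator C x * h (y, x))"
      by (rule DD.integral_snd[symmetric, OF i])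
    also have "\<dots> = (LINT x|?D2. indicator C x * (LINT y|?D1. h (y, x)))"
      by simp
    also have "\<dots> = (LINT \<omega>|M. indicator C (X \<omega>) * (LINT y|?D1. h (y, X \<omega>)))"
      by (subst integral_distr) auto
    also have "\<dots> = (LINT \<omega>:A|M. (LINT y|?D1. h (y, X \<omega>)))"
      unfolding set_lebesgue_integral_def A
      by (intro Bochner_Integration.integral_cong) (auto simp: indicator_def)
    finally show "(LINT \<omega>:A|M. h (Y \<omega>, X \<omega>)) = (LINT \<omega>:A|M. (LINT y|?D1. h (y, X \<omega>)))" .
  qed
qed

section \<open>Hyperbolic estimates\<close>

lemma exp_quadratic_bound:
  fixes y :: real assumes "\<bar>y\<bar> \<le> 1"
  shows "1 + y \<le> exp y" "exp y \<le> 1 + y + y\<^sup>2"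
proof -
  show "1 + y \<le> exp y" by (rule exp_ge_add_one_self)
  show "exp y \<le> 1 + y + y\<^sup>2"
  proof (cases "0 \<le> y")
    case True then show ?thesis using assms exp_bound by auto
  next
    case False
    define z where "z = - y"
    have z: "0 \<le> z" "z \<le> 1" using False assms by (auto simp: z_def)
    have "1 \<le> (1 - z + z\<^sup>2) * (1 + z + z\<^sup>2 / 2)"
    proof -
      have "(1 - z + z\<^sup>2) * (1 + z + z\<^sup>2 / 2) = 1 + z\<^sup>2 * (1 / 2 + z / 2 + z\<^sup>2 / 2)"
        by (simp add: field_simps power2_eq_square)
      then show ?thesis using z by simp
    qed
    also have "\<dots> \<le> (1 - z + z\<^sup>2) * exp z"
      using z by (intro mult_left_mono exp_lower_Taylor_quadratic) auto
    finally have "exp (- z) \<le> 1 - z + z\<^sup>2"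
      by (simp add: exp_minus inverse_eq_divide divide_le_eq)
    then show ?thesis by (simp add: z_def)
  qed
qed

lemma cosh_sinh_bounds:
  fixes x :: real assumes "\<bar>x\<bar> \<le> 1"
  shows "0 \<le> cosh x - 1" "cosh x - 1 \<le> x\<^sup>2" "\<bar>sinh x - x\<bar> \<le> x\<^sup>2"
proof -
  show "0 \<le> cosh x - 1" using cosh_real_ge_1[of x] by simp
  have "\<bar>- x\<bar> \<le> 1" using assms by simp
  note a = exp_quadratic_bound[OF assms] exp_quadratic_bound[OF this, unfolded power2_minus]
  have c: "cosh x - 1 = ((exp x - 1 - x) + (exp (-x) - 1 + x)) / 2" by (simp add: cosh_field_def)
  have s: "sinh x - x = ((exp x - 1 - x) - (exp (-x) - 1 + x)) / 2" by (simp add: sinh_field_def field_simps)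
  show "cosh x - 1 \<le> x\<^sup>2" unfolding c using a by simp
  show "\<bar>sinh x - x\<bar> \<le> x\<^sup>2" unfolding s using a by argo
qed

lemma coth_gt_1: "0 < p \<Longrightarrow> 1 < coth p"
  using sinh_less_cosh_real[of p] by (simp add: coth_def)

text \<open>By the addition theorems the ratios are \<open>cosh x + coth p * sinh x\<close> and
\<open>cosh x + sinh x / coth p\<close>. The hypothesis weighs \<open>x\<close> by \<open>coth p\<close> because this is the
coefficient of \<open>sinh x\<close> in the first ratio; it is large when \<open>p\<close> is small.\<close>

lemma sinh_ratio_bound:
  assumes p: "0 < p" and x: "coth p * \<bar>x\<bar> \<le> e" and e: "e \<le> 1"
  shows "\<bar>sinh (p + x) / sinh p - 1\<bar> \<le> 3 * e" "\<bar>cosh (p + x) / cosh p - 1\<bar> \<le> 3 * e"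
    "\<bar>sinh x + coth p * (cosh x - 1) - x\<bar> \<le> 2 * e * \<bar>x\<bar>"
proof -
  define t where "t = coth p"
  have t: "1 \<le> t" using coth_gt_1[OF p] by (simp add: t_def)
  have "\<bar>x\<bar> * 1 \<le> \<bar>x\<bar> * t" using t by (intro mult_left_mono) auto
  then have xe: "\<bar>x\<bar> \<le> e" "\<bar>x\<bar> \<le> 1" "t * \<bar>x\<bar> \<le> e" using x e by (auto simp: t_def mult.commute)
  note b = cosh_sinh_bounds[OF xe(2)]
  have x2: "x\<^sup>2 \<le> e * \<bar>x\<bar>" "t * x\<^sup>2 \<le> e * \<bar>x\<bar>"
    using mult_right_mono[OF xe(1), of "\<bar>x\<bar>"] mult_right_mono[OF xe(3), of "\<bar>x\<bar>"]
    by (auto simp: power2_eq_square mult.assoc simp flip: abs_mult)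
  have e0: "0 \<le> e" using xe(1) by simp
  have ex: "e * \<bar>x\<bar> \<le> e" using mult_left_mono[OF xe(2) e0] by simp
  have sx: "\<bar>sinh x\<bar> \<le> 2 * \<bar>x\<bar>"
  proof -
    have "x\<^sup>2 \<le> \<bar>x\<bar>" using mult_right_mono[OF xe(2), of "\<bar>x\<bar>"] by (simp add: power2_eq_square)
    then show ?thesis using b(3) by linarith
  qed
  have "sinh (p + x) / sinh p - 1 = (cosh x - 1) + t * sinh x"
    using p by (simp add: sinh_add t_def coth_def field_simps)
  moreover have "\<bar>t * sinh x\<bar> \<le> 2 * e"
    using mult_left_mono[OF sx, of t] t xe(3) by (simp add: abs_mult, linarith)
  ultimately show "\<bar>sinh (p + x) / sinh p - 1\<bar> \<le> 3 * e"
    using b x2 ex by linarith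
  have "cosh (p + x) / cosh p - 1 = (cosh x - 1) + sinh x / t"
    using p by (simp add: cosh_add t_def coth_def field_simps)
  moreover have "\<bar>sinh x / t\<bar> \<le> 2 * e"
  proof -
    have "\<bar>sinh x / t\<bar> \<le> \<bar>sinh x\<bar>" using t by (simp add: abs_mult divide_le_eq mult_le_cancel_left1)
    then show ?thesis using sx xe by linarith
  qed
  ultimately show "\<bar>cosh (p + x) / cosh p - 1\<bar> \<le> 3 * e"
    using b x2 ex by linarith
  have "t * (cosh x - 1) \<le> t * x\<^sup>2" "0 \<le> t * (cosh x - 1)"
    using b t by (auto intro!: mult_left_mono)
  then show "\<bar>sinh x + coth p * (cosh x - 1) - x\<bar> \<le> 2 * e * \<bar>x\<bar>"
    using b x2 unfolding t_def[symmetric] by linarith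
qed

text \<open>Here \<open>p\<close> is \<open>\<kappa> * \<rho>\<close>, \<open>a\<close> is \<open>\<kappa> * \<epsilon>\<close>, and \<open>x0\<close>, \<open>x1\<close> are the standardised radii of
the query and a prototype. The quotient by \<open>b\<close> factors as \<open>C / S * I\<close>, where
\<open>C / S = coth (p + a * x0) / coth p\<close> is close to 1 and
\<open>I = (sinh (a * x1) + coth p * (cosh (a * x1) - 1)) / a\<close> is close to \<open>x1\<close>.\<close>

lemma score_main_term_bound:
  fixes p a x0 x1 b K :: real
  assumes p: "0 < p" and a: "0 < a" and b: "b = a * coth p"
    and x: "\<bar>x0\<bar> \<le> K" "\<bar>x1\<bar> \<le> K" and small: "b * K \<le> 1 / 4"
  shows "\<bar>coth (p + a * x0) * (cosh (p + a * x1) - cosh p) / sinh p / b - x1\<bar> \<le> 40 * b * K\<^sup>2"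
proof -
  define e where "e = b * K"
  have t: "1 < coth p" by (rule coth_gt_1[OF p])
  have b0: "0 < b" using a t by (simp add: b)
  have K: "0 \<le> K" using x by linarith
  have e: "0 \<le> e" "e \<le> 1 / 4" using b0 K small by (auto simp: e_def)
  have tx: "coth p * \<bar>a * x\<bar> \<le> e" if "\<bar>x\<bar> \<le> K" for x
    using mult_left_mono[OF that, of b] b0 a by (simp add: e_def b abs_mult mult_ac)
  note B0 = sinh_ratio_bound[OF p tx[OF x(1)]] and B1 = sinh_ratio_bound[OF p tx[OF x(2)]]
  define S C where "S = sinh (p + a * x0) / sinh p" and "C = cosh (p + a * x0) / cosh p"
  have SC: "\<bar>S - 1\<bar> \<le> 3 * e" "\<bar>C - 1\<bar> \<le> 3 * e" using B0 e by (auto simp: S_def C_def)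
  then have S: "1 / 4 \<le> S" using e by linarith
  have A: "\<bar>C / S - 1\<bar> \<le> 24 * e"
  proof -
    have "\<bar>C / S - 1\<bar> = \<bar>C - S\<bar> / S" using S by (simp add: diff_divide_distrib[symmetric] abs_divide
      field_simps)
    also have "\<dots> \<le> (6 * e) / (1 / 4)" using SC S by (intro frac_le) auto
    finally show ?thesis by simp
  qed
  define I where "I = (sinh (a * x1) + coth p * (cosh (a * x1) - 1)) / a"
  have I: "\<bar>I - x1\<bar> \<le> 2 * e * K"
  proof -
    have "\<bar>I - x1\<bar> = \<bar>sinh (a * x1) + coth p * (cosh (a * x1) - 1) - a * x1\<bar> / a"
      using a by (simp add: I_def field_simps abs_divide)
    also have "\<dots> \<le> 2 * e * \<bar>a * x1\<bar> / a" using B1(3) e a by (intro divide_right_mono) auto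
    also have "\<dots> = 2 * e * \<bar>x1\<bar>" using a by (simp add: abs_mult)
    also have "\<dots> \<le> 2 * e * K" using x e by (intro mult_left_mono) auto
    finally show ?thesis .
  qed
  have eq: "coth (p + a * x0) * (cosh (p + a * x1) - cosh p) / sinh p / b = C / S * I"
  proof -
    have "coth (p + a * x0) = C / S * coth p"
      using p by (simp add: C_def S_def coth_def)
    moreover have "(cosh (p + a * x1) - cosh p) / sinh p = a * I"
      using p a by (simp add: I_def cosh_add coth_def field_simps)
    ultimately have "coth (p + a * x0) * (cosh (p + a * x1) - cosh p) / sinh p / b
      = C / S * coth p * (a * I) / b"
      by (simp only: times_divide_eq_right[symmetric])
    also have "\<dots> = C / S * I" using b0 a t by (simp add: b)
    finally show ?thesis .
  qed
  have "\<bar>C / S * I - x1\<bar> = \<bar>(C / S - 1) * I + (I - x1)\<bar>" by (simp add: algebra_simps)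
  also have "\<dots> \<le> \<bar>C / S - 1\<bar> * \<bar>I\<bar> + \<bar>I - x1\<bar>"
    by (rule order_trans[OF abs_triangle_ineq]) (simp only: abs_mult order_refl)
  also have "\<dots> \<le> 24 * e * (3 / 2 * K) + 2 * e * K"
  proof -
    have "2 * e * K \<le> 1 / 2 * K" using e K by (intro mult_right_mono) auto
    then have "\<bar>I\<bar> \<le> 3 / 2 * K" using I x by linarith
    then show ?thesis using A I e by (intro add_mono mult_mono) auto
  qed
  also have "\<dots> \<le> 40 * b * K\<^sup>2"
  proof -
    have "24 * e * (3 / 2 * K) + 2 * e * K = 38 * (b * K\<^sup>2)"
      by (simp add: e_def power2_eq_square)
    moreover have "0 \<le> b * K\<^sup>2" using b0 by simp
    ultimately show ?thesis by simp
  qed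
  finally show ?thesis unfolding eq .
qed

section \<open>Scores, remainders and geodesic distance\<close>

lemma sets_unif_sphere [measurable_cong, simp]: "sets (unif_sphere d) = sets (vec_borel d)"
  by (simp add: unif_sphere_def)

lemma space_unif_sphere [simp]: "space (unif_sphere d) = space (vec_borel d)"
  by (rule sets_eq_imp_space_eq) simp

lemma AE_unif_sphere_unit: "AE v in unif_sphere d. dotp d v v = 1"
proof -
  have [measurable]: "normalise d \<in> measurable (leb d) (vec_borel d)"
    using normalise_measurable[of d] by (simp add: measurable_cong_sets[OF sets_leb refl])
  have "AE x in uniform_measure (leb d) (punctured_ball d). dotp d (normalise d x) (normalise d x) = 1"
  proof (rule AE_uniform_measureI[OF punctured_ball_sets], intro AE_I2 impI)
    fix x assume "x \<in> punctured_ball d"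
    from normalise_on_sphere[OF this] show "dotp d (normalise d x) (normalise d x) = 1"
      by (simp add: vnorm_def)
  qed
  then show ?thesis
    unfolding unif_sphere_def by (subst AE_distr_iff) auto
qed

lemma dotp_Cauchy_Schwarz:
  assumes "dotp d u u = 1" "dotp d v v = 1"
  shows "\<bar>dotp d u v\<bar> \<le> 1"
proof -
  have "(dotp d u v)\<^sup>2 \<le> dotp d u u * dotp d v v"
    unfolding dotp_def using Cauchy_Schwarz_ineq_sum[of u v "{..<d}"] by (simp add: power2_eq_square)
  then show ?thesis by (simp add: assms abs_square_le_1)
qed

text \<open>The hyperbolic law of cosines. The right-hand side is at least \<open>cosh (\<kappa> * r - \<kappa> * s) \<ge> 1\<close>, so
\<open>cosh\<close> inverts \<open>arcosh\<close> there.\<close>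

lemma cosh_hyp_dist_polar:
  assumes "0 < \<kappa>" "0 < r" "0 < s" "dotp d u u = 1" "dotp d v v = 1"
  shows "cosh (\<kappa> * hyp_dist \<kappa> d (hyp_polar \<kappa> d r u) (hyp_polar \<kappa> d s v))
    = cosh (\<kappa> * r) * cosh (\<kappa> * s) - sinh (\<kappa> * r) * sinh (\<kappa> * s) * dotp d u v"
proof -
  let ?c = "cosh (\<kappa> * r) * cosh (\<kappa> * s) - sinh (\<kappa> * r) * sinh (\<kappa> * s) * dotp d u v"
  have "1 \<le> cosh (\<kappa> * r - \<kappa> * s)" by (rule cosh_real_ge_1)
  also have "\<dots> = cosh (\<kappa> * r) * cosh (\<kappa> * s) - sinh (\<kappa> * r) * sinh (\<kappa> * s) * 1"
    by (simp add: cosh_diff)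
  also have "\<dots> \<le> ?c"
    using dotp_Cauchy_Schwarz[OF assms(4,5)] assms(1-3) by (intro diff_left_mono mult_left_mono) auto
  finally have "1 \<le> ?c" .
  moreover have "- \<kappa>\<^sup>2 * minkowski d (hyp_polar \<kappa> d r u) (hyp_polar \<kappa> d s v) = ?c"
    unfolding minkowski_hyp_polar using assms(1) by simp
  ultimately show ?thesis
    using assms(1) by (simp add: hyp_dist_def)
qed

text \<open>Conditionally on the second direction this is the tail of a single projection.\<close>

lemma indep_dotp_tail:
  assumes M: "prob_space M" and d: "1 \<le> d" and K: "0 < K"
    and ind: "prob_space.indep_var M (vec_borel d) X (vec_borel d) Y"
    and X: "distr M (vec_borel d) X = unif_sphere d" and Y: "distr M (vec_borel d) Y = unif_sphere d"
  shows "measure M {\<omega> \<in> space M. K < \<bar>sqrt d * dotp d (X \<omega>) (Y \<omega>)\<bar>} \<le> 4 / d + 4 / K\<^sup>2"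
proof -
  interpret prob_space M by fact
  interpret S: prob_space "unif_sphere d" by (rule prob_space_unif_sphere[OF d])
  interpret SS: pair_prob_space "unif_sphere d" "unif_sphere d" ..
  have [measurable]: "X \<in> measurable M (vec_borel d)" "Y \<in> measurable M (vec_borel d)"
    using indep_var_rv1[OF ind] indep_var_rv2[OF ind] by auto
  let ?A = "{z \<in> space (vec_borel d \<Otimes>\<^sub>M vec_borel d). K < \<bar>sqrt d * dotp d (fst z) (snd z)\<bar>}"
  have A [measurable]: "?A \<in> sets (vec_borel d \<Otimes>\<^sub>M vec_borel d)" by measurable
  have "emeasure M {\<omega> \<in> space M. K < \<bar>sqrt d * dotp d (X \<omega>) (Y \<omega>)\<bar>}
    = emeasure (distr M (vec_borel d \<Otimes>\<^sub>M vec_borel d) (\<lambda>\<omega>. (X \<omega>, Y \<omega>))) ?A"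
  proof -
    have "(\<lambda>\<omega>. (X \<omega>, Y \<omega>)) -` ?A \<inter> space M = {\<omega> \<in> space M. K < \<bar>sqrt d * dotp d (X \<omega>) (Y \<omega>)\<bar>}"
      using measurable_space[of X M "vec_borel d"] measurable_space[of Y M "vec_borel d"]
      by (auto simp: space_pair_measure)
    then show ?thesis by (simp add: emeasure_distr del: vimage_Collect_eq)
  qed
  also have "distr M (vec_borel d \<Otimes>\<^sub>M vec_borel d) (\<lambda>\<omega>. (X \<omega>, Y \<omega>)) = unif_sphere d \<Otimes>\<^sub>M unif_sphere d"
    using ind unfolding indep_var_distribution_eq X Y by simp
  also have "emeasure (unif_sphere d \<Otimes>\<^sub>M unif_sphere d) ?A
    = (\<integral>\<^sup>+y. emeasure (unif_sphere d) ((\<lambda>x. (x, y)) -` ?A) \<partial>unif_sphere d)"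
    by (rule SS.emeasure_pair_measure_alt2) measurable
  also have "\<dots> \<le> (\<integral>\<^sup>+y. ennreal (4 / d + 4 / K\<^sup>2) \<partial>unif_sphere d)"
  proof (rule nn_integral_mono_AE)
    show "AE y in unif_sphere d. emeasure (unif_sphere d) ((\<lambda>x. (x, y)) -` ?A) \<le> ennreal (4 / d + 4 / K\<^sup>2)"
      using AE_unif_sphere_unit AE_space
    proof eventually_elim
      case (elim y)
      have "(\<lambda>x. (x, y)) -` ?A = {v \<in> space (unif_sphere d). K < \<bar>sqrt d * dotp d v y\<bar>}"
        using elim(2) by (auto simp: space_pair_measure)
      then show ?case
        using sphere_dotp_tail[OF d elim(1) K] elim(2)
          by (simp add: S.emeasure_eq_measure ennreal_leI del: ennreal_plus)
    qed
  qed
  also have "\<dots> = ennreal (4 / d + 4 / K\<^sup>2)"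
    using S.emeasure_space_1 by simp
  finally show ?thesis
    using K by (simp add: emeasure_eq_measure del: ennreal_plus)
qed

text \<open>The score \<open>S x z\<close> is an increasing affine function of \<open>cosh q * cosh x - sinh q * sinh x * z\<close>, with
coefficients that depend on \<open>q\<close>, \<open>p\<close> and \<open>m\<close> only.\<close>

lemma ordering_by_scores:
  fixes q p s t :: real
  assumes "0 < q" "0 < p" "0 < m"
  defines "S \<equiv> \<lambda>x z. m * (coth q * (cosh x - cosh p) / sinh p) - sinh x / sinh p * (m * z)"
  shows "cosh q * cosh x - sinh q * sinh x * z \<le> cosh q * cosh y - sinh q * sinh y * w \<longleftrightarrow> S x z \<le> S y w"
proof -
  have pos: "0 < m / (sinh q * sinh p)" using assms by simp
  have eq: "S x z = m / (sinh q * sinh p) * (cosh q * cosh x - sinh q * sinh x * z)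
    - m * coth q * cosh p / sinh p" for x z
    using assms(1,2) by (simp add: S_def coth_def field_simps)
  show ?thesis unfolding eq by (simp only: diff_le_eq diff_add_cancel mult_le_cancel_left_pos[OF pos])
qed

text \<open>In the application \<open>m\<close> is \<open>sqrt d\<close>, so \<open>m * b\<close> is \<open>lam\<close>, and \<open>z\<close> is the rescaled inner
product of the two directions.\<close>

lemma remainder_bound:
  fixes p a x0 x1 b K m z :: real
  assumes p: "0 < p" and a: "0 < a" and b: "b = a * coth p" and m: "0 \<le> m"
    and x: "\<bar>x0\<bar> \<le> K" "\<bar>x1\<bar> \<le> K" and z: "\<bar>z\<bar> \<le> K" and small: "b * K \<le> 1 / 4"
  shows "\<bar>m * (coth (p + a * x0) * (cosh (p + a * x1) - cosh p) / sinh p) - sinh (p + a * x1) / sinh p * z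
      - m * b * x1 + z\<bar> \<le> 40 * b * K\<^sup>2 * (1 + m * b)"
proof -
  have t: "1 < coth p" by (rule coth_gt_1[OF p])
  have b0: "0 < b" using a t by (simp add: b)
  have K: "0 \<le> K" using x by linarith
  let ?W = "coth (p + a * x0) * (cosh (p + a * x1) - cosh p) / sinh p / b - x1"
  let ?V = "sinh (p + a * x1) / sinh p - 1"
  have W: "\<bar>?W\<bar> \<le> 40 * b * K\<^sup>2" by (rule score_main_term_bound[OF p a b x small])
  have V: "\<bar>?V\<bar> \<le> 3 * (b * K)"
  proof (rule sinh_ratio_bound[OF p])
    show "coth p * \<bar>a * x1\<bar> \<le> b * K"
      using mult_left_mono[OF x(2), of b] b0 a by (simp add: b abs_mult mult_ac)
    show "b * K \<le> 1" using small by simp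
  qed
  have "m * (coth (p + a * x0) * (cosh (p + a * x1) - cosh p) / sinh p) - sinh (p + a * x1) / sinh p * z
    - m * b * x1 + z
    = m * b * ?W - ?V * z"
  proof -
    have "m * T - v * z - m * b * x1 + z = m * b * (T / b - x1) - (v - 1) * z" for T v
      using b0 by (simp add: algebra_simps)
    then show ?thesis by blast
  qed
  also have "\<bar>\<dots>\<bar> \<le> \<bar>m * b * ?W\<bar> + \<bar>?V * z\<bar>" by (rule abs_triangle_ineq4)
  also have "\<dots> \<le> m * b * (40 * b * K\<^sup>2) + 3 * (b * K) * K"
  proof (rule add_mono)
    show "\<bar>m * b * ?W\<bar> \<le> m * b * (40 * b * K\<^sup>2)"
      unfolding abs_mult[of "m * b"] using W m b0 by (intro mult_mono) auto
    show "\<bar>?V * z\<bar> \<le> 3 * (b * K) * K"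
      unfolding abs_mult using V z b0 K by (intro mult_mono) auto
  qed
  also have "\<dots> \<le> 40 * b * K\<^sup>2 * (1 + m * b)"
  proof -
    have "0 \<le> b * K\<^sup>2" using b0 by simp
    then show ?thesis by (simp add: algebra_simps power2_eq_square)
  qed
  finally show ?thesis .
qed

text \<open>One estimate serves both regimes: \<open>1 + l\<close> is bounded when \<open>l\<close> is, and is at most \<open>2 * l\<close> once
\<open>l \<ge> 1\<close>.\<close>

lemma small_op_cases:
  fixes M :: "nat \<Rightarrow> 'a measure"
  assumes prob: "\<And>d. 1 \<le> d \<Longrightarrow> prob_space (M d)"
    and r: "\<And>d. 1 \<le> d \<Longrightarrow> r d \<in> borel_measurable (M d)"
    and lim: "\<And>\<eta>. 0 < \<eta> \<Longrightarrow> (\<lambda>d. measure (M d) {\<omega> \<in> space (M d). \<eta> * (1 + l d) < \<bar>r d \<omega>\<bar>}) \<longlonglongrightarrow> 0"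
  shows "l \<in> O(\<lambda>_. 1) \<Longrightarrow> small_op M r (\<lambda>_. 1)"
    and "filterlim l at_top sequentially \<Longrightarrow> small_op M r l"
proof -
  have compare: "(\<lambda>d. measure (M d) {\<omega> \<in> space (M d). e < \<bar>r d \<omega> / a d - 0\<bar>}) \<longlonglongrightarrow> 0"
    if "0 < \<eta>" and ev: "\<forall>\<^sub>F d in sequentially. 0 < a d \<and> \<eta> * (1 + l d) \<le> e * a d" for \<eta> e a
  proof (rule tendsto_sandwich[OF _ _ tendsto_const lim[OF \<open>0 < \<eta>\<close>]])
    show "\<forall>\<^sub>F d in sequentially. measure (M d) {\<omega> \<in> space (M d). e < \<bar>r d \<omega> / a d - 0\<bar>}
        \<le> measure (M d) {\<omega> \<in> space (M d). \<eta> * (1 + l d) < \<bar>r d \<omega>\<bar>}"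
      using ev eventually_ge_at_top[of 1]
    proof eventually_elim
      case (elim d)
      interpret prob_space "M d" using elim by (intro prob) auto
      have [measurable]: "r d \<in> borel_measurable (M d)" using elim by (intro r)
      show ?case
      proof (rule finite_measure_mono)
        show "{\<omega> \<in> space (M d). e < \<bar>r d \<omega> / a d - 0\<bar>} \<subseteq> {\<omega> \<in> space (M d). \<eta> * (1 + l d) < \<bar>r d \<omega>\<bar>}"
          using elim by (auto simp: abs_divide less_divide_eq)
      qed measurable
    qed
  qed simp
  { assume "l \<in> O(\<lambda>_. 1)"
    then obtain c where c: "0 < c" "\<forall>\<^sub>F d in sequentially. norm (l d) \<le> c * norm (1 :: real)"
      by (rule landau_o.bigE)
    show "small_op M r (\<lambda>_. 1)"
      unfolding small_op_def tendsto_in_prob_def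
    proof (intro allI impI)
      fix e :: real assume e: "0 < e"
      show "(\<lambda>d. measure (M d) {\<omega> \<in> space (M d). e < \<bar>r d \<omega> / 1 - 0\<bar>}) \<longlonglongrightarrow> 0"
      proof (rule compare[where \<eta> = "e / (1 + c)"])
        show "\<forall>\<^sub>F d in sequentially. 0 < (1::real) \<and> e / (1 + c) * (1 + l d) \<le> e * 1"
          using c(2)
        proof eventually_elim
          case (elim d)
          then have "e * (1 + l d) \<le> e * (1 + c)" using e by (intro mult_left_mono) auto
          then show ?case using c(1) by (simp add: divide_le_eq)
        qed
      qed (use e c in auto)
    qed }
  { assume l: "filterlim l at_top sequentially"
    show "small_op M r l"
      unfolding small_op_def tendsto_in_prob_def
    proof (intro allI impI)
      fix e :: real assume e: "0 < e"
      show "(\<lambda>d. measure (M d) {\<omega> \<in> space (M d). e < \<bar>r d \<omega> / l d - 0\<bar>}) \<longlonglongrightarrow> 0"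
      proof (rule compare[where \<eta> = "e / 2"])
        have "\<forall>\<^sub>F d in sequentially. 1 \<le> l d" using l by (simp add: filterlim_at_top)
        then show "\<forall>\<^sub>F d in sequentially. 0 < l d \<and> e / 2 * (1 + l d) \<le> e * l d"
        proof eventually_elim
          case (elim d)
          then have "e / 2 * (1 + l d) \<le> e / 2 * (2 * l d)" using e by (intro mult_left_mono) auto
          then show ?case using elim by simp
        qed
      qed (use e in auto)
    qed }
qed

lemma cosh_sinh_measurable [measurable]:
  "(cosh :: real \<Rightarrow> real) \<in> borel_measurable borel" "(sinh :: real \<Rightarrow> real) \<in> borel_measurable borel"
  by (auto intro!: borel_measurable_continuous_onI continuous_intros)

lemma coth_measurable [measurable]: "coth \<in> borel_measurable borel"
  unfolding coth_def[abs_def] by measurable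

section \<open>The ordering of the prototypes\<close>

theorem lemma2:
  fixes P :: "nat \<Rightarrow> 'p measure"
    and R :: "nat \<Rightarrow> 'p \<Rightarrow> real"
    and U :: "nat \<Rightarrow> 'p \<Rightarrow> nat \<Rightarrow> real"
    and N :: "'n measure"
    and \<Xi> :: "'n \<Rightarrow> real"
    and M :: "nat \<Rightarrow> 'm measure"
    and Rc :: "nat \<Rightarrow> nat \<Rightarrow> 'm \<Rightarrow> real"
    and Uc :: "nat \<Rightarrow> nat \<Rightarrow> 'm \<Rightarrow> nat \<Rightarrow> real"
    and \<kappa> \<rho> \<epsilon> b lam :: "nat \<Rightarrow> real"
    and \<xi> :: "nat \<Rightarrow> 'p \<Rightarrow> real"
    and \<xi>c C Z :: "nat \<Rightarrow> nat \<Rightarrow> 'm \<Rightarrow> real"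
  assumes prob_P: "\<And>d. d \<ge> 1 \<Longrightarrow> prob_space (P d)"
    and kappa_pos: "\<And>d. d \<ge> 1 \<Longrightarrow> \<kappa> d > 0"
    and R_measurable: "\<And>d. d \<ge> 1 \<Longrightarrow> R d \<in> borel_measurable (P d)"
    and R_pos: "\<And>d. d \<ge> 1 \<Longrightarrow> AE \<omega> in P d. R d \<omega> > 0"
    and R_square_integrable: "\<And>d. d \<ge> 1 \<Longrightarrow> integrable (P d) (\<lambda>\<omega>. (R d \<omega>)\<^sup>2)"
    and rho: "\<And>d. \<rho> d = (LINT \<omega>|P d. R d \<omega>)"
    and eps: "\<And>d. \<epsilon> d = sqrt (LINT \<omega>|P d. (R d \<omega> - \<rho> d)\<^sup>2)"
    and eps_pos: "\<And>d. d \<ge> 1 \<Longrightarrow> \<epsilon> d > 0"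
    and xi: "\<And>d \<omega>. \<xi> d \<omega> = (R d \<omega> - \<rho> d) / \<epsilon> d"
    and U_measurable: "\<And>d. d \<ge> 1 \<Longrightarrow> U d \<in> measurable (P d) (vec_borel d)"
    and U_uniform: "\<And>d. d \<ge> 1 \<Longrightarrow> distr (P d) (vec_borel d) (U d) = unif_sphere d"
    and R_U_indep: "\<And>d. d \<ge> 1 \<Longrightarrow>
          prob_space.indep_set (P d)
            {R d -` A \<inter> space (P d) | A. A \<in> sets borel}
            {U d -` B \<inter> space (P d) | B. B \<in> sets (vec_borel d)}"
    and prob_N: "prob_space N"
    and Xi_measurable: "\<Xi> \<in> borel_measurable N"
    and xi_weak_conv: "weak_conv_m (\<lambda>d. distr (P d) borel (\<xi> d)) (distr N borel \<Xi>)"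
    and b: "\<And>d. b d = \<kappa> d * \<epsilon> d * coth (\<kappa> d * \<rho> d)"
    and b_tendsto: "b \<longlonglongrightarrow> 0"
    and lam: "\<And>d. lam d = sqrt (real d) * b d"
    and prob_M: "\<And>d. d \<ge> 1 \<Longrightarrow> prob_space (M d)"
    and copies_measurable: "\<And>d i. d \<ge> 1 \<Longrightarrow> i \<le> 3 \<Longrightarrow>
          (\<lambda>\<omega>. (Rc i d \<omega>, Uc i d \<omega>)) \<in> measurable (M d) (borel \<Otimes>\<^sub>M vec_borel d)"
    and copies_distr: "\<And>d i. d \<ge> 1 \<Longrightarrow> i \<le> 3 \<Longrightarrow>
          distr (M d) (borel \<Otimes>\<^sub>M vec_borel d) (\<lambda>\<omega>. (Rc i d \<omega>, Uc i d \<omega>))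
            = distr (P d) (borel \<Otimes>\<^sub>M vec_borel d) (\<lambda>\<omega>. (R d \<omega>, U d \<omega>))"
    and copies_indep: "\<And>d. d \<ge> 1 \<Longrightarrow>
          prob_space.indep_vars (M d) (\<lambda>_. borel \<Otimes>\<^sub>M vec_borel d)
            (\<lambda>i \<omega>. (Rc i d \<omega>, Uc i d \<omega>)) {0..3}"
    and xic: "\<And>i d \<omega>. \<xi>c i d \<omega> = (Rc i d \<omega> - \<rho> d) / \<epsilon> d"
    and C: "\<And>i d \<omega>. C i d \<omega> =
          cosh (\<kappa> d * Rc 0 d \<omega>) * cosh (\<kappa> d * Rc i d \<omega>)
            - sinh (\<kappa> d * Rc 0 d \<omega>) * sinh (\<kappa> d * Rc i d \<omega>) * dotp d (Uc 0 d \<omega>) (Uc i d \<omega>)"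
    and Z: "\<And>i d \<omega>. Z i d \<omega> = sqrt (real d) * dotp d (Uc 0 d \<omega>) (Uc i d \<omega>)"
  shows "(\<forall>d\<ge>1. AE \<omega> in M d. \<forall>i\<in>{1..3}.
            C i d \<omega> = cosh (\<kappa> d * hyp_dist (\<kappa> d) d
              (hyp_polar (\<kappa> d) d (Rc 0 d \<omega>) (Uc 0 d \<omega>))
              (hyp_polar (\<kappa> d) d (Rc i d \<omega>) (Uc i d \<omega>))))
       \<and> (\<exists>r :: nat \<Rightarrow> nat \<Rightarrow> 'm \<Rightarrow> real.
            (\<forall>d\<ge>1. \<forall>i\<in>{1..3}. r i d \<in> borel_measurable (M d))
          \<and> (\<forall>d\<ge>1. AE \<omega> in M d. \<forall>i\<in>{1..3}. \<forall>j\<in>{1..3}.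
               C i d \<omega> \<le> C j d \<omega> \<longleftrightarrow>
               lam d * \<xi>c i d \<omega> - Z i d \<omega> + r i d \<omega> \<le> lam d * \<xi>c j d \<omega> - Z j d \<omega> + r j d \<omega>)
          \<and> (lam \<in> O(\<lambda>_. 1) \<longrightarrow> (\<forall>i\<in>{1..3}. small_op M (r i) (\<lambda>_. 1)))
          \<and> (filterlim lam at_top sequentially \<longrightarrow> (\<forall>i\<in>{1..3}. small_op M (r i) lam)))
       \<and> (\<forall>f :: real \<times> real \<times> real \<Rightarrow> real.
            continuous_on UNIV f \<longrightarrow> bounded (range f) \<longrightarrow>
            tendsto_in_prob M
              (\<lambda>d. real_cond_exp (M d)
                 (prototype_algebra (M d) d (\<lambda>i. Rc i d) (\<lambda>i. Uc i d))
                 (\<lambda>\<omega>. f (Z 1 d \<omega>, Z 2 d \<omega>, Z 3 d \<omega>)))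
              (LINT z|std_normal3. f z))"
proof -
  have vec: "Uc i d \<in> measurable (M d) (vec_borel d)" and rad: "Rc i d \<in> borel_measurable (M d)" if "1 \<le> d" "i
    \<le> 3" for i d
    using measurable_compose[OF copies_measurable[OF that] measurable_snd]
      measurable_compose[OF copies_measurable[OF that] measurable_fst] by simp_all
  have Uc_law: "distr (M d) (vec_borel d) (Uc i d) = unif_sphere d" if d: "1 \<le> d" "i \<le> 3" for i d
  proof -
    have [measurable]: "(\<lambda>\<omega>. (Rc i d \<omega>, Uc i d \<omega>)) \<in> measurable (M d) (borel \<Otimes>\<^sub>M vec_borel d)"
      "R d \<in> borel_measurable (P d)" "U d \<in> measurable (P d) (vec_borel d)"
      using d copies_measurable R_measurable U_measurable by auto
    have "distr (M d) (vec_borel d) (Uc i d) = distr (distr (M d) (borel \<Otimes>\<^sub>M vec_borel d) (\<lambda>\<omega>.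
      (Rc i d \<omega>, Uc i d \<omega>))) (vec_borel d) snd"
      by (subst distr_distr) (auto simp: comp_def)
    also have "\<dots> = distr (P d) (vec_borel d) (U d)"
      unfolding copies_distr[OF d] by (subst distr_distr) (auto simp: comp_def)
    finally show ?thesis using U_uniform[OF d(1)] by simp
  qed
  have Rc_law: "distr (M d) borel (Rc i d) = distr (P d) borel (R d)" if d: "1 \<le> d" "i \<le> 3" for i d
  proof -
    have [measurable]: "(\<lambda>\<omega>. (Rc i d \<omega>, Uc i d \<omega>)) \<in> measurable (M d) (borel \<Otimes>\<^sub>M vec_borel d)"
      "R d \<in> borel_measurable (P d)" "U d \<in> measurable (P d) (vec_borel d)"
      using d copies_measurable R_measurable U_measurable by auto
    have "distr (M d) borel (Rc i d) = distr (distr (M d) (borel \<Otimes>\<^sub>M vec_borel d) (\<lambda>\<omega>.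
      (Rc i d \<omega>, Uc i d \<omega>))) borel fst"
      by (subst distr_distr) (auto simp: comp_def)
    also have "\<dots> = distr (P d) borel (R d)"
      unfolding copies_distr[OF d] by (subst distr_distr) (auto simp: comp_def)
    finally show ?thesis .
  qed
  have unit: "AE \<omega> in M d. dotp d (Uc i d \<omega>) (Uc i d \<omega>) = 1" if d: "1 \<le> d" "i \<le> 3" for i d
  proof -
    have "AE v in distr (M d) (vec_borel d) (Uc i d). dotp d v v = 1"
      unfolding Uc_law[OF d] by (rule AE_unif_sphere_unit)
    then show ?thesis by (subst (asm) AE_distr_iff) (auto simp: vec[OF d])
  qed
  have pos: "AE \<omega> in M d. 0 < Rc i d \<omega>" if d: "1 \<le> d" "i \<le> 3" for i d
  proof -
    have "AE x in distr (P d) borel (R d). 0 < x"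
      using R_pos[OF d(1)] by (subst AE_distr_iff) (auto simp: R_measurable[OF d(1)])
    then show ?thesis
      unfolding Rc_law[OF d, symmetric] by (subst (asm) AE_distr_iff) (auto simp: rad[OF d])
  qed
  have rho_pos: "0 < \<rho> d" if d: "1 \<le> d" for d
  proof -
    interpret prob_space "P d" by (rule prob_P[OF d])
    have "integrable (P d) (R d)"
      by (rule square_integrable_imp_integrable[OF R_measurable[OF d] R_square_integrable[OF d]])
    then show ?thesis unfolding rho by (rule expectation_greater) (rule R_pos[OF d])
  qed
  have b_pos: "0 < b d" if "1 \<le> d" for d
    unfolding b using kappa_pos[OF that] eps_pos[OF that] rho_pos[OF that] coth_gt_1[of "\<kappa> d * \<rho> d"]
    by (intro mult_pos_pos) auto

  have radial_tail: "measure (M d) {\<omega> \<in> space (M d). K < \<bar>\<xi>c i d \<omega>\<bar>} \<le> 1 / K\<^sup>2" if d: "1 \<le> d" "i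
    \<le> 3" and K: "0 < K" for i d K
  proof -
    interpret M: prob_space "M d" by (rule prob_M[OF d(1)])
    interpret P: prob_space "P d" by (rule prob_P[OF d(1)])
    have [measurable]: "R d \<in> borel_measurable (P d)" "Rc i d \<in> borel_measurable (M d)"
      using R_measurable rad d by auto
    have i1: "integrable (P d) (R d)"
      by (rule P.square_integrable_imp_integrable[OF _ R_square_integrable[OF d(1)]]) measurable
    have i2: "integrable (P d) (\<lambda>\<omega>. (R d \<omega> - \<rho> d)\<^sup>2)"
      unfolding power2_diff using i1 R_square_integrable[OF d(1)]
        by (intro Bochner_Integration.integrable_add Bochner_Integration.integrable_diff) auto
    have var: "(LINT \<omega>|P d. (R d \<omega> - \<rho> d)\<^sup>2) = (\<epsilon> d)\<^sup>2"
      unfolding eps by (simp add: integral_nonneg_AE)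
    have sq: "(\<lambda>\<omega>. ((R d \<omega> - \<rho> d) / \<epsilon> d)\<^sup>2) = (\<lambda>\<omega>. (R d \<omega> - \<rho> d)\<^sup>2 / (\<epsilon> d)\<^sup>2)"
      by (simp add: power_divide)
    have "measure (M d) {\<omega> \<in> space (M d). K < \<bar>\<xi>c i d \<omega>\<bar>}
      = measure (distr (M d) borel (Rc i d)) {x. K < \<bar>(x - \<rho> d) / \<epsilon> d\<bar>}"
      unfolding xic by (subst measure_distr) (auto intro!: arg_cong[where f = "measure (M d)"])
    also have "\<dots> = measure (P d) {\<omega> \<in> space (P d). K < \<bar>(R d \<omega> - \<rho> d) / \<epsilon> d\<bar>}"
      unfolding Rc_law[OF d] by (subst measure_distr) (auto intro!: arg_cong[where f = "measure (P d)"])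
    also have "\<dots> \<le> measure (P d) {\<omega> \<in> space (P d). K \<le> \<bar>(R d \<omega> - \<rho> d) / \<epsilon> d\<bar>}"
      by (rule P.finite_measure_mono) auto
    also have "\<dots> \<le> (LINT \<omega>|P d. ((R d \<omega> - \<rho> d) / \<epsilon> d)\<^sup>2) / K\<^sup>2"
      using i2 K by (intro P.second_moment_method) (auto simp: sq)
    also have "(LINT \<omega>|P d. ((R d \<omega> - \<rho> d) / \<epsilon> d)\<^sup>2) = 1"
      unfolding sq using var eps_pos[OF d(1)] by simp
    finally show ?thesis .
  qed

  have dot_tail: "measure (M d) {\<omega> \<in> space (M d). K < \<bar>sqrt d * dotp d (Uc i d \<omega>) (Uc j d \<omega>)\<bar>}
    \<le> 4 / d + 4 / K\<^sup>2"
    if d: "1 \<le> d" and ij: "i \<le> 3" "j \<le> 3" "i \<noteq> j" and K: "0 < K" for i j d K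
  proof -
    interpret M: prob_space "M d" by (rule prob_M[OF d])
    have "M.indep_var (vec_borel d) ((\<lambda>f. snd (f i)) \<circ> (\<lambda>\<omega>. \<lambda>k\<in>{i}. (Rc k d \<omega>, Uc k d \<omega>)))
        (vec_borel d) ((\<lambda>f. snd (f j)) \<circ> (\<lambda>\<omega>. \<lambda>k\<in>{j}. (Rc k d \<omega>, Uc k d \<omega>)))"
      using ij by (intro M.indep_var_compose[OF M.indep_var_restrict[OF copies_indep[OF d]]]) auto
    then have "M.indep_var (vec_borel d) (Uc i d) (vec_borel d) (Uc j d)"
      by (simp add: comp_def)
    from indep_dotp_tail[OF prob_M[OF d] d K this Uc_law[OF d ij(1)] Uc_law[OF d ij(2)]]
    show ?thesis .
  qed

  \<comment> \<open>The hyperbolic law of cosines on the almost sure event where the radii are positive and the directions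
    are unit vectors.\<close>
  have part1: "\<forall>d\<ge>1. AE \<omega> in M d. \<forall>i\<in>{1..3}. C i d \<omega> = cosh (\<kappa> d * hyp_dist (\<kappa> d) d
      (hyp_polar (\<kappa> d) d (Rc 0 d \<omega>) (Uc 0 d \<omega>)) (hyp_polar (\<kappa> d) d (Rc i d \<omega>) (Uc i d \<omega>)))"
  proof (intro allI impI)
    fix d :: nat assume d: "1 \<le> d"
    have "AE \<omega> in M d. \<forall>i\<in>{0..3}. dotp d (Uc i d \<omega>) (Uc i d \<omega>) = 1 \<and> 0 < Rc i d \<omega>"
      using unit[OF d] pos[OF d] by (intro AE_finite_allI) auto
    then show "AE \<omega> in M d. \<forall>i\<in>{1..3}. C i d \<omega> = cosh (\<kappa> d * hyp_dist (\<kappa> d) d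
      (hyp_polar (\<kappa> d) d (Rc 0 d \<omega>) (Uc 0 d \<omega>)) (hyp_polar (\<kappa> d) d (Rc i d \<omega>) (Uc i d \<omega>)))"
    proof eventually_elim
      case (elim \<omega>)
      then show ?case unfolding C using kappa_pos[OF d] by (auto simp: cosh_hyp_dist_polar)
    qed
  qed

  define r where "r = (\<lambda>i d \<omega>. sqrt d * (coth (\<kappa> d * Rc 0 d \<omega>) * (cosh (\<kappa> d * Rc i d \<omega>)
    - cosh (\<kappa> d * \<rho> d)) / sinh (\<kappa> d * \<rho> d))
    - sinh (\<kappa> d * Rc i d \<omega>) / sinh (\<kappa> d * \<rho> d) * Z i d \<omega> - lam d * \<xi>c i d \<omega> + Z i d \<omega>)"
  have Z_measurable: "Z i d \<in> borel_measurable (M d)" if "1 \<le> d" "i \<le> 3" for i d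
  proof -
    have [measurable]: "Uc i d \<in> measurable (M d) (vec_borel d)" "Uc 0 d \<in> measurable (M d) (vec_borel d)"
      using vec that by auto
    show ?thesis unfolding Z[abs_def] by measurable
  qed
  have r_measurable: "r i d \<in> borel_measurable (M d)" if "1 \<le> d" "i \<le> 3" for i d
  proof -
    have [measurable]: "Z i d \<in> borel_measurable (M d)" "Rc i d \<in> borel_measurable
      (M d)" "Rc 0 d \<in> borel_measurable (M d)"
      using Z_measurable rad that by auto
    show ?thesis unfolding r_def xic by measurable
  qed
  have ordering: "\<forall>d\<ge>1. AE \<omega> in M d. \<forall>i\<in>{1..3}. \<forall>j\<in>{1..3}. C i d \<omega> \<le> C j d \<omega> \<longleftrightarrow>
      lam d * \<xi>c i d \<omega> - Z i d \<omega> + r i d \<omega> \<le> lam d * \<xi>c j d \<omega> - Z j d \<omega> + r j d \<omega>"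
  proof (intro allI impI)
    fix d :: nat assume d: "1 \<le> d"
    have p: "0 < \<kappa> d * \<rho> d" using kappa_pos[OF d] rho_pos[OF d] by simp
    have m: "0 < sqrt (real d)" using d by simp
    show "AE \<omega> in M d. \<forall>i\<in>{1..3}. \<forall>j\<in>{1..3}. C i d \<omega> \<le> C j d \<omega> \<longleftrightarrow>
      lam d * \<xi>c i d \<omega> - Z i d \<omega> + r i d \<omega> \<le> lam d * \<xi>c j d \<omega> - Z j d \<omega> + r j d \<omega>"
      using pos[OF d le0]
    proof eventually_elim
      case (elim \<omega>)
      have q: "0 < \<kappa> d * Rc 0 d \<omega>" using kappa_pos[OF d] elim by simp
      have S: "lam d * \<xi>c i d \<omega> - Z i d \<omega> + r i d \<omega>
        = sqrt d * (coth (\<kappa> d * Rc 0 d \<omega>) * (cosh (\<kappa> d * Rc i d \<omega>) - cosh (\<kappa> d * \<rho> d)) / sinh (\<kappa> d * \<rho> d))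
          - sinh (\<kappa> d * Rc i d \<omega>) / sinh (\<kappa> d * \<rho> d) * (sqrt d * dotp d (Uc 0 d \<omega>) (Uc i d \<omega>))" for i
        by (simp add: r_def Z)
      show ?case unfolding S C by (intro ballI ordering_by_scores[OF q p m])
    qed
  qed

  have remainder: "(\<lambda>d. measure (M d) {\<omega> \<in> space (M d). \<eta> * (1 + lam d) < \<bar>r i d \<omega>\<bar>}) \<longlonglongrightarrow> 0"
    if i: "i \<in> {1..3}" and \<eta>: "0 < \<eta>" for i \<eta>
  proof (rule LIMSEQ_I)
    fix \<tau> :: real assume \<tau>: "0 < \<tau>"
    \<comment> \<open>The two standardised radii and \<open>Z i\<close> exceed \<open>K\<close> with total probability at most \<open>6 / K\<^sup>2 + 4 / d\<close>.\<close>
    define K where "K = 1 + sqrt (12 / \<tau>)"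
    have K: "1 \<le> K" using \<tau> by (simp add: K_def)
    have K2: "6 / K\<^sup>2 \<le> \<tau> / 2"
    proof -
      have "12 / \<tau> = (sqrt (12 / \<tau>))\<^sup>2" using \<tau> by simp
      also have "\<dots> \<le> K\<^sup>2" unfolding K_def using \<tau> by (intro power_mono) auto
      finally show ?thesis using K \<tau> by (simp add: field_simps)
    qed
    have lim: "(\<lambda>d. b d * K) \<longlonglongrightarrow> 0 * K" "(\<lambda>d. 40 * b d * K\<^sup>2) \<longlonglongrightarrow> 40 * 0 * K\<^sup>2"
      by (intro tendsto_intros b_tendsto)+
    have "\<forall>\<^sub>F d in sequentially. b d * K < 1 / 4" "\<forall>\<^sub>F d in sequentially. 40 * b d * K\<^sup>2 < \<eta>"
      using \<eta> by (intro order_tendstoD(2)[OF lim(1)] order_tendstoD(2)[OF lim(2)]; simp)+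
    moreover have "\<forall>\<^sub>F d in sequentially. 4 / real d < \<tau> / 2"
      using \<tau> by (intro order_tendstoD(2)[OF lim_const_over_n]) auto
    ultimately have "\<forall>\<^sub>F d in sequentially. measure (M d) {\<omega> \<in> space (M d). \<eta> * (1 + lam d) < \<bar>r i d \<omega>\<bar>} < \<tau>"
      using eventually_ge_at_top[of 1]
    proof eventually_elim
      case (elim d)
      then have d: "1 \<le> d" by simp
      interpret M: prob_space "M d" by (rule prob_M[OF d])
      let ?X = "\<lambda>i. {\<omega> \<in> space (M d). K < \<bar>\<xi>c i d \<omega>\<bar>}"
      let ?Z = "{\<omega> \<in> space (M d). K < \<bar>sqrt d * dotp d (Uc 0 d \<omega>) (Uc i d \<omega>)\<bar>}"
      have i3: "i \<le> 3" "0 \<noteq> i" using i by auto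
      have [measurable]: "Rc 0 d \<in> borel_measurable (M d)" "Rc i d \<in> borel_measurable (M d)"
        "Uc 0 d \<in> measurable (M d) (vec_borel d)" "Uc i d \<in> measurable (M d) (vec_borel d)"
        using rad vec d i3 by auto
      have [measurable]: "\<xi>c 0 d \<in> borel_measurable (M d)" "\<xi>c i d \<in> borel_measurable (M d)"
        unfolding xic[abs_def] by measurable
      have "{\<omega> \<in> space (M d). \<eta> * (1 + lam d) < \<bar>r i d \<omega>\<bar>} \<subseteq> ?X 0 \<union> ?X i \<union> ?Z"
      proof (rule ccontr)
        assume "\<not> ?thesis"
        then obtain \<omega> where "\<omega> \<in> {\<omega> \<in> space (M d). \<eta> * (1 + lam d) < \<bar>r i d \<omega>\<bar>}" "\<omega> \<notin> ?X 0 \<union> ?X i \<union> ?Z"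
          by blast
        then have \<omega>: "\<eta> * (1 + lam d) < \<bar>r i d \<omega>\<bar>" "\<bar>\<xi>c 0 d \<omega>\<bar> \<le> K" "\<bar>\<xi>c i d \<omega>\<bar> \<le> K" "\<bar>Z i d \<omega>\<bar> \<le> K"
          by (simp_all add: not_less Z)
        have p: "0 < \<kappa> d * \<rho> d" "0 < \<kappa> d * \<epsilon> d" using kappa_pos[OF d] rho_pos[OF d] eps_pos[OF d] by auto
        have R: "\<kappa> d * Rc j d \<omega> = \<kappa> d * \<rho> d + \<kappa> d * \<epsilon> d * \<xi>c j d \<omega>" for j
        proof -
          have "Rc j d \<omega> = \<rho> d + \<epsilon> d * \<xi>c j d \<omega>" using eps_pos[OF d] by (simp add: xic)
          then show ?thesis by (simp add: distrib_left)
        qed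
        have "\<bar>r i d \<omega>\<bar> \<le> 40 * b d * K\<^sup>2 * (1 + sqrt d * b d)"
          unfolding r_def R lam
          by (rule remainder_bound[OF p b _ \<omega>(2-4)]) (use elim in auto)
        also have "\<dots> \<le> \<eta> * (1 + lam d)"
          using elim b_pos[OF d] unfolding lam by (intro mult_right_mono) auto
        finally show False using \<omega>(1) by simp
      qed
      then have "measure (M d) {\<omega> \<in> space (M d). \<eta> * (1 + lam d) < \<bar>r i d \<omega>\<bar>}
        \<le> measure (M d) (?X 0 \<union> ?X i \<union> ?Z)"
        by (rule M.finite_measure_mono) measurable
      also have "\<dots> \<le> measure (M d) (?X 0 \<union> ?X i) + measure (M d) ?Z"
        by (rule measure_Un_le) measurable
      also have "measure (M d) (?X 0 \<union> ?X i) \<le> measure (M d) (?X 0) + measure (M d) (?X i)"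
        by (rule measure_Un_le) measurable
      finally have "measure (M d) {\<omega> \<in> space (M d). \<eta> * (1 + lam d) < \<bar>r i d \<omega>\<bar>}
        \<le> 1 / K\<^sup>2 + 1 / K\<^sup>2 + (4 / d + 4 / K\<^sup>2)"
        using radial_tail[OF d le0, of K] radial_tail[OF d i3(1), of K] dot_tail[OF d le0 i3, of K] K
          by linarith
      also have "\<dots> = 6 / K\<^sup>2 + 4 / d" by simp
      also have "\<dots> < \<tau>" using K2 elim by linarith
      finally show ?case .
    qed
    then show "\<exists>no. \<forall>d\<ge>no. norm (measure (M d) {\<omega> \<in> space (M d). \<eta> * (1 + lam d) < \<bar>r i d \<omega>\<bar>} - 0) < \<tau>"
      by (simp add: eventually_sequentially)
  qed
  have part2: "(lam \<in> O(\<lambda>_. 1) \<longrightarrow> (\<forall>i\<in>{1..3}. small_op M (r i) (\<lambda>_. 1)))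
      \<and> (filterlim lam at_top sequentially \<longrightarrow> (\<forall>i\<in>{1..3}. small_op M (r i) lam))"
    by (intro conjI impI ballI small_op_cases[OF prob_M]) (auto intro!: r_measurable remainder)

  have part3: "tendsto_in_prob M
      (\<lambda>d. real_cond_exp (M d) (prototype_algebra (M d) d (\<lambda>i. Rc i d) (\<lambda>i. Uc i d))
         (\<lambda>\<omega>. f (Z 1 d \<omega>, Z 2 d \<omega>, Z 3 d \<omega>))) (LINT z|std_normal3. f z)"
    if f: "continuous_on UNIV f" and bounded: "bounded (range f)" for f :: "real \<times> real \<times> real \<Rightarrow> real"
    unfolding tendsto_in_prob_def
  proof (intro allI impI)
    fix e :: real assume e: "0 < e"
    obtain B where B: "\<And>z. \<bar>f z\<bar> \<le> B" using bounded unfolding bounded_iff by auto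
    have [measurable]: "f \<in> borel_measurable borel" using f by (rule borel_measurable_continuous_onI)
    obtain D \<delta> where D: "1 \<le> D" "0 < \<delta>" and near:
      "\<And>d u v w. D \<le> d \<Longrightarrow> u \<in> space (vec_borel d) \<Longrightarrow> v \<in> space (vec_borel d) \<Longrightarrow> w \<in> space (vec_borel d) \<Longrightarrow>
      dotp d u u = 1 \<Longrightarrow> dotp d v v = 1 \<Longrightarrow> dotp d w w = 1 \<Longrightarrow>
      \<bar>dotp d u v\<bar> \<le> \<delta> \<Longrightarrow> \<bar>dotp d u w\<bar> \<le> \<delta> \<Longrightarrow> \<bar>dotp d v w\<bar> \<le> \<delta> \<Longrightarrow>
      \<bar>(LINT x|unif_sphere d. f (sqrt d * dotp d x u, sqrt d * dotp d x v, sqrt d * dotp d x w))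
        - (LINT z|std_normal3. f z)\<bar> \<le> e"
      by (rule sphere_projections_near_normal[OF f B e]) blast
    let ?ce = "\<lambda>d. real_cond_exp (M d) (prototype_algebra (M d) d (\<lambda>i. Rc i d) (\<lambda>i. Uc i d)) (\<lambda>\<omega>. f
      (Z 1 d \<omega>, Z 2 d \<omega>, Z 3 d \<omega>))"
    let ?I = "LINT z|std_normal3. f z"
    have bound: "measure (M d) {\<omega> \<in> space (M d). e < \<bar>?ce d \<omega> - ?I\<bar>} \<le> 3 * (4 / d + 4 / (\<delta>\<^sup>2 * d))" if dD: "D
      \<le> d" for d
    proof -
      have d: "1 \<le> d" using dD D by simp
      interpret M: prob_space "M d" by (rule prob_M[OF d])
      note [measurable] = vec[OF d]
      \<comment> \<open>The query is kept as a family indexed by \<open>{0}\<close>, so that it takes values in the same type as the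
        family of prototypes.\<close>
      let ?N = "\<lambda>I. Pi\<^sub>M I (\<lambda>_::nat. borel \<Otimes>\<^sub>M vec_borel d) :: (nat \<Rightarrow> real \<times> (nat \<Rightarrow> real)) measure"
      let ?X = "\<lambda>I \<omega>. \<lambda>i\<in>I. (Rc i d \<omega>, Uc i d \<omega>)"
      let ?h = "\<lambda>(y, p). f (sqrt d * dotp d (snd (y (0::nat))) (snd (p (1::nat))), sqrt d
        * dotp d (snd (y 0)) (snd (p 2)),
        sqrt d * dotp d (snd (y 0)) (snd (p 3)))"
      have ind: "M.indep_var (?N {0}) (?X {0}) (?N {1..3}) (?X {1..3})"
        by (rule M.indep_var_restrict[OF copies_indep[OF d]]) auto
      have h: "?h \<in> borel_measurable (?N {0} \<Otimes>\<^sub>M ?N {1..3})"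
      proof -
        have y: "(\<lambda>z. snd (fst z 0)) \<in> measurable (?N {0} \<Otimes>\<^sub>M ?N {1..3}) (vec_borel d)"
          by (rule measurable_compose[OF measurable_fst]) measurable
        have p: "(\<lambda>z. snd (snd z k)) \<in> measurable (?N {0} \<Otimes>\<^sub>M ?N {1..3}) (vec_borel d)" if "k \<in> {1..3}" for k
        proof -
          have "(\<lambda>q. q k) \<in> measurable (?N {1..3}) (borel \<Otimes>\<^sub>M vec_borel d)"
            using that by (rule measurable_component_singleton)
          from measurable_compose[OF measurable_compose[OF measurable_snd this] measurable_snd] show ?thesis .
        qed
        note [measurable] = y p[of 1, simplified] p[of 2, simplified] p[of 3, simplified]
        show ?thesis unfolding case_prod_unfold by measurable
      qed
      have "AE \<omega> in M d. real_cond_exp (M d) (vimage_algebra (space (M d)) (?X {1..3}) (?N {1..3})) (\<lambda>\<omega>. ?h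
        (?X {0} \<omega>, ?X {1..3} \<omega>)) \<omega>
          = (LINT y|distr (M d) (?N {0}) (?X {0}). ?h (y, ?X {1..3} \<omega>))"
        by (rule real_cond_exp_indep[OF prob_M[OF d] ind h]) (use B in \<open>auto split: prod.split\<close>)
      then have ce: "AE \<omega> in M d. ?ce d \<omega> = (LINT x|unif_sphere d. f (sqrt d * dotp d x (Uc 1 d \<omega>), sqrt d
        * dotp d x (Uc 2 d \<omega>), sqrt d * dotp d x (Uc 3 d \<omega>)))"
        using AE_space
      proof eventually_elim
        case (elim \<omega>)
        have [measurable]: "Uc 0 d \<in> measurable (M d) (vec_borel d)" "?X {0} \<in> measurable (M d) (?N {0})"
          using M.indep_var_rv1[OF ind] vec[OF d] by auto
        have X: "?X {1..3} \<omega> \<in> space (?N {1..3})"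
          by (rule measurable_space[OF M.indep_var_rv2[OF ind] elim(2)])
        have [measurable]: "Uc 1 d \<omega> \<in> space (vec_borel d)" "Uc 2 d \<omega> \<in> space (vec_borel d)" "Uc 3 d \<omega> \<in> space
          (vec_borel d)"
          using measurable_space[OF vec[OF d] elim(2)] by auto
        have "(\<lambda>y. ?h (y, ?X {1..3} \<omega>)) \<in> borel_measurable (?N {0})"
          by (rule measurable_Pair1[OF h X])
        then have "(LINT y|distr (M d) (?N {0}) (?X {0}). ?h (y, ?X {1..3} \<omega>))
          = (LINT \<omega>'|M d. ?h (?X {0} \<omega>', ?X {1..3} \<omega>))"
          by (subst integral_distr) auto
        also have "\<dots> = (LINT \<omega>'|M d. f (sqrt d * dotp d (Uc 0 d \<omega>') (Uc 1 d \<omega>), sqrt d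
          * dotp d (Uc 0 d \<omega>') (Uc 2 d \<omega>), sqrt d * dotp d (Uc 0 d \<omega>') (Uc 3 d \<omega>)))"
          by simp
        also have "\<dots> = (LINT x|unif_sphere d. f (sqrt d * dotp d x (Uc 1 d \<omega>), sqrt d
          * dotp d x (Uc 2 d \<omega>), sqrt d * dotp d x (Uc 3 d \<omega>)))"
          unfolding Uc_law[OF d le0, symmetric] by (rule integral_distr[symmetric]) measurable
        finally show ?case using elim(1) by (simp add: prototype_algebra_def Z)
      qed
      let ?B = "\<lambda>i j. {\<omega> \<in> space (M d). \<delta> * sqrt d < \<bar>sqrt d * dotp d (Uc i d \<omega>) (Uc j d \<omega>)\<bar>}"
      have "measure (M d) {\<omega> \<in> space (M d). e < \<bar>?ce d \<omega> - ?I\<bar>} \<le> measure (M d) (?B 1 2 \<union> ?B 1 3 \<union> ?B 2 3)"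
      proof (rule M.finite_measure_mono_AE)
        show "AE \<omega> in M d. \<omega> \<in> {\<omega> \<in> space (M d). e < \<bar>?ce d \<omega> - ?I\<bar>} \<longrightarrow> \<omega> \<in> ?B 1 2 \<union> ?B 1 3 \<union> ?B 2 3"
          using ce unit[OF d, of 1, simplified] unit[OF d, of 2, simplified] unit[OF d, of 3, simplified]
            AE_space
        proof eventually_elim
          case (elim \<omega>)
          have sp: "Uc i d \<omega> \<in> space (vec_borel d)" if "i \<le> 3" for i
            using measurable_space[OF vec[OF d that] elim(5)] .
          have s: "0 < sqrt (real d)" using d by simp
          have small: "\<bar>dotp d (Uc i d \<omega>) (Uc j d \<omega>)\<bar> \<le> \<delta>" if "\<omega> \<notin> ?B i j" for i j
            using that elim(5) s by (simp add: abs_mult not_less mult.commute[of \<delta>])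
          show ?case
          proof (rule impI, rule ccontr)
            assume \<omega>: "\<omega> \<in> {\<omega> \<in> space (M d). e < \<bar>?ce d \<omega> - ?I\<bar>}" and no: "\<omega> \<notin> ?B 1 2 \<union> ?B 1 3 \<union> ?B 2 3"
            have "\<bar>?ce d \<omega> - ?I\<bar> \<le> e"
              unfolding elim(1) by (rule near[OF dD]) (use no sp small elim in auto)
            then show False using \<omega> by simp
          qed
        qed
      qed measurable
      also have "\<dots> \<le> measure (M d) (?B 1 2 \<union> ?B 1 3) + measure (M d) (?B 2 3)"
        by (rule measure_Un_le) measurable
      also have "measure (M d) (?B 1 2 \<union> ?B 1 3) \<le> measure (M d) (?B 1 2) + measure (M d) (?B 1 3)"
        by (rule measure_Un_le) measurable
      finally have "measure (M d) {\<omega> \<in> space (M d). e < \<bar>?ce d \<omega> - ?I\<bar>}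
        \<le> measure (M d) (?B 1 2) + measure (M d) (?B 1 3) + measure (M d) (?B 2 3)"
        by simp
      moreover have "measure (M d) (?B i j) \<le> 4 / d + 4 / (\<delta> * sqrt d)\<^sup>2" if "i \<le> 3" "j \<le> 3" "i \<noteq> j" for i j
        using d D by (intro dot_tail[OF d that]) simp
      from this[of 1 2] this[of 1 3] this[of 2 3]
      have "measure (M d) (?B 1 2) + measure (M d) (?B 1 3) + measure (M d) (?B 2 3)
        \<le> 3 * (4 / d + 4 / (\<delta> * sqrt d)\<^sup>2)"
        by simp
      ultimately have "measure (M d) {\<omega> \<in> space (M d). e < \<bar>?ce d \<omega> - ?I\<bar>} \<le> 3 * (4 / d + 4 / (\<delta> * sqrt d)\<^sup>2)"
        by (rule order_trans)
      then show ?thesis using d by (simp add: power_mult_distrib)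
    qed
    have "(\<lambda>d. 3 * (4 / real d + 4 / \<delta>\<^sup>2 / real d)) \<longlonglongrightarrow> 3 * (0 + 0)"
      by (intro tendsto_mult tendsto_add tendsto_const lim_const_over_n)
    then have "(\<lambda>d. 3 * (4 / real d + 4 / (\<delta>\<^sup>2 * real d))) \<longlonglongrightarrow> 0" by simp
    then show "(\<lambda>d. measure (M d) {\<omega> \<in> space (M d). e < \<bar>?ce d \<omega> - ?I\<bar>}) \<longlonglongrightarrow> 0"
      by (rule Lim_null_comparison[rotated]) (use bound in \<open>auto simp: eventually_sequentially\<close>)
  qed
  show ?thesis
    using part1 r_measurable ordering part2 part3 by (intro conjI exI[of _ r]) auto
qed

end
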